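(* Assume that $f$ is $\mu$-quasi strongly convex, $\mu\ge0$, and the functions $f_{ij}$ are convex and $L$-smooth for all $i\in\{1,\dots,n\}$, $j\in\{1,\dots,m\}$. Consider EC-LSVRGstar with $p\in(0,1)$ and $$0<\gamma\le\min\left\{\frac3{56L},\ \frac{\delta}{8L\sqrt{3\left(1+\delta\left(1+\frac2{1-p}\right)\right)}}\right\}.$$ Then EC-LSVRGstar satisfies the parametric assumption of the context with $A=L$, $\widetilde A=A'=2L$, $B_1=\widetilde B_1=B_1'=B_2=0$, $\widetilde B_2=B_2'=2$, $D_1=\widetilde D_1=D_1'=0$, $\sigma_{1,k}^2\equiv0$, $C_1=0$, $\sigma_{2,k}^2=\sigma_k^2=\frac1{nm}\sum_{i=1}^n\sum_{j=1}^m\|\nabla f_{ij}(w_i^k)-\nabla f_{ij}(x^* )\|^2$, $\rho_1=1$, $\rho_2=p$, $C_2=Lp$, $D_2=0$, $G=0$, $F_1=0$, $F_2=\frac{48L\gamma^2(2+p)}{\delta p}$, $D_3=0$. Moreover, with $M_2=\frac8{3p}$ and $T^0=\|x^0-x^*\|^2+M_2\gamma^2\sigma_0^2$, for all $K\ge0$ $$\mathbf E[f(\bar x^K)-f(x^* )]\le\left(1-\min\left\{\frac{\gamma\mu}2,\frac p4\right\}\right)^K\frac{4(T^0+\gamma F_2\sigma_0^2)}\gamma$$ when $\mu>0$, and $$\mathbf E[f(\bar x^K)-f(x^* )]\le\frac{4(T^0+\gamma F_2\sigma_0^2)}{\gamma K}$$ when $\mu=0$ (right-hand side read as $+\infty$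 for $K=0$).
   Context: $f(x)=\frac1n\sum_{i=1}^nf_i(x)$, $f_i(x)=\frac1m\sum_{j=1}^mf_{ij}(x)$ on $\mathbb R^d$. A function is $L$-smooth if it is differentiable with $L$-Lipschitz gradient. $f$ is $\mu$-quasi strongly convex if it has a unique minimizer $x^*$ and $f(x^* )\ge f(x)+\langle\nabla f(x),x^*-x\rangle+\frac\mu2\|x-x^*\|^2$ for all $x$. $\mathcal C$ is a (possibly randomized) compression operator with $\mathbf E\|\mathcal C(x)-x\|^2\le(1-\delta)\|x\|^2$ for all $x$, $\delta\in(0,1]$. All random choices use fresh independent randomness. EC-LSVRGstar: given deterministic $x^0,w_i^0\in\mathbb R^d$, $e_i^0=0$; at iteration $k\ge0$ each worker $i$ picks $l$ uniformly from $\{1,\dots,m\}$, sets $g_i^k=\nabla f_{il}(x^k)-\nabla f_{il}(w_i^k)+\nabla f_i(w_i^k)-\nabla f_i(x^* )$, $v_i^k=\mathcal C(e_i^k+\gamma g_i^k)$, $e_i^{k+1}=e_i^k+\gamma g_i^k-v_i^k$, and $w_i^{k+1}=x^k$ with probability $p$, $w_i^{k+1}=w_i^k$ with probability $1-p$; then $x^{k+1}=x^k-\frac1n\sum_iv_i^k$. Parametric assumption: let $g^k=\frac1n\sum_ig_i^k$, $e^k=\frac1n\sum_ie_i^k$, $\mathbf E_k$ the conditional expectation given all randomness generated before iteration $k$, $\bar g_i^k=\mathbf E_k[g_i^k]$. For all $k,K\ge0$: $\mathbf E_k[g^k]=\nabla f(x^k)$; $\frac1n\sum_i\|\bar g_i^k\|^2\le2A(f(x^k)-f(x^*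 ))+B_1\sigma_{1,k}^2+B_2\sigma_{2,k}^2+D_1$; $\frac1n\sum_i\mathbf E_k\|g_i^k-\bar g_i^k\|^2\le2\widetilde A(f(x^k)-f(x^* ))+\widetilde B_1\sigma_{1,k}^2+\widetilde B_2\sigma_{2,k}^2+\widetilde D_1$; $\mathbf E_k\|g^k\|^2\le2A'(f(x^k)-f(x^* ))+B_1'\sigma_{1,k}^2+B_2'\sigma_{2,k}^2+D_1'$; $\mathbf E_k[\sigma_{1,k+1}^2]\le(1-\rho_1)\sigma_{1,k}^2+2C_1(f(x^k)-f(x^* ))+G\rho_1\sigma_{2,k}^2+D_2$; $\mathbf E_k[\sigma_{2,k+1}^2]\le(1-\rho_2)\sigma_{2,k}^2+2C_2(f(x^k)-f(x^* ))$; $3L\sum_{k=0}^Kw_k\mathbf E\|e^k\|^2\le\frac14\sum_{k=0}^Kw_k\mathbf E[f(x^k)-f(x^* )]+F_1\sigma_{1,0}^2+F_2\sigma_{2,0}^2+\gamma D_3W_K$, where (scalar weights) $w_k=(1-\eta)^{-(k+1)}$, $W_K=\sum_{k=0}^Kw_k$, $\eta=\min\{\frac{\gamma\mu}2,\frac{\rho_1}4,\frac{\rho_2}4\}$. Also $\bar x^K=\frac1{W_K}\sum_{k=0}^Kw_kx^k$. *)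

theory Defs
  imports "HOL-Probability.Probability"
begin

section \<open>The optimization problem\<close>

text \<open>Only meaningful where \<open>f\<close> is differentiable; on a Euclidean space the gradient is unique there.\<close>

definition grad :: "('a::euclidean_space \<Rightarrow> real) \<Rightarrow> 'a \<Rightarrow> 'a" where
  "grad f x = (THE D. GDERIV f x :> D)"

definition L_smooth :: "real \<Rightarrow> ('a::euclidean_space \<Rightarrow> real) \<Rightarrow> bool" where
  "L_smooth L f \<longleftrightarrow> (\<forall>x. f differentiable (at x)) \<and> L-lipschitz_on UNIV (grad f)"

text \<open>The minimizer is an explicit argument because the algorithm and the bounds refer to it.\<close>

definition quasi_strongly_convex :: "real \<Rightarrow> ('a::euclidean_space \<Rightarrow> real) \<Rightarrow> 'a \<Rightarrow> bool" where
  "quasi_strongly_convex \<mu> f xs \<longleftrightarrow>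
     {x. \<forall>y. f x \<le> f y} = {xs} \<and>
     (\<forall>x. f xs \<ge> f x + grad f x \<bullet> (xs - x) + \<mu> / 2 * (norm (x - xs))\<^sup>2)"

definition worker_avg :: "nat \<Rightarrow> (nat \<Rightarrow> nat \<Rightarrow> 'a \<Rightarrow> real) \<Rightarrow> nat \<Rightarrow> 'a \<Rightarrow> real" where
  "worker_avg m f i x = (1 / real m) * (\<Sum>j=1..m. f i j x)"

definition total_avg :: "nat \<Rightarrow> nat \<Rightarrow> (nat \<Rightarrow> nat \<Rightarrow> 'a \<Rightarrow> real) \<Rightarrow> 'a \<Rightarrow> real" where
  "total_avg n m f x = (1 / real n) * (\<Sum>i=1..n. worker_avg m f i x)"

definition grad_shift_sq ::
    "nat \<Rightarrow> nat \<Rightarrow> (nat \<Rightarrow> nat \<Rightarrow> 'a::euclidean_space \<Rightarrow> real) \<Rightarrow> 'a \<Rightarrow> (nat \<Rightarrow> 'a) \<Rightarrow> real" where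
  "grad_shift_sq n m f xs w =
     (1 / (real n * real m)) * (\<Sum>i=1..n. \<Sum>j=1..m. (norm (grad (f i j) (w i) - grad (f i j) xs))\<^sup>2)"

section \<open>The algorithm\<close>

text \<open>A randomized operator is a jointly measurable function of a random seed with law \<open>Q\<close> and of
  the compressed vector.\<close>

definition compressor :: "real \<Rightarrow> 'c measure \<Rightarrow> ('c \<Rightarrow> 'a \<Rightarrow> 'a::euclidean_space) \<Rightarrow> bool" where
  "compressor \<delta> Q C \<longleftrightarrow>
     prob_space Q \<and> (\<lambda>(s, x). C s x) \<in> borel_measurable (Q \<Otimes>\<^sub>M borel) \<and> 0 < \<delta> \<and> \<delta> \<le> 1 \<and>
     (\<forall>x. integrable Q (\<lambda>s. (norm (C s x - x))\<^sup>2) \<and>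
          (\<integral>s. (norm (C s x - x))\<^sup>2 \<partial>Q) \<le> (1 - \<delta>) * (norm x)\<^sup>2)"

text \<open>Law of the randomness used by one worker in one iteration: a uniform index in \<open>{1..m}\<close>, a
  seed for the compressor and the coin that decides (with probability \<open>p\<close>) to refresh the reference
  point. The product makes the three components independent. The space of the
  first factor is \<open>{1..m}\<close>, so the index lies in this set surely, not just almost surely (nothing is
  assumed about \<open>f i j\<close> for other \<open>j\<close>, not even measurability).\<close>

definition step_law :: "nat \<Rightarrow> 'c measure \<Rightarrow> real \<Rightarrow> (nat \<times> 'c \<times> bool) measure" where
  "step_law m Q p = uniform_count_measure {1..m} \<Otimes>\<^sub>M (Q \<Otimes>\<^sub>M measure_pmf (bernoulli_pmf p))"

definition fresh_randomness ::
    "'w measure \<Rightarrow> nat \<Rightarrow> 'z measure \<Rightarrow> (nat \<Rightarrow> nat \<Rightarrow> 'w \<Rightarrow> 'z) \<Rightarrow> bool" where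
  "fresh_randomness M n N Z \<longleftrightarrow>
     prob_space.indep_vars M (\<lambda>_. N) (\<lambda>(k, i). Z k i) (UNIV \<times> {1..n}) \<and>
     (\<forall>k. \<forall>i\<in>{1..n}. distr M N (Z k i) = N)"

text \<open>The sigma-algebra of all randomness generated before iteration \<open>k\<close>.\<close>

definition past ::
    "'w measure \<Rightarrow> nat \<Rightarrow> 'z measure \<Rightarrow> (nat \<Rightarrow> nat \<Rightarrow> 'w \<Rightarrow> 'z) \<Rightarrow> nat \<Rightarrow> 'w measure" where
  "past M n N Z k =
     sigma (space M) (\<Union>j\<in>{..<k}. \<Union>i\<in>{1..n}. {Z j i -` A \<inter> space M | A. A \<in> sets N})"

definition EC_LSVRGstar ::
    "nat \<Rightarrow> nat \<Rightarrow> (nat \<Rightarrow> nat \<Rightarrow> 'a::euclidean_space \<Rightarrow> real) \<Rightarrow> 'a \<Rightarrow> real \<Rightarrow> ('c \<Rightarrow> 'a \<Rightarrow> 'a) \<Rightarrow>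
     'a \<Rightarrow> (nat \<Rightarrow> 'a) \<Rightarrow> 'w measure \<Rightarrow> (nat \<Rightarrow> nat \<Rightarrow> 'w \<Rightarrow> nat \<times> 'c \<times> bool) \<Rightarrow>
     (nat \<Rightarrow> 'w \<Rightarrow> 'a) \<Rightarrow> (nat \<Rightarrow> nat \<Rightarrow> 'w \<Rightarrow> 'a) \<Rightarrow> (nat \<Rightarrow> nat \<Rightarrow> 'w \<Rightarrow> 'a) \<Rightarrow>
     (nat \<Rightarrow> nat \<Rightarrow> 'w \<Rightarrow> 'a) \<Rightarrow> (nat \<Rightarrow> nat \<Rightarrow> 'w \<Rightarrow> 'a) \<Rightarrow> bool" where
  "EC_LSVRGstar n m f xs \<gamma> C x0 w0 M Z x w e g v \<longleftrightarrow>
     (\<forall>\<omega>\<in>space M.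
        x 0 \<omega> = x0 \<and> (\<forall>i\<in>{1..n}. w 0 i \<omega> = w0 i \<and> e 0 i \<omega> = 0) \<and>
        (\<forall>k.
          (\<forall>i\<in>{1..n}. case Z k i \<omega> of (l, s, b) \<Rightarrow>
             g k i \<omega> = grad (f i l) (x k \<omega>) - grad (f i l) (w k i \<omega>)
                       + grad (worker_avg m f i) (w k i \<omega>) - grad (worker_avg m f i) xs \<and>
             v k i \<omega> = C s (e k i \<omega> + \<gamma> *\<^sub>R g k i \<omega>) \<and>
             e (Suc k) i \<omega> = e k i \<omega> + \<gamma> *\<^sub>R g k i \<omega> - v k i \<omega> \<and>
             w (Suc k) i \<omega> = (if b then x k \<omega> else w k i \<omega>)) \<and>
          x (Suc k) \<omega> = x k \<omega> - (1 / real n) *\<^sub>R (\<Sum>i=1..n. v k i \<omega>)))"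

section \<open>The parametric assumption\<close>

text \<open>Conditional expectation of a vector, coordinatewise.\<close>

definition vec_cond_exp ::
    "'w measure \<Rightarrow> 'w measure \<Rightarrow> ('w \<Rightarrow> 'a::euclidean_space) \<Rightarrow> 'w \<Rightarrow> 'a" where
  "vec_cond_exp M F X \<omega> = (\<Sum>b\<in>Basis. real_cond_exp M F (\<lambda>\<omega>. X \<omega> \<bullet> b) \<omega> *\<^sub>R b)"

text \<open>Integrability is part of the claim: expectations of non-integrable functions have junk
  values in the library.\<close>

definition cond_exp_le :: "'w measure \<Rightarrow> 'w measure \<Rightarrow> ('w \<Rightarrow> real) \<Rightarrow> ('w \<Rightarrow> real) \<Rightarrow> bool" where
  "cond_exp_le M F X Y \<longleftrightarrow> integrable M X \<and> (AE \<omega> in M. real_cond_exp M F X \<omega> \<le> Y \<omega>)"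

text \<open>Suffix \<open>t\<close> stands for a tilde and suffix \<open>p\<close> for a prime: \<open>cB1t\<close> is the constant
  \<open>B\<^sub>1\<close> with a tilde, \<open>cB1p\<close> is \<open>B\<^sub>1'\<close>.\<close>

record param_consts =
  cA :: real   cB1 :: real   cB2 :: real   cD1 :: real
  cAt :: real  cB1t :: real  cB2t :: real  cD1t :: real
  cAp :: real  cB1p :: real  cB2p :: real  cD1p :: real
  crho1 :: real  cC1 :: real  cG :: real  cD2 :: real
  crho2 :: real  cC2 :: real
  cF1 :: real  cF2 :: real  cD3 :: real

definition rate :: "real \<Rightarrow> real \<Rightarrow> param_consts \<Rightarrow> real" where
  "rate \<gamma> \<mu> c = Min {\<gamma> * \<mu> / 2, crho1 c / 4, crho2 c / 4}"

definition weight :: "real \<Rightarrow> nat \<Rightarrow> real" where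
  "weight \<eta> k = 1 / (1 - \<eta>) ^ (k + 1)"

definition weight_sum :: "real \<Rightarrow> nat \<Rightarrow> real" where
  "weight_sum \<eta> K = (\<Sum>k=0..K. weight \<eta> k)"

definition weighted_avg :: "real \<Rightarrow> (nat \<Rightarrow> 'w \<Rightarrow> 'a::real_vector) \<Rightarrow> nat \<Rightarrow> 'w \<Rightarrow> 'a" where
  "weighted_avg \<eta> x K \<omega> = (1 / weight_sum \<eta> K) *\<^sub>R (\<Sum>k=0..K. weight \<eta> k *\<^sub>R x k \<omega>)"

text \<open>\<open>F k\<close> is the sigma-algebra of \<open>\<^bold>E\<^sub>k\<close>, \<open>f\<close> the (averaged) objective; the processes \<open>s1\<close> and
  \<open>s2\<close> are the squares \<open>\<sigma>\<^sub>1\<^sup>2\<close> and \<open>\<sigma>\<^sub>2\<^sup>2\<close> themselves.\<close>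

definition parametric_assumption ::
    "'w measure \<Rightarrow> (nat \<Rightarrow> 'w measure) \<Rightarrow> nat \<Rightarrow> ('a::euclidean_space \<Rightarrow> real) \<Rightarrow> 'a \<Rightarrow>
     real \<Rightarrow> real \<Rightarrow> real \<Rightarrow>
     (nat \<Rightarrow> 'w \<Rightarrow> 'a) \<Rightarrow> (nat \<Rightarrow> nat \<Rightarrow> 'w \<Rightarrow> 'a) \<Rightarrow> (nat \<Rightarrow> nat \<Rightarrow> 'w \<Rightarrow> 'a) \<Rightarrow>
     (nat \<Rightarrow> 'w \<Rightarrow> real) \<Rightarrow> (nat \<Rightarrow> 'w \<Rightarrow> real) \<Rightarrow> param_consts \<Rightarrow> bool" where
  "parametric_assumption M F n f xs L \<mu> \<gamma> x e g s1 s2 c \<longleftrightarrow>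
    (let gavg = (\<lambda>k \<omega>. (1 / real n) *\<^sub>R (\<Sum>i=1..n. g k i \<omega>));
         eavg = (\<lambda>k \<omega>. (1 / real n) *\<^sub>R (\<Sum>i=1..n. e k i \<omega>));
         gbar = (\<lambda>k i. vec_cond_exp M (F k) (g k i));
         gap = (\<lambda>k \<omega>. f (x k \<omega>) - f xs);
         \<eta> = rate \<gamma> \<mu> c
     in
      (\<forall>k. \<forall>i\<in>{1..n}. integrable M (g k i)) \<and>
      (\<forall>k. integrable M (gap k)) \<and>
      (\<forall>k. integrable M (\<lambda>\<omega>. (norm (eavg k \<omega>))\<^sup>2)) \<and>
      (\<forall>k. AE \<omega> in M. vec_cond_exp M (F k) (gavg k) \<omega> = grad f (x k \<omega>)) \<and>
      (\<forall>k. AE \<omega> in M.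
         (1 / real n) * (\<Sum>i=1..n. (norm (gbar k i \<omega>))\<^sup>2)
           \<le> 2 * cA c * gap k \<omega> + cB1 c * s1 k \<omega> + cB2 c * s2 k \<omega> + cD1 c) \<and>
      (\<forall>k. \<forall>i\<in>{1..n}. integrable M (\<lambda>\<omega>. (norm (g k i \<omega> - gbar k i \<omega>))\<^sup>2)) \<and>
      (\<forall>k. AE \<omega> in M.
         (1 / real n) * (\<Sum>i=1..n. real_cond_exp M (F k) (\<lambda>\<omega>. (norm (g k i \<omega> - gbar k i \<omega>))\<^sup>2) \<omega>)
           \<le> 2 * cAt c * gap k \<omega> + cB1t c * s1 k \<omega> + cB2t c * s2 k \<omega> + cD1t c) \<and>
      (\<forall>k. cond_exp_le M (F k) (\<lambda>\<omega>. (norm (gavg k \<omega>))\<^sup>2)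
         (\<lambda>\<omega>. 2 * cAp c * gap k \<omega> + cB1p c * s1 k \<omega> + cB2p c * s2 k \<omega> + cD1p c)) \<and>
      (\<forall>k. cond_exp_le M (F k) (s1 (k + 1))
         (\<lambda>\<omega>. (1 - crho1 c) * s1 k \<omega> + 2 * cC1 c * gap k \<omega> + cG c * crho1 c * s2 k \<omega> + cD2 c)) \<and>
      (\<forall>k. cond_exp_le M (F k) (s2 (k + 1))
         (\<lambda>\<omega>. (1 - crho2 c) * s2 k \<omega> + 2 * cC2 c * gap k \<omega>)) \<and>
      (\<forall>K. AE \<omega> in M.
         3 * L * (\<Sum>k=0..K. weight \<eta> k * (\<integral>\<omega>'. (norm (eavg k \<omega>'))\<^sup>2 \<partial>M))
           \<le> 1 / 4 * (\<Sum>k=0..K. weight \<eta> k * (\<integral>\<omega>'. gap k \<omega>' \<partial>M))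
             + cF1 c * s1 0 \<omega> + cF2 c * s2 0 \<omega> + \<gamma> * cD3 c * weight_sum \<eta> K))"

end

theory Submission
  imports Defs
begin

text \<open>The proof compares the iterates with the virtual sequence
\<open>z\<^sub>k = x\<^sub>k - e\<^sub>k\<close>, where \<open>e\<^sub>k\<close> is the average of the error memories. What a worker does not
transmit stays in its memory, so the compressor cancels from the recursion and
\<open>z\<^sub>k\<^sub>+\<^sub>1 = z\<^sub>k - \<gamma> g\<^sub>k\<close> holds exactly (lemma \<open>virtual_step\<close>): the virtual sequence is plain
stochastic gradient descent with the unbiased estimator \<open>g\<^sub>k\<close>, except that the gradient is
taken at \<open>x\<^sub>k\<close> instead of \<open>z\<^sub>k\<close>. By \<open>perturbed_descent\<close> this discrepancy costs \<open>3 L \<gamma> \<parallel>e\<^sub>k\<parallel>\<^sup>2\<close> per step.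

The estimator satisfies moment bounds in terms of the gap \<open>f(x\<^sub>k) - f(x*)\<close> and of the
gradient shift \<open>\<sigma>\<^sub>k\<^sup>2\<close> of the reference points. All of them come from one inequality for
a convex smooth function, \<open>convex_L_smooth_grad_bound\<close>, together with the fact that a
variance is at most a second moment. The shift contracts by \<open>1 - p\<close> per step, up to a multiple of
the gap, because a reference point is refreshed with probability \<open>p\<close>. Hence the Lyapunov
function \<open>\<parallel>z\<^sub>k - x*\<parallel>\<^sup>2 + 8 / (3 p) \<gamma>\<^sup>2 \<sigma>\<^sub>k\<^sup>2\<close> decreases by half the gap, times \<open>\<gamma>\<close>, up to the
error term (lemma \<open>lyapunov_budget\<close>).

The error memory contracts by \<open>1 - \<delta>/2\<close> and is fed with \<open>\<gamma>\<^sup>2\<close> times the moments of the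
estimator. The weights grow slowly, as \<open>\<eta> \<le> \<delta>/27\<close> and \<open>\<eta> \<le> p/4\<close>, so both contractions survive
weighting (lemma \<open>weighted_contraction_sum\<close>) and the restriction on \<open>\<gamma>\<close> makes the weighted sum
of \<open>3 L \<parallel>e\<^sub>k\<parallel>\<^sup>2\<close> at most a quarter of the weighted sum of gaps plus a multiple of \<open>\<sigma>\<^sub>0\<^sup>2\<close>
(lemma \<open>error_budget\<close>). A quarter of the weighted sum of gaps is then left over, and convexity
turns it into a bound for the averaged iterate. The bound \<open>\<eta> \<le> \<delta>/27\<close> rests on
\<open>\<mu> \<le> L\<close> (lemma \<open>mu_le_L\<close>).

On the probabilistic side, the draw of a worker is independent of the past. Conditional
expectations given the past are therefore computed by freezing the past and integrating over the
law of the draw (lemma \<open>cond_exp_freeze\<close>). All iterates have finite second moments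
(lemma \<open>state_regular\<close>), which gives every integrability claim.\<close>

section \<open>Smooth convex functions\<close>

lemma grad_eqI:
  fixes f :: "'a::euclidean_space \<Rightarrow> real"
  assumes "GDERIV f x :> D"
  shows "grad f x = D"
proof -
  have "E = D" if "GDERIV f x :> E" for E
  proof -
    have "(\<lambda>h. h \<bullet> E) = (\<lambda>h. h \<bullet> D)"
      using that assms unfolding gderiv_def by (rule has_derivative_unique)
    from fun_cong[OF this, of "E - D"] have "(E - D) \<bullet> (E - D) = 0"
      by (simp only: inner_diff_right)
    then show ?thesis by (simp only: inner_eq_zero_iff right_minus_eq)
  qed
  with assms show ?thesis unfolding grad_def by blast
qed

text \<open>The gradient is the vector of the values of the derivative on the orthonormal basis.\<close>

lemma GDERIV_grad:
  fixes f :: "'a::euclidean_space \<Rightarrow> real"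
  assumes "f differentiable (at x)"
  shows "GDERIV f x :> grad f x"
proof -
  obtain f' where f': "(f has_derivative f') (at x)"
    using assms unfolding differentiable_def by blast
  then interpret bounded_linear f' by (rule has_derivative_bounded_linear)
  have "f' h = h \<bullet> (\<Sum>b\<in>Basis. f' b *\<^sub>R b)" for h
  proof -
    have "f' h = f' (\<Sum>b\<in>Basis. (h \<bullet> b) *\<^sub>R b)" by (simp only: euclidean_representation)
    also have "\<dots> = (\<Sum>b\<in>Basis. (h \<bullet> b) * f' b)" by (simp only: sum scaleR real_scaleR_def)
    finally show ?thesis by (simp add: inner_sum_right mult.commute)
  qed
  then have "GDERIV f x :> (\<Sum>b\<in>Basis. f' b *\<^sub>R b)"
    unfolding gderiv_def by (rule has_derivative_eq_rhs[OF f', OF ext])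
  with grad_eqI[OF this] show ?thesis by simp
qed

lemma L_smooth_GDERIV: "L_smooth L f \<Longrightarrow> GDERIV f x :> grad f x"
  by (simp add: L_smooth_def GDERIV_grad)

lemma L_smooth_lipschitz: "L_smooth L f \<Longrightarrow> norm (grad f x - grad f y) \<le> L * norm (x - y)"
  using lipschitz_onD[of L UNIV "grad f" x y] by (simp add: L_smooth_def dist_norm)

lemma L_smooth_grad_measurable: "L_smooth L f \<Longrightarrow> grad f \<in> borel_measurable borel"
  unfolding L_smooth_def
  by (intro borel_measurable_continuous_onI lipschitz_on_continuous_on) auto

lemma L_smooth_measurable: "L_smooth L f \<Longrightarrow> f \<in> borel_measurable borel"
  unfolding L_smooth_def
  by (intro borel_measurable_continuous_onI differentiable_imp_continuous_on)
     (simp add: differentiable_on_def)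

text \<open>Restriction to a line turns the two global bounds below, from above by smoothness and from
  below by convexity, into statements about one real variable.\<close>

lemma DERIV_along_line:
  assumes "GDERIV f (x + t *\<^sub>R d) :> D"
  shows "((\<lambda>t. f (x + t *\<^sub>R d)) has_real_derivative d \<bullet> D) (at t)"
proof -
  have "(f has_derivative (\<lambda>h. h \<bullet> D)) (at (x + t *\<^sub>R d))"
    using assms by (simp add: gderiv_def)
  moreover have "((\<lambda>t. x + t *\<^sub>R d) has_derivative (\<lambda>s. s *\<^sub>R d)) (at t)"
    by (auto intro!: derivative_eq_intros)
  ultimately have "((\<lambda>t. f (x + t *\<^sub>R d)) has_derivative (\<lambda>s. (s *\<^sub>R d) \<bullet> D)) (at t)"
    using has_derivative_compose by blast
  then show ?thesis
    unfolding has_field_derivative_def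
    by (rule has_derivative_eq_rhs) (simp add: fun_eq_iff)
qed

text \<open>The descent lemma. Along the segment from \<open>x\<close> to \<open>y\<close>, the difference between \<open>f\<close> and its
  quadratic model has a nonpositive derivative, because the gradient moves by at most \<open>L\<close> times the
  distance travelled.\<close>

lemma L_smooth_upper_bound:
  fixes f :: "'a::euclidean_space \<Rightarrow> real"
  assumes f: "L_smooth L f"
  shows "f y \<le> f x + grad f x \<bullet> (y - x) + L / 2 * (norm (y - x))\<^sup>2"
proof -
  define d where "d = y - x"
  define \<phi> where "\<phi> t = f (x + t *\<^sub>R d) - t * (d \<bullet> grad f x) - L * t\<^sup>2 / 2 * (norm d)\<^sup>2" for t
  have deriv: "(\<phi> has_real_derivative
      d \<bullet> grad f (x + t *\<^sub>R d) - d \<bullet> grad f x - L * t * (norm d)\<^sup>2) (at t)" for t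
    unfolding \<phi>_def
    by (auto intro!: derivative_eq_intros DERIV_along_line[OF L_smooth_GDERIV[OF f]])
  have "\<phi> 1 \<le> \<phi> 0"
  proof (rule DERIV_nonpos_imp_nonincreasing[of 0 1 \<phi>])
    fix t :: real assume t: "0 \<le> t" "t \<le> 1"
    have "d \<bullet> (grad f (x + t *\<^sub>R d) - grad f x) \<le> norm d * norm (grad f (x + t *\<^sub>R d) - grad f x)"
      by (rule norm_cauchy_schwarz)
    also have "\<dots> \<le> norm d * (L * norm (x + t *\<^sub>R d - x))"
      by (intro mult_left_mono L_smooth_lipschitz f) auto
    also have "\<dots> = L * t * (norm d)\<^sup>2"
      using t by (simp add: power2_eq_square)
    finally have "d \<bullet> grad f (x + t *\<^sub>R d) - d \<bullet> grad f x - L * t * (norm d)\<^sup>2 \<le> 0"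
      by (simp add: inner_diff_right)
    with deriv show "\<exists>y. (\<phi> has_real_derivative y) (at t) \<and> y \<le> 0"
      by (intro exI conjI)
  qed simp
  then show ?thesis by (simp add: \<phi>_def d_def inner_commute)
qed

lemma convex_above_tangent:
  fixes f :: "'a::euclidean_space \<Rightarrow> real"
  assumes cvx: "convex_on UNIV f" and f: "L_smooth L f"
  shows "f x + grad f x \<bullet> (y - x) \<le> f y"
proof -
  define \<psi> where "\<psi> t = f (x + t *\<^sub>R (y - x))" for t
  have "convex_on UNIV \<psi>"
  proof (rule convex_onI)
    fix t a b :: real assume t: "0 < t" "t < 1"
    have "x + ((1 - t) *\<^sub>R a + t *\<^sub>R b) *\<^sub>R (y - x)
        = (1 - t) *\<^sub>R (x + a *\<^sub>R (y - x)) + t *\<^sub>R (x + b *\<^sub>R (y - x))"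
      by (simp add: algebra_simps)
    then show "\<psi> ((1 - t) *\<^sub>R a + t *\<^sub>R b) \<le> (1 - t) * \<psi> a + t * \<psi> b"
      using convex_onD[OF cvx, of t "x + a *\<^sub>R (y - x)" "x + b *\<^sub>R (y - x)"] t
      by (simp add: \<psi>_def)
  qed simp
  moreover have "(\<psi> has_real_derivative (y - x) \<bullet> grad f x) (at 0 within UNIV)"
    unfolding \<psi>_def using DERIV_along_line[of f x 0 "y - x"] L_smooth_GDERIV[OF f, of x] by simp
  ultimately have "\<psi> 1 - \<psi> 0 \<ge> (y - x) \<bullet> grad f x * (1 - 0)"
    by (intro convex_on_imp_above_tangent) auto
  then show ?thesis by (simp add: \<psi>_def inner_commute)
qed

text \<open>The tangent at \<open>y\<close> bounds \<open>f\<close> from below and the descent lemma at \<open>x\<close> bounds it from above.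
  Both are evaluated at the point \<open>z\<close> reached from \<open>x\<close> by a step of size \<open>1 / L\<close> against the
  difference of the two gradients, which minimizes the upper bound minus the lower one.\<close>

lemma convex_L_smooth_grad_bound:
  fixes f :: "'a::euclidean_space \<Rightarrow> real"
  assumes cvx: "convex_on UNIV f" and f: "L_smooth L f" and L: "L > 0"
  shows "(norm (grad f x - grad f y))\<^sup>2 \<le> 2 * L * (f x - f y - grad f y \<bullet> (x - y))"
proof -
  define h where "h = grad f x - grad f y"
  define z where "z = x - (1 / L) *\<^sub>R h"
  have "f y + grad f y \<bullet> (z - y) \<le> f z" by (rule convex_above_tangent[OF cvx f])
  also have "f z \<le> f x + grad f x \<bullet> (z - x) + L / 2 * (norm (z - x))\<^sup>2"
    by (rule L_smooth_upper_bound[OF f])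
  also have "L / 2 * (norm (z - x))\<^sup>2 = 1 / (2 * L) * (norm h)\<^sup>2"
    using L by (simp add: z_def power2_eq_square field_simps)
  also have "grad f x \<bullet> (z - x) = - (1 / L) * (grad f x \<bullet> h)"
    by (simp add: z_def)
  also have "grad f y \<bullet> (z - y) = grad f y \<bullet> (x - y) - (1 / L) * (grad f y \<bullet> h)"
    by (simp add: z_def inner_diff_right)
  finally have "f y + grad f y \<bullet> (x - y) + (1 / L) * (grad f x \<bullet> h - grad f y \<bullet> h)
      - 1 / (2 * L) * (norm h)\<^sup>2 \<le> f x"
    by (simp add: right_diff_distrib)
  also have "grad f x \<bullet> h - grad f y \<bullet> h = (norm h)\<^sup>2"
    by (simp add: h_def inner_diff_left[symmetric] power2_norm_eq_inner)
  finally have "1 / (2 * L) * (norm h)\<^sup>2 \<le> f x - f y - grad f y \<bullet> (x - y)"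
    by simp
  then show ?thesis using L by (simp add: h_def field_simps)
qed

lemma L_smooth_average:
  fixes h :: "nat \<Rightarrow> 'a::euclidean_space \<Rightarrow> real"
  assumes "n \<ge> 1" and h: "\<And>i. i \<in> {1..n} \<Longrightarrow> L_smooth L (h i)"
  shows "grad (\<lambda>x. 1 / real n * (\<Sum>i=1..n. h i x)) x = (1 / real n) *\<^sub>R (\<Sum>i=1..n. grad (h i) x)"
    and "L_smooth L (\<lambda>x. 1 / real n * (\<Sum>i=1..n. h i x))"
proof -
  let ?h = "\<lambda>x. 1 / real n * (\<Sum>i=1..n. h i x)"
  have der: "(?h has_derivative (\<lambda>d. 1 / real n * (\<Sum>i=1..n. d \<bullet> grad (h i) x))) (at x)" for x
    using L_smooth_GDERIV[OF h] unfolding gderiv_def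
    by (intro has_derivative_mult_right has_derivative_sum) auto
  then have "GDERIV ?h x :> (1 / real n) *\<^sub>R (\<Sum>i=1..n. grad (h i) x)" for x
    unfolding gderiv_def by (rule has_derivative_eq_rhs) (simp add: inner_sum_right)
  from grad_eqI[OF this]
  show grad: "grad ?h x = (1 / real n) *\<^sub>R (\<Sum>i=1..n. grad (h i) x)" for x .
  have "L \<ge> 0" using h[of 1] assms(1) by (auto simp: L_smooth_def dest: lipschitz_on_nonneg)
  have "norm (grad ?h x - grad ?h y) \<le> L * norm (x - y)" for x y
  proof -
    have "norm (grad ?h x - grad ?h y) = 1 / real n * norm (\<Sum>i=1..n. grad (h i) x - grad (h i) y)"
      unfolding grad sum_subtractf by (simp flip: scaleR_diff_right)
    also have "\<dots> \<le> 1 / real n * (\<Sum>i=1..n. L * norm (x - y))"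
      by (intro mult_left_mono sum_norm_le L_smooth_lipschitz h) auto
    also have "\<dots> = L * norm (x - y)" using assms(1) by simp
    finally show ?thesis .
  qed
  then show "L_smooth L ?h"
    unfolding L_smooth_def using der \<open>L \<ge> 0\<close>
    by (auto simp: dist_norm differentiable_def intro!: lipschitz_onI)
qed

lemma convex_on_average:
  fixes h :: "nat \<Rightarrow> 'a::real_vector \<Rightarrow> real"
  assumes "\<And>i. i \<in> {1..n} \<Longrightarrow> convex_on UNIV (h i)"
  shows "convex_on UNIV (\<lambda>x. 1 / real n * (\<Sum>i=1..n. h i x))"
proof (rule convex_onI)
  fix t :: real and x y assume t: "0 < t" "t < 1"
  have "(\<Sum>i=1..n. h i ((1 - t) *\<^sub>R x + t *\<^sub>R y)) \<le> (\<Sum>i=1..n. (1 - t) * h i x + t * h i y)"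
    using t by (intro sum_mono convex_onD[OF assms]) auto
  then have "1 / real n * (\<Sum>i=1..n. h i ((1 - t) *\<^sub>R x + t *\<^sub>R y))
      \<le> 1 / real n * (\<Sum>i=1..n. (1 - t) * h i x + t * h i y)"
    by (intro mult_left_mono) auto
  then show "1 / real n * (\<Sum>i=1..n. h i ((1 - t) *\<^sub>R x + t *\<^sub>R y))
      \<le> (1 - t) * (1 / real n * (\<Sum>i=1..n. h i x)) + t * (1 / real n * (\<Sum>i=1..n. h i y))"
    by (simp add: sum.distrib sum_distrib_left[symmetric] add_divide_distrib)
qed simp

text \<open>The decomposition of a second moment into variance and squared mean, for the uniform
  distribution on \<open>{1..m}\<close>. Dropping the variance gives Jensen's inequality, dropping the mean the
  bound of the variance by the second moment.\<close>

lemma sum_norm_sq_deviation: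
  fixes a :: "nat \<Rightarrow> 'a::real_inner"
  assumes "m \<ge> 1" and mean: "b = (1 / real m) *\<^sub>R (\<Sum>j=1..m. a j)"
  shows "(\<Sum>j=1..m. (norm (a j - b))\<^sup>2) = (\<Sum>j=1..m. (norm (a j))\<^sup>2) - real m * (norm b)\<^sup>2"
proof -
  have "(\<Sum>j=1..m. a j) = real m *\<^sub>R b" using assms by simp
  then have "(\<Sum>j=1..m. a j \<bullet> b) = real m * (norm b)\<^sup>2"
    by (simp add: inner_sum_left[symmetric] power2_norm_eq_inner)
  moreover have "(norm (a j - b))\<^sup>2 = (norm (a j))\<^sup>2 - 2 * (a j \<bullet> b) + (norm b)\<^sup>2" for j
    by (simp add: power2_norm_eq_inner inner_diff_left inner_diff_right inner_commute)
  ultimately show ?thesis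
    by (simp add: sum.distrib sum_subtractf sum_distrib_left[symmetric])
qed

lemma average_deviation_le:
  fixes a :: "nat \<Rightarrow> 'a::real_inner"
  assumes "m \<ge> 1"
  shows "1 / real m * (\<Sum>j=1..m. (norm (a j - (1 / real m) *\<^sub>R (\<Sum>j=1..m. a j)))\<^sup>2)
      \<le> 1 / real m * (\<Sum>j=1..m. (norm (a j))\<^sup>2)"
  using sum_norm_sq_deviation[OF assms refl, of a] by (intro mult_left_mono) auto

lemma norm_average_sq_le:
  fixes a :: "nat \<Rightarrow> 'a::real_inner"
  assumes "m \<ge> 1"
  shows "(norm ((1 / real m) *\<^sub>R (\<Sum>j=1..m. a j)))\<^sup>2 \<le> 1 / real m * (\<Sum>j=1..m. (norm (a j))\<^sup>2)"
proof -
  let ?b = "(1 / real m) *\<^sub>R (\<Sum>j=1..m. a j)"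
  have "0 \<le> (\<Sum>j=1..m. (norm (a j - ?b))\<^sup>2)" by (intro sum_nonneg) auto
  then have "real m * (norm ?b)\<^sup>2 \<le> (\<Sum>j=1..m. (norm (a j))\<^sup>2)"
    unfolding sum_norm_sq_deviation[OF assms refl] by simp
  then have "1 / real m * (real m * (norm ?b)\<^sup>2) \<le> 1 / real m * (\<Sum>j=1..m. (norm (a j))\<^sup>2)"
    by (rule mult_left_mono) simp
  then show ?thesis using assms by simp
qed

text \<open>Young's inequality: the parameter \<open>s\<close> trades the weight of one summand against that of the other.
  It is \<open>1\<close> where only constants matter and \<open>\<delta> / 2\<close> where the first factor has to stay
  close to one.\<close>

lemma norm_add_sq_le:
  fixes a b :: "'a::real_inner"
  assumes "s > 0"
  shows "(norm (a + b))\<^sup>2 \<le> (1 + s) * (norm a)\<^sup>2 + (1 + 1 / s) * (norm b)\<^sup>2"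
proof -
  have "0 \<le> (norm (sqrt s *\<^sub>R a - (1 / sqrt s) *\<^sub>R b))\<^sup>2" by simp
  also have "\<dots> = s * (norm a)\<^sup>2 - 2 * (a \<bullet> b) + 1 / s * (norm b)\<^sup>2"
    using assms by (simp add: power2_norm_eq_inner inner_diff_left inner_diff_right inner_commute
        divide_simps algebra_simps)
  finally show ?thesis
    by (simp add: power2_norm_eq_inner inner_add_left inner_add_right inner_commute algebra_simps)
qed

section \<open>Square-integrable vectors\<close>

text \<open>A class of random vectors that is closed under linear combinations and Lipschitz maps, hence
  under gradient steps, and small enough to make inner products and squared norms
  integrable.\<close>

definition square_integrable :: "'w measure \<Rightarrow> ('w \<Rightarrow> 'a::euclidean_space) \<Rightarrow> bool" where
  "square_integrable M X \<longleftrightarrow>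
     X \<in> borel_measurable M \<and> integrable M (\<lambda>\<omega>. (norm (X \<omega>))\<^sup>2)"

lemma square_integrableD:
  assumes "square_integrable M X"
  shows "X \<in> borel_measurable M" "integrable M (\<lambda>\<omega>. (norm (X \<omega>))\<^sup>2)"
  using assms by (auto simp: square_integrable_def)

lemma square_integrable_bound:
  assumes X: "X \<in> borel_measurable M" and Y: "square_integrable M Y"
    and le: "\<And>\<omega>. \<omega> \<in> space M \<Longrightarrow> norm (X \<omega>) \<le> norm (Y \<omega>)"
  shows "square_integrable M X"
  unfolding square_integrable_def
proof (intro conjI X Bochner_Integration.integrable_bound[OF square_integrableD(2)[OF Y]])
  show "AE \<omega> in M. norm ((norm (X \<omega>))\<^sup>2) \<le> norm ((norm (Y \<omega>))\<^sup>2)"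
    by (intro AE_I2) (use le in \<open>auto intro!: power_mono\<close>)
qed (use X in measurable)

lemma square_integrable_cong:
  assumes "\<And>\<omega>. \<omega> \<in> space M \<Longrightarrow> X \<omega> = Y \<omega>"
  shows "square_integrable M X \<longleftrightarrow> square_integrable M Y"
proof -
  have "X \<in> borel_measurable M \<longleftrightarrow> Y \<in> borel_measurable M"
    by (rule measurable_cong) (rule assms)
  moreover have "integrable M (\<lambda>\<omega>. (norm (X \<omega>))\<^sup>2) \<longleftrightarrow> integrable M (\<lambda>\<omega>. (norm (Y \<omega>))\<^sup>2)"
    by (rule Bochner_Integration.integrable_cong) (simp_all add: assms)
  ultimately show ?thesis by (simp add: square_integrable_def)
qed

lemma square_integrable_add:
  assumes X: "square_integrable M X" and Y: "square_integrable M Y"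
  shows "square_integrable M (\<lambda>\<omega>. X \<omega> + Y \<omega>)"
proof -
  note [measurable] = square_integrableD(1)[OF X] square_integrableD(1)[OF Y]
  have "integrable M (\<lambda>\<omega>. (norm (X \<omega> + Y \<omega>))\<^sup>2)"
  proof (rule Bochner_Integration.integrable_bound)
    show "integrable M (\<lambda>\<omega>. 2 * (norm (X \<omega>))\<^sup>2 + 2 * (norm (Y \<omega>))\<^sup>2)"
      using square_integrableD(2)[OF X] square_integrableD(2)[OF Y] by auto
    show "AE \<omega> in M. norm ((norm (X \<omega> + Y \<omega>))\<^sup>2) \<le> norm (2 * (norm (X \<omega>))\<^sup>2 + 2 * (norm (Y \<omega>))\<^sup>2)"
      using norm_add_sq_le[of 1] by (intro AE_I2) simp
  qed measurable
  then show ?thesis by (simp add: square_integrable_def)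
qed

lemma square_integrable_scaleR:
  assumes "square_integrable M X"
  shows "square_integrable M (\<lambda>\<omega>. c *\<^sub>R X \<omega>)"
  using assms unfolding square_integrable_def by (auto simp: power_mult_distrib)

lemma square_integrable_diff:
  assumes X: "square_integrable M X" and Y: "square_integrable M Y"
  shows "square_integrable M (\<lambda>\<omega>. X \<omega> - Y \<omega>)"
  using square_integrable_add[OF X square_integrable_scaleR[OF Y, of "-1"]] by simp

lemma square_integrable_const:
  "finite_measure M \<Longrightarrow> square_integrable M (\<lambda>_. c)"
  by (simp add: square_integrable_def finite_measure.integrable_const)

lemma square_integrable_sum:
  assumes "finite_measure M" "\<And>i. i \<in> I \<Longrightarrow> square_integrable M (X i)"
  shows "square_integrable M (\<lambda>\<omega>. \<Sum>i\<in>I. X i \<omega>)"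
  using assms(2)
  by (induction I rule: infinite_finite_induct)
     (auto intro!: square_integrable_add square_integrable_const assms(1))

lemma square_integrable_inner:
  assumes X: "square_integrable M X" and Y: "square_integrable M Y"
  shows "integrable M (\<lambda>\<omega>. X \<omega> \<bullet> Y \<omega>)"
proof -
  have "(\<lambda>\<omega>. X \<omega> \<bullet> Y \<omega>) = (\<lambda>\<omega>. ((norm (X \<omega> + Y \<omega>))\<^sup>2 - (norm (X \<omega> - Y \<omega>))\<^sup>2) / 4)"
    by (simp add: fun_eq_iff power2_norm_eq_inner inner_add_left inner_add_right inner_diff_left
        inner_diff_right inner_commute)
  moreover have "integrable M (\<lambda>\<omega>. ((norm (X \<omega> + Y \<omega>))\<^sup>2 - (norm (X \<omega> - Y \<omega>))\<^sup>2) / 4)"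
    using square_integrableD(2)[OF square_integrable_add[OF X Y]]
      square_integrableD(2)[OF square_integrable_diff[OF X Y]]
    by auto
  ultimately show ?thesis by simp
qed

lemma square_integrable_integrable:
  assumes "finite_measure M" and X: "square_integrable M X"
  shows "integrable M X"
proof (rule Bochner_Integration.integrable_bound)
  show "integrable M (\<lambda>\<omega>. 1 + (norm (X \<omega>))\<^sup>2)"
    using assms by (auto simp: finite_measure.integrable_const square_integrableD(2))
  have "norm (X \<omega>) \<le> 1 + (norm (X \<omega>))\<^sup>2" for \<omega>
  proof -
    have "(norm (X \<omega>) - 1)\<^sup>2 = (norm (X \<omega>))\<^sup>2 - 2 * norm (X \<omega>) + 1" by (simp add: power2_diff)
    then show ?thesis using zero_le_power2[of "norm (X \<omega>) - 1"] norm_ge_zero[of "X \<omega>"] by linarith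
  qed
  then show "AE \<omega> in M. norm (X \<omega>) \<le> norm (1 + (norm (X \<omega>))\<^sup>2)" by simp
qed (use X in \<open>simp add: square_integrable_def\<close>)

lemma square_integrable_lipschitz:
  assumes M: "finite_measure M" and X: "square_integrable M X"
    and h: "h \<in> borel_measurable borel" and lip: "\<And>x y. norm (h x - h y) \<le> L * norm (x - y)"
  shows "square_integrable M (\<lambda>\<omega>. h (X \<omega>))"
proof -
  have "square_integrable M (\<lambda>\<omega>. h (X \<omega>) - h 0)"
  proof (rule square_integrable_bound)
    show "square_integrable M (\<lambda>\<omega>. L *\<^sub>R X \<omega>)" by (rule square_integrable_scaleR[OF X])
    show "(\<lambda>\<omega>. h (X \<omega>) - h 0) \<in> borel_measurable M"
      using measurable_compose[OF square_integrableD(1)[OF X] h] by measurable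
    show "norm (h (X \<omega>) - h 0) \<le> norm (L *\<^sub>R X \<omega>)" for \<omega>
      using lip[of "X \<omega>" 0] mult_right_mono[OF abs_ge_self[of L], of "norm (X \<omega>)"] by simp
  qed
  from square_integrable_add[OF this square_integrable_const[OF M, of "h 0"]]
  show ?thesis by simp
qed

section \<open>Conditioning on the past of an independent draw\<close>

text \<open>The coordinates and squared norms of the worker averages are averages of one-worker quantities,
  so that their conditional expectations reduce to those of single workers.\<close>

lemma (in sigma_finite_subalgebra) cond_exp_average:
  fixes X Y :: "nat \<Rightarrow> 'a \<Rightarrow> real"
  assumes int: "\<And>i. i \<in> {1..n} \<Longrightarrow> integrable M (X i)"
    and eq: "\<And>i. i \<in> {1..n} \<Longrightarrow> AE \<omega> in M. real_cond_exp M F (X i) \<omega> = Y i \<omega>"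
  shows "AE \<omega> in M. real_cond_exp M F (\<lambda>\<omega>. 1 / real n * (\<Sum>i=1..n. X i \<omega>)) \<omega>
      = 1 / real n * (\<Sum>i=1..n. Y i \<omega>)"
proof -
  \<comment> \<open>Outside the index range the summands are set to zero, so that every summand is integrable.\<close>
  define X' where "X' i = (if i \<in> {1..n} then X i else (\<lambda>_. 0))" for i
  have X': "integrable M (X' i)" for i using int by (simp add: X'_def)
  have sum_eq: "(\<Sum>i=1..n. X i \<omega>) = (\<Sum>i=1..n. X' i \<omega>)" for \<omega>
    by (simp add: X'_def)
  have "AE \<omega> in M. \<forall>i\<in>{1..n}. real_cond_exp M F (X' i) \<omega> = Y i \<omega>"
    using eq by (intro AE_finite_allI) (auto simp: X'_def)
  moreover have "AE \<omega> in M. real_cond_exp M F (\<lambda>\<omega>. \<Sum>i=1..n. X' i \<omega>) \<omega> = (\<Sum>i=1..n. real_cond_exp M F (X' i) \<omega>)"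
    by (rule real_cond_exp_sum) (rule X')
  moreover have "AE \<omega> in M. real_cond_exp M F (\<lambda>\<omega>. 1 / real n * (\<Sum>i=1..n. X' i \<omega>)) \<omega>
      = 1 / real n * real_cond_exp M F (\<lambda>\<omega>. \<Sum>i=1..n. X' i \<omega>) \<omega>"
    by (rule real_cond_exp_cmult) (use X' in auto)
  ultimately show ?thesis
    unfolding sum_eq by eventually_elim simp
qed

lemma (in sigma_finite_subalgebra) vec_cond_expI:
  fixes X Y :: "'a \<Rightarrow> 'b::euclidean_space"
  assumes "\<And>b. b \<in> Basis \<Longrightarrow> AE \<omega> in M. real_cond_exp M F (\<lambda>\<omega>. X \<omega> \<bullet> b) \<omega> = Y \<omega> \<bullet> b"
  shows "AE \<omega> in M. vec_cond_exp M F X \<omega> = Y \<omega>"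
proof -
  have "AE \<omega> in M. \<forall>b\<in>Basis. real_cond_exp M F (\<lambda>\<omega>. X \<omega> \<bullet> b) \<omega> = Y \<omega> \<bullet> b"
    using assms by (intro AE_finite_allI) auto
  then show ?thesis
    by eventually_elim (simp add: vec_cond_exp_def euclidean_representation)
qed

lemma vec_cond_exp_measurable: "vec_cond_exp M F X \<in> borel_measurable M"
  unfolding vec_cond_exp_def
  by (intro borel_measurable_sum borel_measurable_scaleR borel_measurable_cond_exp2 borel_measurable_const)

lemma distr_fst_pair:
  assumes "prob_space B"
  shows "distr (A \<Otimes>\<^sub>M B) A fst = A"
proof (rule measure_eqI)
  interpret B: prob_space B by fact
  fix X assume "X \<in> sets (distr (A \<Otimes>\<^sub>M B) A fst)"
  then have X: "X \<in> sets A" by simp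
  then have "fst -` X \<inter> space (A \<Otimes>\<^sub>M B) = X \<times> space B"
    using sets.sets_into_space by (fastforce simp: space_pair_measure)
  then show "emeasure (distr (A \<Otimes>\<^sub>M B) A fst) X = emeasure A X"
    using X by (simp add: emeasure_distr B.emeasure_pair_measure_Times B.emeasure_space_1)
qed simp

lemma distr_snd_pair:
  assumes "prob_space A" "prob_space B"
  shows "distr (A \<Otimes>\<^sub>M B) B snd = B"
proof (rule measure_eqI)
  interpret A: prob_space A by fact
  interpret B: prob_space B by fact
  fix X assume "X \<in> sets (distr (A \<Otimes>\<^sub>M B) B snd)"
  then have X: "X \<in> sets B" by simp
  then have "snd -` X \<inter> space (A \<Otimes>\<^sub>M B) = space A \<times> X"
    using sets.sets_into_space by (fastforce simp: space_pair_measure)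
  then show "emeasure (distr (A \<Otimes>\<^sub>M B) B snd) X = emeasure B X"
    using X by (simp add: emeasure_distr B.emeasure_pair_measure_Times A.emeasure_space_1)
qed simp

text \<open>The situation inside one iteration: \<open>F\<close> is the past, \<open>Z\<close> the draw of one worker.
  Independence is stated for sets, because the past and the draw live on different types.\<close>

locale fresh_draw = prob_space M for M :: "'w measure" +
  fixes F :: "'w measure" and N :: "'z measure" and Z :: "'w \<Rightarrow> 'z"
  assumes subalg: "subalgebra M F"
    and draw_measurable [measurable]: "Z \<in> measurable M N"
    and indep: "indep_set (sets F) {Z -` A \<inter> space M | A. A \<in> sets N}"
    and law: "distr M N Z = N"
begin

sublocale cond: finite_measure_subalgebra M F
  by unfold_locales (rule subalg)

lemma past_measurable [measurable]: "(\<lambda>\<omega>. \<omega>) \<in> measurable M F"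
  using subalg by (auto simp: subalgebra_def measurable_def sets.sets_into_space Int_absorb2)

lemma prob_space_law: "prob_space N"
  using prob_space_distr[OF draw_measurable] by (simp add: law)

lemma prob_space_past: "prob_space (distr M F (\<lambda>\<omega>. \<omega>))"
  by (rule prob_space_distr) measurable

text \<open>The pair of the past, seen as the identity with values in \<open>F\<close>, and the draw has a product
  law; this is the form in which independence enters.\<close>

lemma joint_law:
  "distr M F (\<lambda>\<omega>. \<omega>) \<Otimes>\<^sub>M N = distr M (F \<Otimes>\<^sub>M N) (\<lambda>\<omega>. (\<omega>, Z \<omega>))"
proof (rule pair_measure_eqI)
  interpret N: prob_space N by (rule prob_space_law)
  interpret P: prob_space "distr M F (\<lambda>\<omega>. \<omega>)" by (rule prob_space_past)
  show "sigma_finite_measure (distr M F (\<lambda>\<omega>. \<omega>))" "sigma_finite_measure N" by unfold_locales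
  show "sets (distr M F (\<lambda>\<omega>. \<omega>) \<Otimes>\<^sub>M N) = sets (distr M (F \<Otimes>\<^sub>M N) (\<lambda>\<omega>. (\<omega>, Z \<omega>)))"
    by (simp cong: sets_pair_measure_cong)
  fix A B assume "A \<in> sets (distr M F (\<lambda>\<omega>. \<omega>))" and B [measurable]: "B \<in> sets N"
  then have A [measurable]: "A \<in> sets F" by simp
  have AM: "A \<inter> space M = A"
    using subalg sets.sets_into_space[OF A] by (auto simp: subalgebra_def)
  have "prob (A \<inter> (Z -` B \<inter> space M)) = prob A * prob (Z -` B \<inter> space M)"
    using indep A B unfolding indep_sets2_eq by blast
  then have "emeasure M (A \<inter> (Z -` B \<inter> space M)) = emeasure M A * emeasure M (Z -` B \<inter> space M)"
    by (simp add: emeasure_eq_measure ennreal_mult)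
  moreover have "emeasure N B = emeasure M (Z -` B \<inter> space M)"
    using emeasure_distr[OF draw_measurable B] by (simp add: law)
  moreover have "(\<lambda>\<omega>. (\<omega>, Z \<omega>)) -` (A \<times> B) \<inter> space M = A \<inter> (Z -` B \<inter> space M)"
    using AM by auto
  ultimately show "emeasure (distr M F (\<lambda>\<omega>. \<omega>)) A * emeasure N B
      = emeasure (distr M (F \<Otimes>\<^sub>M N) (\<lambda>\<omega>. (\<omega>, Z \<omega>))) (A \<times> B)"
    by (simp add: emeasure_distr AM)
qed

lemma integral_freeze:
  fixes h :: "'w \<times> 'z \<Rightarrow> real"
  assumes h [measurable]: "h \<in> borel_measurable (F \<Otimes>\<^sub>M N)"
    and int: "integrable M (\<lambda>\<omega>. h (\<omega>, Z \<omega>))"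
  shows "integrable M (\<lambda>\<omega>. \<integral>z. h (\<omega>, z) \<partial>N)"
    and "(\<integral>\<omega>. h (\<omega>, Z \<omega>) \<partial>M) = (\<integral>\<omega>. (\<integral>z. h (\<omega>, z) \<partial>N) \<partial>M)"
proof -
  let ?P = "distr M F (\<lambda>\<omega>. \<omega>)"
  interpret N: prob_space N by (rule prob_space_law)
  interpret P: prob_space ?P by (rule prob_space_past)
  interpret pair_sigma_finite ?P N ..
  have inner: "(\<lambda>\<omega>. \<integral>z. h (\<omega>, z) \<partial>N) \<in> borel_measurable F" by measurable
  have joint: "integrable (?P \<Otimes>\<^sub>M N) h"
    unfolding joint_law by (subst integrable_distr_eq) (use int in auto)
  from integrable_fst'[OF joint]
  show "integrable M (\<lambda>\<omega>. \<integral>z. h (\<omega>, z) \<partial>N)"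
    by (subst (asm) integrable_distr_eq) (use inner in auto)
  have "(\<integral>\<omega>. (\<integral>z. h (\<omega>, z) \<partial>N) \<partial>?P) = integral\<^sup>L (?P \<Otimes>\<^sub>M N) h"
    by (rule integral_fst'[OF joint])
  also have "\<dots> = (\<integral>\<omega>. h (\<omega>, Z \<omega>) \<partial>M)"
    unfolding joint_law by (subst integral_distr) auto
  also have "(\<integral>\<omega>. (\<integral>z. h (\<omega>, z) \<partial>N) \<partial>?P) = (\<integral>\<omega>. (\<integral>z. h (\<omega>, z) \<partial>N) \<partial>M)"
    by (subst integral_distr) (use inner in auto)
  finally show "(\<integral>\<omega>. h (\<omega>, Z \<omega>) \<partial>M) = (\<integral>\<omega>. (\<integral>z. h (\<omega>, z) \<partial>N) \<partial>M)" by simp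
qed

lemma nn_integral_freeze:
  assumes h [measurable]: "h \<in> borel_measurable (F \<Otimes>\<^sub>M N)"
  shows "(\<integral>\<^sup>+\<omega>. h (\<omega>, Z \<omega>) \<partial>M) = (\<integral>\<^sup>+\<omega>. (\<integral>\<^sup>+z. h (\<omega>, z) \<partial>N) \<partial>M)"
proof -
  let ?P = "distr M F (\<lambda>\<omega>. \<omega>)"
  interpret N: prob_space N by (rule prob_space_law)
  have "(\<integral>\<^sup>+\<omega>. h (\<omega>, Z \<omega>) \<partial>M) = integral\<^sup>N (?P \<Otimes>\<^sub>M N) h"
    unfolding joint_law by (subst nn_integral_distr) auto
  also have "\<dots> = (\<integral>\<^sup>+\<omega>. (\<integral>\<^sup>+z. h (\<omega>, z) \<partial>N) \<partial>?P)"
    by (rule N.nn_integral_fst[symmetric]) (simp cong: measurable_cong_sets)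
  also have "\<dots> = (\<integral>\<^sup>+\<omega>. (\<integral>\<^sup>+z. h (\<omega>, z) \<partial>N) \<partial>M)"
    by (subst nn_integral_distr) auto
  finally show ?thesis .
qed

text \<open>Multiplying by the indicator of a past event keeps a function of the past and the draw of this
  form, so the claim reduces to equality of expectations.\<close>

lemma cond_exp_freeze:
  fixes h :: "'w \<times> 'z \<Rightarrow> real"
  assumes h [measurable]: "h \<in> borel_measurable (F \<Otimes>\<^sub>M N)"
    and int: "integrable M (\<lambda>\<omega>. h (\<omega>, Z \<omega>))"
  shows "AE \<omega> in M. real_cond_exp M F (\<lambda>\<omega>. h (\<omega>, Z \<omega>)) \<omega> = (\<integral>z. h (\<omega>, z) \<partial>N)"
proof (rule cond.real_cond_exp_charact)
  interpret N: prob_space N by (rule prob_space_law)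
  show "(\<lambda>\<omega>. \<integral>z. h (\<omega>, z) \<partial>N) \<in> borel_measurable F" by measurable
  show "integrable M (\<lambda>\<omega>. \<integral>z. h (\<omega>, z) \<partial>N)" by (rule integral_freeze[OF h int])
  fix A assume A [measurable]: "A \<in> sets F"
  then have A': "A \<in> sets M" using subalg by (auto simp: subalgebra_def)
  let ?h = "\<lambda>(\<omega>, z). indicator A \<omega> * h (\<omega>, z)"
  have "(\<integral>\<omega>. ?h (\<omega>, Z \<omega>) \<partial>M) = (\<integral>\<omega>. (\<integral>z. ?h (\<omega>, z) \<partial>N) \<partial>M)"
  proof (rule integral_freeze(2))
    show "integrable M (\<lambda>\<omega>. ?h (\<omega>, Z \<omega>))"
      using integrable_mult_indicator[OF A' int] by simp
  qed measurable
  then show "(\<integral>\<omega>\<in>A. h (\<omega>, Z \<omega>) \<partial>M) = (\<integral>\<omega>\<in>A. (\<integral>z. h (\<omega>, z) \<partial>N) \<partial>M)"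
    by (simp add: set_lebesgue_integral_def)
qed (rule int)

end

lemma past_space [simp]: "space (past M n N Z k) = space M"
  by (simp add: past_def space_measure_of_conv)

lemma sets_past:
  "sets (past M n N Z k) =
     sigma_sets (space M) (\<Union>j\<in>{..<k}. \<Union>i\<in>{1..n}. {Z j i -` A \<inter> space M | A. A \<in> sets N})"
  unfolding past_def by (intro sets_measure_of) auto

lemma past_mono: "k \<le> k' \<Longrightarrow> sets (past M n N Z k) \<subseteq> sets (past M n N Z k')"
  unfolding sets_past by (intro sigma_sets_mono' UN_mono) auto

lemma measurable_past_mono:
  "X \<in> measurable (past M n N Z k) K \<Longrightarrow> k \<le> k' \<Longrightarrow> X \<in> measurable (past M n N Z k') K"
  using past_mono[of k k' M n N Z] unfolding measurable_def by auto

text \<open>The iterates of step \<open>k + 1\<close> are built from draws up to step \<open>k\<close>; this makes them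
  measurable with respect to the next past.\<close>

lemma measurable_draw_past:
  assumes "Z j i \<in> measurable M N" "j < k" "i \<in> {1..n}"
  shows "Z j i \<in> measurable (past M n N Z k) N"
proof (rule measurableI)
  fix A assume "A \<in> sets N"
  then show "Z j i -` A \<inter> space (past M n N Z k) \<in> sets (past M n N Z k)"
    unfolding sets_past past_space using assms(2,3)
    by (intro sigma_sets.Basic UN_I[of j] UN_I[of i]) auto
qed (use assms(1) in \<open>auto dest: measurable_space\<close>)

text \<open>The draws that generate the past and the draw of worker \<open>i\<close> at step \<open>k\<close> are two disjoint blocks
  of the independent family.\<close>

lemma fresh_randomness_fresh_draw:
  assumes "prob_space M" and fresh: "fresh_randomness M n N Z" and i: "i \<in> {1..n}"
  shows "fresh_draw M (past M n N Z k) N (Z k i)"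
proof -
  interpret prob_space M by fact
  let ?I = "UNIV \<times> {1..n}"
  let ?E = "\<lambda>(k, i). {Z k i -` A \<inter> space M | A. A \<in> sets N}"
  let ?J = "case_bool ({..<k} \<times> {1..n}) {(k, i)}"
  have vars: "indep_vars (\<lambda>_. N) (\<lambda>(k, i). Z k i) ?I"
    and law: "distr M N (Z k i) = N"
    using fresh i by (auto simp: fresh_randomness_def)
  have Z: "Z j i' \<in> measurable M N" if "i' \<in> {1..n}" for j i'
    using vars that unfolding indep_vars_def2 by (auto dest: bspec[of _ _ "(j, i')"])
  have "indep_sets ?E ?I"
    using vars unfolding indep_vars_def2 by (simp add: case_prod_beta')
  then have "indep_sets ?E (\<Union>b. ?J b)"
    by (rule indep_sets_mono_index[rotated]) (use i in \<open>auto split: bool.splits\<close>)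
  then have "indep_sets (\<lambda>b. sigma_sets (space M) (\<Union>q\<in>?J b. ?E q)) UNIV"
  proof (rule indep_sets_collect_sigma)
    show "Int_stable (?E q)" for q
    proof (rule Int_stableI)
      fix a b assume "a \<in> ?E q" "b \<in> ?E q"
      then obtain A B where "A \<in> sets N" "B \<in> sets N"
        "a = Z (fst q) (snd q) -` A \<inter> space M" "b = Z (fst q) (snd q) -` B \<inter> space M"
        by (auto simp: case_prod_beta')
      then show "a \<inter> b \<in> ?E q"
        by (auto simp: case_prod_beta' intro!: exI[of _ "A \<inter> B"])
    qed
    show "disjoint_family_on ?J UNIV"
      by (auto simp: disjoint_family_on_def split: bool.splits)
  qed
  moreover have "(\<lambda>b. sigma_sets (space M) (\<Union>q\<in>?J b. ?E q))
      = case_bool (sets (past M n N Z k)) (sigma_sets (space M) {Z k i -` A \<inter> space M | A. A \<in> sets N})"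
    by (auto simp: fun_eq_iff sets_past UN_Times_distrib split: bool.splits intro!: arg_cong[of _ _ "sigma_sets (space M)"])
  ultimately have ind: "indep_set (sets (past M n N Z k))
      (sigma_sets (space M) {Z k i -` A \<inter> space M | A. A \<in> sets N})"
    by (simp add: indep_set_def)
  then have sub: "sets (past M n N Z k) \<subseteq> sets M" by (simp add: indep_sets2_eq)
  show ?thesis
  proof
    show "subalgebra M (past M n N Z k)" using sub by (simp add: subalgebra_def)
    show "indep_set (sets (past M n N Z k)) {Z k i -` A \<inter> space M | A. A \<in> sets N}"
      using ind unfolding indep_set_def
      by (rule indep_sets_mono_sets) (auto split: bool.splits)
  qed (rule Z[OF i] law)+
qed

section \<open>Index, compression and coin of one draw\<close>

lemma integral_bernoulli: "(\<integral>b. (\<phi> b :: real) \<partial>measure_pmf (bernoulli_pmf p)) = p * \<phi> True + (1 - p) * \<phi> False"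
  if "0 \<le> p" "p \<le> 1"
  using that by (simp add: integral_measure_pmf_real[of UNIV] UNIV_bool)

text \<open>The draw consists of a sample index, a seed for the compressor and a coin. The lemmas below
  integrate functions of one or two of these components.\<close>

locale fresh_step = fresh_draw M F "step_law m Q p" Z
  for M :: "'w measure" and F m and Q :: "'c measure" and p and Z +
  assumes m: "m \<ge> 1" and Q: "prob_space Q" and p: "0 < p" "p < 1"
begin

abbreviation index :: "'w \<Rightarrow> nat" where "index \<omega> \<equiv> fst (Z \<omega>)"
abbreviation coin :: "'w \<Rightarrow> bool" where "coin \<omega> \<equiv> snd (snd (Z \<omega>))"

lemma prob_space_factors:
  "prob_space (uniform_count_measure {1..m})"
  "prob_space (Q \<Otimes>\<^sub>M measure_pmf (bernoulli_pmf p))"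
  using m by (auto intro!: prob_space_uniform_count_measure prob_space_pair Q measure_pmf.prob_space_axioms)

lemma fst_law_measurable [measurable]:
  "fst \<in> measurable (step_law m Q p) (count_space {1..m})"
  unfolding step_law_def by (auto cong: measurable_cong_sets simp: sets_uniform_count_measure_count_space)

lemma seed_law_measurable [measurable]:
  "(\<lambda>z. fst (snd z)) \<in> measurable (step_law m Q p) Q"
  unfolding step_law_def by measurable

lemma coin_law_measurable [measurable]:
  "(\<lambda>z. snd (snd z)) \<in> measurable (step_law m Q p) (count_space UNIV)"
  unfolding step_law_def
  by (intro measurable_compose[OF measurable_snd measurable_compose[OF measurable_snd]]) auto

lemma index_range: "\<omega> \<in> space M \<Longrightarrow> index \<omega> \<in> {1..m}"
  using measurable_space[OF measurable_compose[OF draw_measurable fst_law_measurable]] by simp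

lemma integral_index: "(\<integral>z. (\<phi> (fst z) :: real) \<partial>step_law m Q p) = 1 / real m * (\<Sum>l=1..m. \<phi> l)"
proof -
  let ?U = "uniform_count_measure {1..m}"
  have "(\<integral>z. \<phi> (fst z) \<partial>step_law m Q p) = (\<integral>l. \<phi> l \<partial>distr (step_law m Q p) ?U fst)"
    unfolding step_law_def
    by (rule integral_distr[symmetric, OF measurable_fst])
       (simp add: measurable_cong_sets[OF sets_uniform_count_measure_count_space refl])
  also have "\<dots> = (\<integral>l. \<phi> l \<partial>?U)"
    unfolding step_law_def by (simp only: distr_fst_pair[OF prob_space_factors(2)])
  finally show ?thesis by (simp add: integral_uniform_count_measure)
qed

lemma integral_coin:
  "(\<integral>z. (if snd (snd z) then a else b :: real) \<partial>step_law m Q p) = p * a + (1 - p) * b"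
proof -
  let ?B = "measure_pmf (bernoulli_pmf p)"
  let ?QB = "Q \<Otimes>\<^sub>M ?B"
  let ?\<phi> = "\<lambda>c. if c then a else b"
  have "(\<integral>z. ?\<phi> (snd (snd z)) \<partial>step_law m Q p) = (\<integral>y. ?\<phi> (snd y) \<partial>distr (step_law m Q p) ?QB snd)"
    unfolding step_law_def
    by (rule integral_distr[symmetric]) auto
  also have "\<dots> = (\<integral>y. ?\<phi> (snd y) \<partial>?QB)"
    unfolding step_law_def by (simp only: distr_snd_pair[OF prob_space_factors])
  also have "\<dots> = (\<integral>c. ?\<phi> c \<partial>distr ?QB ?B snd)"
    by (rule integral_distr[symmetric]) auto
  also have "\<dots> = (\<integral>c. ?\<phi> c \<partial>?B)"
    by (simp add: distr_snd_pair Q measure_pmf.prob_space_axioms)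
  finally show ?thesis using p by (simp add: integral_bernoulli)
qed

lemma measurable_index_choice:
  assumes "\<And>l. l \<in> {1..m} \<Longrightarrow> \<phi> l \<in> measurable M K"
  shows "(\<lambda>\<omega>. \<phi> (index \<omega>) \<omega>) \<in> measurable M K"
proof (rule measurable_compose_countable'[where I = "{1..m}" and g = index])
  show "index \<in> measurable M (count_space {1..m})"
    by (rule measurable_compose[OF draw_measurable fst_law_measurable])
qed (rule assms, assumption, simp)

text \<open>The value at the drawn index is dominated by the sum over all indices.\<close>

lemma integrable_index_choice:
  fixes \<phi> :: "nat \<Rightarrow> 'w \<Rightarrow> real"
  assumes "\<And>l. l \<in> {1..m} \<Longrightarrow> integrable M (\<phi> l)"
  shows "integrable M (\<lambda>\<omega>. \<phi> (index \<omega>) \<omega>)"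
proof (rule Bochner_Integration.integrable_bound)
  show "integrable M (\<lambda>\<omega>. \<Sum>l=1..m. \<bar>\<phi> l \<omega>\<bar>)" using assms by auto
  show "(\<lambda>\<omega>. \<phi> (index \<omega>) \<omega>) \<in> borel_measurable M"
    by (rule measurable_index_choice) (rule borel_measurable_integrable[OF assms])
  have "\<bar>\<phi> (index \<omega>) \<omega>\<bar> \<le> (\<Sum>l=1..m. \<bar>\<phi> l \<omega>\<bar>)" if "\<omega> \<in> space M" for \<omega>
    using index_range[OF that] by (intro member_le_sum) auto
  then show "AE \<omega> in M. norm (\<phi> (index \<omega>) \<omega>) \<le> norm (\<Sum>l=1..m. \<bar>\<phi> l \<omega>\<bar>)"
    by (intro AE_I2) (simp add: sum_nonneg)
qed

lemma square_integrable_index_choice: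
  assumes "\<And>l. l \<in> {1..m} \<Longrightarrow> square_integrable M (\<phi> l)"
  shows "square_integrable M (\<lambda>\<omega>. \<phi> (index \<omega>) \<omega>)"
  unfolding square_integrable_def
proof
  show "(\<lambda>\<omega>. \<phi> (index \<omega>) \<omega>) \<in> borel_measurable M"
    by (rule measurable_index_choice) (rule square_integrableD(1)[OF assms])
  show "integrable M (\<lambda>\<omega>. (norm (\<phi> (index \<omega>) \<omega>))\<^sup>2)"
    by (rule integrable_index_choice[of "\<lambda>l \<omega>. (norm (\<phi> l \<omega>))\<^sup>2"]) (rule square_integrableD(2)[OF assms])
qed

lemma measurable_index_pair:
  assumes "\<And>l. l \<in> {1..m} \<Longrightarrow> \<phi> l \<in> measurable F K"
  shows "(\<lambda>(\<omega>, z). \<phi> (fst z) \<omega>) \<in> measurable (F \<Otimes>\<^sub>M step_law m Q p) K"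
  unfolding case_prod_beta'
proof (rule measurable_compose_countable'[where I = "{1..m}" and g = "\<lambda>y. fst (snd y)"])
  show "(\<lambda>y. fst (snd y)) \<in> measurable (F \<Otimes>\<^sub>M step_law m Q p) (count_space {1..m})"
    by (rule measurable_compose[OF measurable_snd fst_law_measurable])
qed (rule measurable_compose[OF measurable_fst assms], assumption, simp)

lemma cond_exp_index:
  fixes \<phi> :: "nat \<Rightarrow> 'w \<Rightarrow> real"
  assumes meas: "\<And>l. l \<in> {1..m} \<Longrightarrow> \<phi> l \<in> borel_measurable F"
    and int: "\<And>l. l \<in> {1..m} \<Longrightarrow> integrable M (\<phi> l)"
  shows "AE \<omega> in M. real_cond_exp M F (\<lambda>\<omega>. \<phi> (index \<omega>) \<omega>) \<omega> = 1 / real m * (\<Sum>l=1..m. \<phi> l \<omega>)"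
proof -
  have "(\<lambda>(\<omega>, z). \<phi> (fst z) \<omega>) \<in> borel_measurable (F \<Otimes>\<^sub>M step_law m Q p)"
    by (rule measurable_index_pair) (rule meas)
  moreover have "integrable M (\<lambda>\<omega>. \<phi> (index \<omega>) \<omega>)" by (rule integrable_index_choice) (rule int)
  moreover have "(\<integral>z. \<phi> (fst z) \<omega> \<partial>step_law m Q p) = 1 / real m * (\<Sum>l=1..m. \<phi> l \<omega>)" for \<omega>
    by (rule integral_index[of "\<lambda>l. \<phi> l \<omega>"])
  ultimately show ?thesis using cond_exp_freeze[of "\<lambda>(\<omega>, z). \<phi> (fst z) \<omega>"] by simp
qed

lemma integral_index_choice:
  fixes \<phi> :: "nat \<Rightarrow> 'w \<Rightarrow> real"
  assumes meas: "\<And>l. l \<in> {1..m} \<Longrightarrow> \<phi> l \<in> borel_measurable F"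
    and int: "\<And>l. l \<in> {1..m} \<Longrightarrow> integrable M (\<phi> l)"
  shows "(\<integral>\<omega>. \<phi> (index \<omega>) \<omega> \<partial>M) = (\<integral>\<omega>. 1 / real m * (\<Sum>l=1..m. \<phi> l \<omega>) \<partial>M)"
proof -
  have "(\<lambda>(\<omega>, z). \<phi> (fst z) \<omega>) \<in> borel_measurable (F \<Otimes>\<^sub>M step_law m Q p)"
    by (rule measurable_index_pair) (rule meas)
  moreover have "integrable M (\<lambda>\<omega>. \<phi> (index \<omega>) \<omega>)" by (rule integrable_index_choice) (rule int)
  moreover have "(\<integral>z. \<phi> (fst z) \<omega> \<partial>step_law m Q p) = 1 / real m * (\<Sum>l=1..m. \<phi> l \<omega>)" for \<omega>
    by (rule integral_index[of "\<lambda>l. \<phi> l \<omega>"])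
  ultimately show ?thesis using integral_freeze(2)[of "\<lambda>(\<omega>, z). \<phi> (fst z) \<omega>"] by simp
qed

lemma measurable_coin_choice:
  assumes "a \<in> measurable M K" "b \<in> measurable M K"
  shows "(\<lambda>\<omega>. if coin \<omega> then a \<omega> else b \<omega>) \<in> measurable M K"
  using assms measurable_compose[OF draw_measurable coin_law_measurable]
  by (intro measurable_If) auto

lemma integrable_coin_choice:
  fixes a b :: "'w \<Rightarrow> real"
  assumes "integrable M a" "integrable M b"
  shows "integrable M (\<lambda>\<omega>. if coin \<omega> then a \<omega> else b \<omega>)"
proof (rule Bochner_Integration.integrable_bound)
  show "integrable M (\<lambda>\<omega>. \<bar>a \<omega>\<bar> + \<bar>b \<omega>\<bar>)" using assms by auto
  show "(\<lambda>\<omega>. if coin \<omega> then a \<omega> else b \<omega>) \<in> borel_measurable M"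
    using assms by (intro measurable_coin_choice) auto
qed auto

lemma square_integrable_coin_choice:
  assumes "square_integrable M a" "square_integrable M b"
  shows "square_integrable M (\<lambda>\<omega>. if coin \<omega> then a \<omega> else b \<omega>)"
  using integrable_coin_choice[OF square_integrableD(2)[OF assms(1)] square_integrableD(2)[OF assms(2)]]
    measurable_coin_choice[OF square_integrableD(1)[OF assms(1)] square_integrableD(1)[OF assms(2)]]
  by (simp add: square_integrable_def if_distrib[of norm] if_distrib[of "\<lambda>x. x\<^sup>2"] cong: if_cong)

lemma cond_exp_coin:
  fixes a b :: "'w \<Rightarrow> real"
  assumes meas: "a \<in> borel_measurable F" "b \<in> borel_measurable F"
    and int: "integrable M a" "integrable M b"
  shows "AE \<omega> in M. real_cond_exp M F (\<lambda>\<omega>. if coin \<omega> then a \<omega> else b \<omega>) \<omega> = p * a \<omega> + (1 - p) * b \<omega>"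
proof -
  have "(\<lambda>(\<omega>, z). if snd (snd z) then a \<omega> else b \<omega>) \<in> borel_measurable (F \<Otimes>\<^sub>M step_law m Q p)"
    unfolding case_prod_beta'
    by (intro measurable_If measurable_compose[OF measurable_fst meas(1)] measurable_compose[OF measurable_fst meas(2)])
       (use measurable_compose[OF measurable_snd coin_law_measurable, of F] in auto)
  from cond_exp_freeze[OF this] show ?thesis
    using integrable_coin_choice[OF int] by (simp add: integral_coin)
qed

text \<open>Contraction of the compressor, applied with the past and the index frozen and the seed
  integrated. The computation uses nonnegative integrals because the integrability of the
  squared error is part of the conclusion.\<close>

lemma compression_error:
  fixes C :: "'c \<Rightarrow> 'a \<Rightarrow> 'a::euclidean_space" and Y :: "nat \<Rightarrow> 'w \<Rightarrow> 'a"
  assumes C: "compressor \<delta> Q C"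
    and meas: "\<And>l. l \<in> {1..m} \<Longrightarrow> Y l \<in> borel_measurable F"
    and sq: "\<And>l. l \<in> {1..m} \<Longrightarrow> square_integrable M (Y l)"
  defines "R \<equiv> \<lambda>\<omega>. Y (index \<omega>) \<omega> - C (fst (snd (Z \<omega>))) (Y (index \<omega>) \<omega>)"
  shows "square_integrable M R"
    and "(\<integral>\<omega>. (norm (R \<omega>))\<^sup>2 \<partial>M) \<le> (1 - \<delta>) * (\<integral>\<omega>. 1 / real m * (\<Sum>l=1..m. (norm (Y l \<omega>))\<^sup>2) \<partial>M)"
proof -
  let ?N = "step_law m Q p"
  have C_meas: "(\<lambda>(s, x). C s x) \<in> borel_measurable (Q \<Otimes>\<^sub>M borel)"
    and \<delta>: "0 < \<delta>" "\<delta> \<le> 1"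
    and C_int: "\<And>x. integrable Q (\<lambda>s. (norm (C s x - x))\<^sup>2)"
    and C_le: "\<And>x. (\<integral>s. (norm (C s x - x))\<^sup>2 \<partial>Q) \<le> (1 - \<delta>) * (norm x)\<^sup>2"
    using C by (auto simp: compressor_def)
  define h :: "'w \<times> nat \<times> 'c \<times> bool \<Rightarrow> 'a"
    where "h = (\<lambda>(\<omega>, z). Y (fst z) \<omega> - C (fst (snd z)) (Y (fst z) \<omega>))"
  have Y_meas: "(\<lambda>(\<omega>, z). Y (fst z) \<omega>) \<in> borel_measurable (F \<Otimes>\<^sub>M ?N)"
    by (rule measurable_index_pair) (rule meas)
  have "(\<lambda>y. (fst (snd (snd y)), Y (fst (snd y)) (fst y))) \<in> measurable (F \<Otimes>\<^sub>M ?N) (Q \<Otimes>\<^sub>M borel)"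
    using Y_meas by (intro measurable_Pair measurable_compose[OF measurable_snd seed_law_measurable])
      (simp add: case_prod_beta')
  from measurable_compose[OF this C_meas]
  have h_meas [measurable]: "h \<in> borel_measurable (F \<Otimes>\<^sub>M ?N)"
    using Y_meas unfolding h_def case_prod_beta' by (intro borel_measurable_diff) simp_all
  have R_eq: "R = (\<lambda>\<omega>. h (\<omega>, Z \<omega>))"
    by (simp add: R_def h_def fun_eq_iff)
  have R_meas [measurable]: "R \<in> borel_measurable M"
    unfolding R_eq by measurable
  define q where "q \<omega> = 1 / real m * (\<Sum>l=1..m. (norm (Y l \<omega>))\<^sup>2)" for \<omega>
  have q_int: "integrable M q"
    unfolding q_def
    by (intro Bochner_Integration.integrable_mult_right Bochner_Integration.integrable_sum
        square_integrableD(2)[OF sq])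
  have q_nonneg: "0 \<le> q \<omega>" for \<omega>
    unfolding q_def by (auto intro!: divide_nonneg_nonneg sum_nonneg)
  have fixed: "(\<integral>\<^sup>+z. ennreal ((norm (h (\<omega>, z)))\<^sup>2) \<partial>?N) \<le> ennreal ((1 - \<delta>) * q \<omega>)" if \<omega>: "\<omega> \<in> space F" for \<omega>
  proof -
    let ?QB = "Q \<Otimes>\<^sub>M measure_pmf (bernoulli_pmf p)"
    interpret QB: prob_space ?QB by (rule prob_space_factors)
    interpret B: prob_space "measure_pmf (bernoulli_pmf p)" by (rule measure_pmf.prob_space_axioms)
    have per_index: "(\<integral>\<^sup>+y. ennreal ((norm (h (\<omega>, l, y)))\<^sup>2) \<partial>?QB) \<le> ennreal ((1 - \<delta>) * (norm (Y l \<omega>))\<^sup>2)" for l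
    proof -
      have C_slice: "(\<lambda>s. C s (Y l \<omega>)) \<in> borel_measurable Q"
        using measurable_compose[OF measurable_Pair2'[of "Y l \<omega>" borel Q] C_meas] by simp
      have "(\<integral>\<^sup>+y. ennreal ((norm (h (\<omega>, l, y)))\<^sup>2) \<partial>?QB)
          = (\<integral>\<^sup>+y. ennreal ((norm (C (fst y) (Y l \<omega>) - Y l \<omega>))\<^sup>2) \<partial>?QB)"
        by (simp add: h_def norm_minus_commute)
      also have "\<dots> = (\<integral>\<^sup>+s. ennreal ((norm (C s (Y l \<omega>) - Y l \<omega>))\<^sup>2) \<partial>distr ?QB Q fst)"
        using C_slice by (intro nn_integral_distr[symmetric]) auto
      also have "\<dots> = ennreal (\<integral>s. (norm (C s (Y l \<omega>) - Y l \<omega>))\<^sup>2 \<partial>Q)"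
        by (simp add: distr_fst_pair measure_pmf.prob_space_axioms nn_integral_eq_integral C_int)
      also have "\<dots> \<le> ennreal ((1 - \<delta>) * (norm (Y l \<omega>))\<^sup>2)"
        by (intro ennreal_leI C_le)
      finally show ?thesis .
    qed
    have "(\<lambda>z. h (\<omega>, z)) \<in> borel_measurable ?N"
      using measurable_compose[OF measurable_Pair1'[OF \<omega>] h_meas] by simp
    then have "(\<integral>\<^sup>+z. ennreal ((norm (h (\<omega>, z)))\<^sup>2) \<partial>?N)
        = (\<integral>\<^sup>+l. (\<integral>\<^sup>+y. ennreal ((norm (h (\<omega>, l, y)))\<^sup>2) \<partial>?QB) \<partial>uniform_count_measure {1..m})"
      unfolding step_law_def
      by (intro QB.nn_integral_fst[symmetric]) auto
    also have "\<dots> \<le> (\<integral>\<^sup>+l. ennreal ((1 - \<delta>) * (norm (Y l \<omega>))\<^sup>2) \<partial>uniform_count_measure {1..m})"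
      by (intro nn_integral_mono per_index)
    also have "\<dots> = (\<Sum>l=1..m. ennreal (1 / real m * ((1 - \<delta>) * (norm (Y l \<omega>))\<^sup>2)))"
      unfolding uniform_count_measure_def
      by (subst nn_integral_point_measure_finite) (use \<delta> in \<open>auto intro!: sum.cong simp: ennreal_mult[symmetric] simp del: sum_ennreal\<close>)
    also have "\<dots> = ennreal (\<Sum>l=1..m. 1 / real m * ((1 - \<delta>) * (norm (Y l \<omega>))\<^sup>2))"
      using \<delta> by (intro sum_ennreal) auto
    also have "(\<Sum>l=1..m. 1 / real m * ((1 - \<delta>) * (norm (Y l \<omega>))\<^sup>2)) = (1 - \<delta>) * q \<omega>"
      unfolding q_def sum_distrib_left by (intro sum.cong) auto
    finally show ?thesis .
  qed
  have "(\<integral>\<^sup>+\<omega>. ennreal ((norm (R \<omega>))\<^sup>2) \<partial>M) = (\<integral>\<^sup>+\<omega>. (\<integral>\<^sup>+z. ennreal ((norm (h (\<omega>, z)))\<^sup>2) \<partial>?N) \<partial>M)"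
    unfolding R_eq by (rule nn_integral_freeze[of "\<lambda>y. ennreal ((norm (h y))\<^sup>2)"]) measurable
  also have "\<dots> \<le> (\<integral>\<^sup>+\<omega>. ennreal ((1 - \<delta>) * q \<omega>) \<partial>M)"
    using subalg by (intro nn_integral_mono fixed) (simp add: subalgebra_def)
  also have "\<dots> = ennreal (\<integral>\<omega>. (1 - \<delta>) * q \<omega> \<partial>M)"
    using q_int q_nonneg \<delta> by (intro nn_integral_eq_integral) auto
  finally have bound: "(\<integral>\<^sup>+\<omega>. ennreal ((norm (R \<omega>))\<^sup>2) \<partial>M) \<le> ennreal (\<integral>\<omega>. (1 - \<delta>) * q \<omega> \<partial>M)" .
  have R_int: "integrable M (\<lambda>\<omega>. (norm (R \<omega>))\<^sup>2)"
    using le_less_trans[OF bound ennreal_less_top]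
    by (intro integrableI_nonneg) auto
  then show "square_integrable M R" by (simp add: square_integrable_def)
  have "0 \<le> (\<integral>\<omega>. (1 - \<delta>) * q \<omega> \<partial>M)"
    using q_nonneg \<delta> by (intro integral_nonneg_AE) auto
  with bound have "(\<integral>\<omega>. (norm (R \<omega>))\<^sup>2 \<partial>M) \<le> (\<integral>\<omega>. (1 - \<delta>) * q \<omega> \<partial>M)"
    by (subst (asm) nn_integral_eq_integral[OF R_int]) auto
  then show "(\<integral>\<omega>. (norm (R \<omega>))\<^sup>2 \<partial>M) \<le> (1 - \<delta>) * (\<integral>\<omega>. 1 / real m * (\<Sum>l=1..m. (norm (Y l \<omega>))\<^sup>2) \<partial>M)"
    by (simp add: q_def)
qed

end

section \<open>The finite-sum problem and the variance-reduced estimator\<close>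

text \<open>A gradient step from a minimizer would decrease the function if the gradient did not vanish.\<close>

lemma L_smooth_minimizer_grad:
  fixes f :: "'a::euclidean_space \<Rightarrow> real"
  assumes f: "L_smooth L f" and L: "L > 0" and min: "\<And>y. f x \<le> f y"
  shows "grad f x = 0"
proof -
  have "f x \<le> f (x - (1 / L) *\<^sub>R grad f x)" by (rule min)
  also have "\<dots> \<le> f x - 1 / L * (grad f x \<bullet> grad f x) + L / 2 * (norm ((1 / L) *\<^sub>R grad f x))\<^sup>2"
    using L_smooth_upper_bound[OF f, of "x - (1 / L) *\<^sub>R grad f x" x] by simp
  also have "\<dots> = f x - 1 / (2 * L) * (norm (grad f x))\<^sup>2"
    using L by (simp add: power2_norm_eq_inner[symmetric] power2_eq_square field_simps)
  finally have "1 / (2 * L) * (norm (grad f x))\<^sup>2 \<le> 0" by simp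
  then show ?thesis using L by (auto simp: divide_le_0_iff)
qed

locale finite_sum_problem =
  fixes f :: "nat \<Rightarrow> nat \<Rightarrow> 'a::euclidean_space \<Rightarrow> real" and n m :: nat and L \<mu> :: real and xs :: 'a
  assumes n: "n \<ge> 1" and m: "m \<ge> 1" and L: "L > 0" and mu: "\<mu> \<ge> 0"
    and qsc: "quasi_strongly_convex \<mu> (total_avg n m f) xs"
    and convex: "\<And>i j. i \<in> {1..n} \<Longrightarrow> j \<in> {1..m} \<Longrightarrow> convex_on UNIV (f i j)"
    and smooth: "\<And>i j. i \<in> {1..n} \<Longrightarrow> j \<in> {1..m} \<Longrightarrow> L_smooth L (f i j)"
begin

abbreviation "obj \<equiv> total_avg n m f"
abbreviation "worker \<equiv> worker_avg m f"

lemma worker_eq: "worker i = (\<lambda>x. 1 / real m * (\<Sum>j=1..m. f i j x))"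
  by (simp add: worker_avg_def fun_eq_iff)

lemma obj_eq: "obj = (\<lambda>x. 1 / real n * (\<Sum>i=1..n. worker i x))"
  by (simp add: total_avg_def fun_eq_iff)

lemma worker_smooth: "i \<in> {1..n} \<Longrightarrow> L_smooth L (worker i)"
  unfolding worker_eq by (rule L_smooth_average(2)[OF m]) (rule smooth)

lemma worker_convex: "i \<in> {1..n} \<Longrightarrow> convex_on UNIV (worker i)"
  unfolding worker_eq by (rule convex_on_average) (rule convex)

lemma grad_worker: "i \<in> {1..n} \<Longrightarrow> grad (worker i) x = (1 / real m) *\<^sub>R (\<Sum>j=1..m. grad (f i j) x)"
  unfolding worker_eq by (rule L_smooth_average(1)[OF m]) (rule smooth)

lemma obj_smooth: "L_smooth L obj"
  unfolding obj_eq by (rule L_smooth_average(2)[OF n]) (rule worker_smooth)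

lemma obj_convex: "convex_on UNIV obj"
  unfolding obj_eq by (rule convex_on_average) (rule worker_convex)

lemma grad_obj: "grad obj x = (1 / real n) *\<^sub>R (\<Sum>i=1..n. grad (worker i) x)"
  unfolding obj_eq by (rule L_smooth_average(1)[OF n]) (rule worker_smooth)

lemma obj_minimal: "obj xs \<le> obj x"
  using qsc by (auto simp: quasi_strongly_convex_def)

lemma grad_obj_minimizer: "grad obj xs = 0"
  by (rule L_smooth_minimizer_grad[OF obj_smooth L obj_minimal])

lemma quasi_strong_convexity: "obj x - obj xs + \<mu> / 2 * (norm (x - xs))\<^sup>2 \<le> grad obj x \<bullet> (x - xs)"
proof -
  have "obj xs \<ge> obj x + grad obj x \<bullet> (xs - x) + \<mu> / 2 * (norm (x - xs))\<^sup>2"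
    using qsc by (simp add: quasi_strongly_convex_def)
  then show ?thesis by (simp add: inner_diff_right)
qed

lemma grad_obj_norm: "(norm (grad obj x))\<^sup>2 \<le> 2 * L * (obj x - obj xs)"
  using convex_L_smooth_grad_bound[OF obj_convex obj_smooth L, of x xs] by (simp add: grad_obj_minimizer)

lemma gap_quadratic: "obj x - obj xs \<le> L / 2 * (norm (x - xs))\<^sup>2"
  using L_smooth_upper_bound[OF obj_smooth, of x xs] by (simp add: grad_obj_minimizer)

text \<open>Quasi strong convexity and smoothness are compared at a point at distance one from the minimizer.
  Such a point exists since a Euclidean space has a nonzero vector.\<close>

lemma mu_le_L: "\<mu> \<le> L"
proof -
  obtain b :: 'a where b: "b \<in> Basis" using nonempty_Basis by blast
  define x where "x = xs + b"
  have nx: "norm (x - xs) = 1" using b by (simp add: x_def)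
  let ?g = "grad obj x"
  have "?g \<bullet> (x - xs) \<le> (norm ?g)\<^sup>2 / (2 * L) + L / 2"
  proof -
    have "?g \<bullet> (x - xs) \<le> norm ?g" using norm_cauchy_schwarz[of ?g "x - xs"] nx by simp
    also have "\<dots> \<le> (norm ?g)\<^sup>2 / (2 * L) + L / 2"
    proof -
      have "0 \<le> (norm ?g - L)\<^sup>2 / (2 * L)" using L by simp
      also have "\<dots> = (norm ?g)\<^sup>2 / (2 * L) + L / 2 - norm ?g"
        using L by (simp add: power2_eq_square field_simps)
      finally show ?thesis by simp
    qed
    finally show ?thesis .
  qed
  moreover have "(norm ?g)\<^sup>2 / (2 * L) \<le> obj x - obj xs"
    using grad_obj_norm[of x] L by (simp add: field_simps)
  ultimately show ?thesis using quasi_strong_convexity[of x] nx by simp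
qed

text \<open>The gradients of the individual workers at the minimizer need not vanish, but their sum does;
  hence the first-order terms cancel when the bounds of the workers are added.\<close>

lemma worker_linear_term: "(\<Sum>i=1..n. grad (worker i) xs \<bullet> d) = 0"
  using grad_obj[of xs] n by (simp add: grad_obj_minimizer inner_sum_left[symmetric])

lemma worker_grad_bound:
  "1 / real n * (\<Sum>i=1..n. (norm (grad (worker i) x - grad (worker i) xs))\<^sup>2) \<le> 2 * L * (obj x - obj xs)"
proof -
  have "(\<Sum>i=1..n. (norm (grad (worker i) x - grad (worker i) xs))\<^sup>2)
      \<le> (\<Sum>i=1..n. 2 * L * (worker i x - worker i xs - grad (worker i) xs \<bullet> (x - xs)))"
    by (intro sum_mono convex_L_smooth_grad_bound worker_convex worker_smooth L)
  also have "\<dots> = 2 * L * ((\<Sum>i=1..n. worker i x) - (\<Sum>i=1..n. worker i xs))"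
    using worker_linear_term[of "x - xs"] by (simp add: sum_distrib_left[symmetric] sum_subtractf)
  finally have "1 / real n * (\<Sum>i=1..n. (norm (grad (worker i) x - grad (worker i) xs))\<^sup>2)
      \<le> 1 / real n * (2 * L * ((\<Sum>i=1..n. worker i x) - (\<Sum>i=1..n. worker i xs)))"
    by (rule mult_left_mono) simp
  then show ?thesis by (simp add: obj_eq right_diff_distrib)
qed

lemma component_grad_bound: "grad_shift_sq n m f xs (\<lambda>_. x) \<le> 2 * L * (obj x - obj xs)"
proof -
  have per_worker: "(\<Sum>j=1..m. (norm (grad (f i j) x - grad (f i j) xs))\<^sup>2)
      \<le> 2 * L * (real m * (worker i x - worker i xs - grad (worker i) xs \<bullet> (x - xs)))"
    if i: "i \<in> {1..n}" for i
  proof -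
    have worker_sum: "(\<Sum>j=1..m. f i j y) = real m * worker i y" for y
      using m by (simp add: worker_eq)
    have "(\<Sum>j=1..m. (norm (grad (f i j) x - grad (f i j) xs))\<^sup>2)
        \<le> (\<Sum>j=1..m. 2 * L * (f i j x - f i j xs - grad (f i j) xs \<bullet> (x - xs)))"
      by (intro sum_mono convex_L_smooth_grad_bound convex smooth i L)
    also have "\<dots> = 2 * L * ((\<Sum>j=1..m. f i j x) - (\<Sum>j=1..m. f i j xs)
        - (\<Sum>j=1..m. grad (f i j) xs \<bullet> (x - xs)))"
      by (simp add: sum_distrib_left[symmetric] sum_subtractf)
    also have "(\<Sum>j=1..m. grad (f i j) xs \<bullet> (x - xs)) = real m * (grad (worker i) xs \<bullet> (x - xs))"
      using m by (simp add: grad_worker[OF i] inner_sum_left)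
    finally show ?thesis unfolding worker_sum by (simp add: right_diff_distrib)
  qed
  have "(\<Sum>i=1..n. \<Sum>j=1..m. (norm (grad (f i j) x - grad (f i j) xs))\<^sup>2)
      \<le> (\<Sum>i=1..n. 2 * L * (real m * (worker i x - worker i xs - grad (worker i) xs \<bullet> (x - xs))))"
    by (intro sum_mono per_worker)
  also have "\<dots> = 2 * L * (real m * ((\<Sum>i=1..n. worker i x) - (\<Sum>i=1..n. worker i xs)))"
    using worker_linear_term[of "x - xs"] by (simp add: sum_distrib_left[symmetric] sum_subtractf)
  also have "\<dots> = real n * real m * (2 * L * (obj x - obj xs))"
    using n by (simp add: obj_eq field_simps)
  finally have "1 / (real n * real m) * (\<Sum>i=1..n. \<Sum>j=1..m. (norm (grad (f i j) x - grad (f i j) xs))\<^sup>2)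
      \<le> 1 / (real n * real m) * (real n * real m * (2 * L * (obj x - obj xs)))"
    by (rule mult_left_mono) simp
  then show ?thesis using n m by (simp add: grad_shift_sq_def)
qed

lemma grad_shift_sq_nonneg: "0 \<le> grad_shift_sq n m f xs u"
  unfolding grad_shift_sq_def by (intro mult_nonneg_nonneg sum_nonneg) auto

lemma grad_shift_sq_average:
  "grad_shift_sq n m f xs u
     = 1 / real n * (\<Sum>i=1..n. 1 / real m * (\<Sum>j=1..m. (norm (grad (f i j) (u i) - grad (f i j) xs))\<^sup>2))"
  by (simp add: grad_shift_sq_def sum_divide_distrib[symmetric])

text \<open>The estimator of worker \<open>i\<close> at \<open>y\<close> with reference point \<open>u\<close> and sample index \<open>l\<close>. The gradient of
  the worker at the minimizer is subtracted; these shifts cancel in the average over the workers.\<close>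

definition lsvrg :: "nat \<Rightarrow> 'a \<Rightarrow> 'a \<Rightarrow> nat \<Rightarrow> 'a" where
  "lsvrg i y u l = grad (f i l) y - grad (f i l) u + grad (worker i) u - grad (worker i) xs"

lemma lsvrg_mean:
  assumes i: "i \<in> {1..n}"
  shows "(1 / real m) *\<^sub>R (\<Sum>l=1..m. lsvrg i y u l) = grad (worker i) y - grad (worker i) xs"
proof -
  have "(\<Sum>l=1..m. lsvrg i y u l)
      = real m *\<^sub>R grad (worker i) y - real m *\<^sub>R grad (worker i) u + real m *\<^sub>R grad (worker i) u
        - real m *\<^sub>R grad (worker i) xs"
    unfolding lsvrg_def sum_subtractf sum.distrib using m
    by (simp add: grad_worker[OF i, of y] grad_worker[OF i, of u] sum_constant_scaleR)
  also have "\<dots> = real m *\<^sub>R (grad (worker i) y - grad (worker i) xs)"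
    by (simp add: scaleR_diff_right)
  finally show ?thesis using m by simp
qed

text \<open>Centering can only decrease the second moment of the difference of the sample gradients at \<open>y\<close>
  and \<open>u\<close>, and both gradients are compared with those at the minimizer.\<close>

lemma lsvrg_deviation:
  assumes i: "i \<in> {1..n}"
  shows "1 / real m * (\<Sum>l=1..m. (norm (lsvrg i y u l - (grad (worker i) y - grad (worker i) xs)))\<^sup>2)
    \<le> 2 * (1 / real m * (\<Sum>l=1..m. (norm (grad (f i l) y - grad (f i l) xs))\<^sup>2))
      + 2 * (1 / real m * (\<Sum>l=1..m. (norm (grad (f i l) u - grad (f i l) xs))\<^sup>2))"
proof -
  let ?a = "\<lambda>l. grad (f i l) y - grad (f i l) u"
  have mean: "(1 / real m) *\<^sub>R (\<Sum>l=1..m. ?a l) = grad (worker i) y - grad (worker i) u"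
    by (simp add: grad_worker[OF i] sum_subtractf scaleR_diff_right)
  have "1 / real m * (\<Sum>l=1..m. (norm (lsvrg i y u l - (grad (worker i) y - grad (worker i) xs)))\<^sup>2)
      = 1 / real m * (\<Sum>l=1..m. (norm (?a l - (1 / real m) *\<^sub>R (\<Sum>l=1..m. ?a l)))\<^sup>2)"
    unfolding mean by (simp add: lsvrg_def algebra_simps)
  also have "\<dots> \<le> 1 / real m * (\<Sum>l=1..m. (norm (?a l))\<^sup>2)"
    by (rule average_deviation_le[OF m])
  also have "\<dots> \<le> 1 / real m * (\<Sum>l=1..m. 2 * (norm (grad (f i l) y - grad (f i l) xs))\<^sup>2
      + 2 * (norm (grad (f i l) u - grad (f i l) xs))\<^sup>2)"
  proof (intro mult_left_mono sum_mono)
    fix l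
    show "(norm (?a l))\<^sup>2 \<le> 2 * (norm (grad (f i l) y - grad (f i l) xs))\<^sup>2
      + 2 * (norm (grad (f i l) u - grad (f i l) xs))\<^sup>2"
      using norm_add_sq_le[of 1 "grad (f i l) y - grad (f i l) xs" "grad (f i l) xs - grad (f i l) u"]
      by (simp add: norm_minus_commute)
  qed simp
  finally show ?thesis by (simp add: sum.distrib sum_distrib_left[symmetric] add_divide_distrib)
qed

text \<open>The estimator is the difference of the sample gradients at \<open>y\<close> and \<open>xs\<close>, minus the centered
  difference of those at \<open>u\<close> and \<open>xs\<close>; centering is again dropped at no cost.\<close>

lemma lsvrg_second_moment:
  assumes i: "i \<in> {1..n}"
  shows "1 / real m * (\<Sum>l=1..m. (norm (lsvrg i y u l))\<^sup>2)
    \<le> 2 * (1 / real m * (\<Sum>l=1..m. (norm (grad (f i l) y - grad (f i l) xs))\<^sup>2))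
      + 2 * (1 / real m * (\<Sum>l=1..m. (norm (grad (f i l) u - grad (f i l) xs))\<^sup>2))"
proof -
  let ?a = "\<lambda>l. grad (f i l) y - grad (f i l) xs" and ?b = "\<lambda>l. grad (f i l) u - grad (f i l) xs"
  let ?b' = "\<lambda>l. ?b l - (1 / real m) *\<^sub>R (\<Sum>l=1..m. ?b l)"
  have mean: "(1 / real m) *\<^sub>R (\<Sum>l=1..m. ?b l) = grad (worker i) u - grad (worker i) xs"
    by (simp add: grad_worker[OF i] sum_subtractf scaleR_diff_right)
  have "1 / real m * (\<Sum>l=1..m. (norm (lsvrg i y u l))\<^sup>2)
      \<le> 1 / real m * (\<Sum>l=1..m. 2 * (norm (?a l))\<^sup>2 + 2 * (norm (?b' l))\<^sup>2)"
  proof (intro mult_left_mono sum_mono)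
    fix l
    have "lsvrg i y u l = ?a l + - ?b' l"
      unfolding mean by (simp add: lsvrg_def algebra_simps)
    then show "(norm (lsvrg i y u l))\<^sup>2 \<le> 2 * (norm (?a l))\<^sup>2 + 2 * (norm (?b' l))\<^sup>2"
      using norm_add_sq_le[of 1 "?a l" "- ?b' l"] by (simp only: norm_minus_cancel) simp
  qed simp
  also have "\<dots> = 2 * (1 / real m * (\<Sum>l=1..m. (norm (?a l))\<^sup>2)) + 2 * (1 / real m * (\<Sum>l=1..m. (norm (?b' l))\<^sup>2))"
    unfolding sum.distrib sum_distrib_left[symmetric] by (simp only: distrib_left mult.left_commute)
  also have "\<dots> \<le> 2 * (1 / real m * (\<Sum>l=1..m. (norm (?a l))\<^sup>2)) + 2 * (1 / real m * (\<Sum>l=1..m. (norm (?b l))\<^sup>2))"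
    using average_deviation_le[OF m, of ?b] by linarith
  finally show ?thesis .
qed

text \<open>The common last step of the variance and second-moment bounds: averaging over the workers turns
  the sample gradients at \<open>y\<close> into the gap and those at the reference points into the gradient
  shift.\<close>

lemma average_moment_bound:
  assumes "\<And>i. i \<in> {1..n} \<Longrightarrow> h i \<le>
      2 * (1 / real m * (\<Sum>l=1..m. (norm (grad (f i l) y - grad (f i l) xs))\<^sup>2))
      + 2 * (1 / real m * (\<Sum>l=1..m. (norm (grad (f i l) (u i) - grad (f i l) xs))\<^sup>2))"
  shows "1 / real n * (\<Sum>i=1..n. h i) \<le> 4 * L * (obj y - obj xs) + 2 * grad_shift_sq n m f xs u"
proof -
  have "1 / real n * (\<Sum>i=1..n. h i) \<le> 1 / real n * (\<Sum>i=1..n.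
      2 * (1 / real m * (\<Sum>l=1..m. (norm (grad (f i l) y - grad (f i l) xs))\<^sup>2))
      + 2 * (1 / real m * (\<Sum>l=1..m. (norm (grad (f i l) (u i) - grad (f i l) xs))\<^sup>2)))"
    by (intro mult_left_mono sum_mono assms) auto
  also have "\<dots> = 2 * grad_shift_sq n m f xs (\<lambda>_. y) + 2 * grad_shift_sq n m f xs u"
    unfolding grad_shift_sq_average sum.distrib sum_distrib_left[symmetric]
    by (simp only: distrib_left mult.left_commute)
  also have "\<dots> \<le> 4 * L * (obj y - obj xs) + 2 * grad_shift_sq n m f xs u"
    using component_grad_bound[of y] by simp
  finally show ?thesis .
qed

text \<open>Progress of a gradient step whose gradient is taken at \<open>y\<close> but which is applied at \<open>y - d\<close>. The
  cross term of \<open>d\<close> and the gradient is split by Young's inequality, and its gradient part is paid by one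
  of the two gaps that quasi strong convexity provides; moving the quadratic term from \<open>y\<close> to \<open>y - d\<close> costs
  \<open>\<mu> \<parallel>d\<parallel>\<^sup>2 \<le> L \<parallel>d\<parallel>\<^sup>2\<close>.\<close>

lemma perturbed_descent:
  "- 2 * ((y - d - xs) \<bullet> grad obj y)
    \<le> - \<mu> / 2 * (norm (y - d - xs))\<^sup>2 - (obj y - obj xs) + 3 * L * (norm d)\<^sup>2"
proof -
  let ?g = "grad obj y"
  have split: "(y - d - xs) \<bullet> ?g = ?g \<bullet> (y - xs) - d \<bullet> ?g"
    by (simp add: inner_diff_left inner_diff_right inner_commute)
  have "0 \<le> (norm ((2 * L) *\<^sub>R d - ?g))\<^sup>2 / (2 * L)" using L by simp
  also have "\<dots> = 2 * L * (norm d)\<^sup>2 - 2 * (d \<bullet> ?g) + (norm ?g)\<^sup>2 / (2 * L)"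
    using L by (simp add: power2_norm_eq_inner inner_diff_left inner_diff_right inner_commute field_simps)
  finally have young: "2 * (d \<bullet> ?g) \<le> 2 * L * (norm d)\<^sup>2 + (norm ?g)\<^sup>2 / (2 * L)" by simp
  have self_bound: "(norm ?g)\<^sup>2 / (2 * L) \<le> obj y - obj xs"
    using grad_obj_norm[of y] L by (simp add: field_simps)
  have "(norm (y - d - xs))\<^sup>2 \<le> 2 * (norm (y - xs))\<^sup>2 + 2 * (norm d)\<^sup>2"
    using norm_add_sq_le[of 1 "y - xs" "- d"] by (simp add: algebra_simps)
  then have "\<mu> / 2 * (norm (y - d - xs))\<^sup>2 \<le> \<mu> / 2 * (2 * (norm (y - xs))\<^sup>2 + 2 * (norm d)\<^sup>2)"
    using mu by (intro mult_left_mono) auto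
  moreover have "\<mu> * (norm d)\<^sup>2 \<le> L * (norm d)\<^sup>2" by (intro mult_right_mono mu_le_L) auto
  ultimately show ?thesis
    unfolding split using young self_bound quasi_strong_convexity[of y] by (simp add: algebra_simps)
qed

end

section \<open>Weighted sums of recursive inequalities\<close>

lemma weight_pos: "\<eta> < 1 \<Longrightarrow> 0 < weight \<eta> k"
  by (simp add: weight_def)

lemma weight_Suc: "\<eta> < 1 \<Longrightarrow> weight \<eta> (Suc k) * (1 - \<eta>) = weight \<eta> k"
  by (simp add: weight_def)

lemma weight_sum_pos: "\<eta> < 1 \<Longrightarrow> 0 < weight_sum \<eta> K"
  unfolding weight_sum_def by (intro sum_pos weight_pos) auto

text \<open>A sequence that contracts by \<open>1 - q\<close> while the weights grow by \<open>1 / (1 - \<eta>)\<close> still contracts, by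
  \<open>1 - r\<close>, after weighting. Summing the weighted recursion and absorbing the shifted sum leaves
  the factor \<open>r\<close> on the left.\<close>

lemma weighted_contraction_sum:
  fixes a b :: "nat \<Rightarrow> real"
  assumes \<eta>: "\<eta> < 1" and rate: "1 - q \<le> (1 - \<eta>) * (1 - r)"
    and a: "\<And>k. 0 \<le> a k" and rec: "\<And>k. a (Suc k) \<le> (1 - q) * a k + b k"
  shows "r * (\<Sum>k=0..K. weight \<eta> k * a k)
    \<le> 1 / (1 - \<eta>) * a 0 + 1 / (1 - \<eta>) * (\<Sum>k=0..K. weight \<eta> k * b k)"
proof -
  let ?S = "\<lambda>K. \<Sum>k=0..K. weight \<eta> k * a k" and ?B = "\<lambda>K. \<Sum>k=0..K. weight \<eta> k * b k"
  \<comment> \<open>The weighted recursion, brought to the weight of step \<open>k\<close>.\<close>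
  have step: "weight \<eta> (Suc k) * a (Suc k) \<le> (1 - r) * (weight \<eta> k * a k) + 1 / (1 - \<eta>) * (weight \<eta> k * b k)" for k
  proof -
    have "a (Suc k) \<le> (1 - \<eta>) * (1 - r) * a k + b k"
      using rec[of k] mult_right_mono[OF rate a[of k]] by linarith
    then have "weight \<eta> (Suc k) * a (Suc k) \<le> weight \<eta> (Suc k) * ((1 - \<eta>) * (1 - r) * a k + b k)"
      using weight_pos[OF \<eta>, of "Suc k"] by (intro mult_left_mono) auto
    also have "\<dots> = (1 - r) * (weight \<eta> (Suc k) * (1 - \<eta>) * a k) + weight \<eta> (Suc k) * b k"
      by (simp add: algebra_simps)
    also have "weight \<eta> (Suc k) * b k = 1 / (1 - \<eta>) * (weight \<eta> (Suc k) * (1 - \<eta>) * b k)"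
      using \<eta> by simp
    finally show ?thesis unfolding weight_Suc[OF \<eta>] .
  qed
  have "?S (Suc K) \<le> 1 / (1 - \<eta>) * a 0 + (1 - r) * ?S K + 1 / (1 - \<eta>) * ?B K"
  proof (induction K)
    case 0
    show ?case using step[of 0] by (simp add: weight_def)
  next
    case (Suc K)
    have "?S (Suc (Suc K)) = ?S (Suc K) + weight \<eta> (Suc (Suc K)) * a (Suc (Suc K))" by simp
    also have "\<dots> \<le> (1 / (1 - \<eta>) * a 0 + (1 - r) * ?S K + 1 / (1 - \<eta>) * ?B K)
        + ((1 - r) * (weight \<eta> (Suc K) * a (Suc K)) + 1 / (1 - \<eta>) * (weight \<eta> (Suc K) * b (Suc K)))"
      by (intro add_mono Suc.IH step)
    also have "\<dots> = 1 / (1 - \<eta>) * a 0 + (1 - r) * (?S K + weight \<eta> (Suc K) * a (Suc K))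
        + 1 / (1 - \<eta>) * (?B K + weight \<eta> (Suc K) * b (Suc K))"
      by (simp only: distrib_left)
    also have "\<dots> = 1 / (1 - \<eta>) * a 0 + (1 - r) * ?S (Suc K) + 1 / (1 - \<eta>) * ?B (Suc K)" by simp
    finally show ?case .
  qed
  moreover have "?S K \<le> ?S (Suc K)"
    using weight_pos[OF \<eta>, of "Suc K"] a[of "Suc K"] by simp
  ultimately show ?thesis by (simp add: left_diff_distrib)
qed

text \<open>The probability \<open>p\<close> enters through \<open>2 / (1 - p) \<ge> 2\<close>. The second bound uses
  \<open>\<mu> \<le> L\<close> and that the square root is at least \<open>sqrt 3\<close>, which exceeds \<open>27 / 16\<close>.\<close>

lemma step_size_consequences:
  fixes L \<mu> \<gamma> \<delta> p :: real
  assumes L: "L > 0" and mu: "0 \<le> \<mu>" "\<mu> \<le> L" and \<delta>: "0 < \<delta>" "\<delta> \<le> 1" and p: "0 < p" "p < 1" and \<gamma>: "0 < \<gamma>"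
    and step: "\<gamma> \<le> \<delta> / (8 * L * sqrt (3 * (1 + \<delta> * (1 + 2 / (1 - p)))))"
  shows "192 * L\<^sup>2 * \<gamma>\<^sup>2 * (1 + 3 * \<delta>) \<le> \<delta>\<^sup>2" and "\<gamma> * \<mu> / 2 \<le> \<delta> / 27"
proof -
  define X where "X = 3 * (1 + \<delta> * (1 + 2 / (1 - p)))"
  have "2 \<le> 2 / (1 - p)" using p by (simp add: field_simps)
  then have "\<delta> * 3 \<le> \<delta> * (1 + 2 / (1 - p))" using \<delta> by (intro mult_left_mono) auto
  then have X: "3 * (1 + 3 * \<delta>) \<le> X" by (simp add: X_def)
  moreover have "3 * 1 \<le> 3 * (1 + 3 * \<delta>)" using \<delta> by (intro mult_left_mono) auto
  ultimately have X0: "3 \<le> X" by linarith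
  then have s: "0 < sqrt X" by simp
  have "\<gamma> * (8 * L * sqrt X) \<le> \<delta>"
    using step s L unfolding X_def[symmetric] by (simp add: field_simps)
  then have "(\<gamma> * (8 * L * sqrt X))\<^sup>2 \<le> \<delta>\<^sup>2"
    using \<gamma> L s by (intro power_mono) auto
  then have sq: "64 * L\<^sup>2 * \<gamma>\<^sup>2 * X \<le> \<delta>\<^sup>2"
    using X0 by (simp add: power_mult_distrib mult_ac)
  have "64 * L\<^sup>2 * \<gamma>\<^sup>2 * (3 * (1 + 3 * \<delta>)) \<le> 64 * L\<^sup>2 * \<gamma>\<^sup>2 * X"
    by (intro mult_left_mono X) auto
  moreover have "192 * L\<^sup>2 * \<gamma>\<^sup>2 * (1 + 3 * \<delta>) = 64 * L\<^sup>2 * \<gamma>\<^sup>2 * (3 * (1 + 3 * \<delta>))" by simp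
  ultimately show "192 * L\<^sup>2 * \<gamma>\<^sup>2 * (1 + 3 * \<delta>) \<le> \<delta>\<^sup>2" using sq by linarith
  \<comment> \<open>The factor is chosen so that \<open>8 * (27 / 16) = 27 / 2\<close> yields \<open>\<gamma> * L / 2 \<le> \<delta> / 27\<close>.\<close>
  have "27 / 16 \<le> sqrt X"
    using X0 by (intro real_le_rsqrt) (simp add: power2_eq_square)
  then have "\<gamma> * (8 * L * (27 / 16)) \<le> \<gamma> * (8 * L * sqrt X)"
    using \<gamma> L by (intro mult_left_mono) auto
  then have "\<gamma> * L * (27 / 2) \<le> \<delta>"
    using \<open>\<gamma> * (8 * L * sqrt X) \<le> \<delta>\<close> by simp
  moreover have "\<gamma> * \<mu> \<le> \<gamma> * L" using mu \<gamma> by simp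
  ultimately show "\<gamma> * \<mu> / 2 \<le> \<delta> / 27" by simp
qed

text \<open>Here \<open>E\<close> stands for the expected squared error memory, \<open>s\<close> for the expected gradient shift and \<open>G\<close>
  for the expected gap. The weighted sum of \<open>s\<close> is bounded with contraction rate \<open>3 p / 4\<close>, then that
  of \<open>E\<close> with rate \<open>\<delta> / 4\<close>. After substitution the coefficient of the gaps is
  \<open>48 L\<^sup>2 \<gamma>\<^sup>2 / \<delta>\<^sup>2 \<cdot> u (1 + \<delta> + 4/3 \<delta> u)\<close> with \<open>u = 1 / (1 - \<eta>) \<le> 1 + \<delta> / 26\<close>. The last factor is
  at most \<open>1 + 3 \<delta>\<close>, and the bound on \<open>\<gamma>\<close> leaves one quarter.\<close>

lemma error_budget:
  fixes L \<gamma> \<delta> p \<eta> :: real and E s G :: "nat \<Rightarrow> real"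
  assumes L: "L > 0" and \<delta>: "0 < \<delta>" "\<delta> \<le> 1" and p: "0 < p" "p < 1"
    and \<gamma>: "192 * L\<^sup>2 * \<gamma>\<^sup>2 * (1 + 3 * \<delta>) \<le> \<delta>\<^sup>2"
    and \<eta>: "0 \<le> \<eta>" "\<eta> \<le> \<delta> / 27" "\<eta> \<le> p / 4"
    and nonneg: "\<And>k. 0 \<le> E k" "\<And>k. 0 \<le> s k" "\<And>k. 0 \<le> G k" and E0: "E 0 = 0"
    and E_rec: "\<And>k. E (Suc k) \<le> (1 - \<delta> / 2) * E k + \<gamma>\<^sup>2 * ((4 * L / \<delta> + 4 * L) * G k + 2 * s k)"
    and s_rec: "\<And>k. s (Suc k) \<le> (1 - p) * s k + 2 * L * p * G k"
  shows "3 * L * (\<Sum>k=0..K. weight \<eta> k * E k)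
    \<le> 1 / 4 * (\<Sum>k=0..K. weight \<eta> k * G k) + 48 * L * \<gamma>\<^sup>2 * (2 + p) / (\<delta> * p) * s 0"
proof -
  define SE where "SE = (\<Sum>k=0..K. weight \<eta> k * E k)"
  define SS where "SS = (\<Sum>k=0..K. weight \<eta> k * s k)"
  define SG where "SG = (\<Sum>k=0..K. weight \<eta> k * G k)"
  define u where "u = 1 / (1 - \<eta>)"
  have \<eta>1: "\<eta> \<le> 1 / 27" using \<eta> \<delta> by simp
  have SG0: "0 \<le> SG" unfolding SG_def
    using weight_pos[of \<eta>] \<eta>1 nonneg by (intro sum_nonneg mult_nonneg_nonneg) (auto simp: less_imp_le)
  have u1: "1 \<le> u" and u2: "u \<le> 27 / 26"
    using \<eta> \<eta>1 by (auto simp: u_def field_simps)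
  have "u = 1 + \<eta> * u" using \<eta>1 by (simp add: u_def field_simps)
  moreover have "\<eta> * u \<le> \<delta> / 27 * (27 / 26)" using \<eta> u1 u2 \<delta> by (intro mult_mono) auto
  ultimately have u3: "u \<le> 1 + \<delta> / 26" by simp
  have "\<delta> / 4 * SE \<le> u * E 0 + u * (\<Sum>k=0..K. weight \<eta> k * (\<gamma>\<^sup>2 * ((4 * L / \<delta> + 4 * L) * G k + 2 * s k)))"
    unfolding SE_def u_def
  proof (rule weighted_contraction_sum)
    have "\<eta> * (1 - \<delta> / 4) \<le> \<delta> / 27 * 1" using \<eta> \<delta> by (intro mult_mono) auto
    moreover have "(1 - \<eta>) * (1 - \<delta> / 4) = 1 - \<delta> / 4 - \<eta> * (1 - \<delta> / 4)"
      by (simp only: left_diff_distrib mult_1)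
    ultimately show "1 - \<delta> / 2 \<le> (1 - \<eta>) * (1 - \<delta> / 4)" using \<delta> by linarith
  qed (use nonneg E_rec \<eta>1 in auto)
  also have "(\<Sum>k=0..K. weight \<eta> k * (\<gamma>\<^sup>2 * ((4 * L / \<delta> + 4 * L) * G k + 2 * s k)))
      = \<gamma>\<^sup>2 * ((4 * L / \<delta> + 4 * L) * SG + 2 * SS)"
    unfolding SG_def SS_def sum_distrib_left sum.distrib[symmetric]
    by (intro sum.cong) (simp_all add: algebra_simps)
  finally have SE: "\<delta> / 4 * SE \<le> u * (\<gamma>\<^sup>2 * ((4 * L / \<delta> + 4 * L) * SG + 2 * SS))"
    by (simp add: E0)
  have "3 * p / 4 * SS \<le> u * s 0 + u * (\<Sum>k=0..K. weight \<eta> k * (2 * L * p * G k))"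
    unfolding SS_def u_def
  proof (rule weighted_contraction_sum)
    have "\<eta> * (1 - 3 * p / 4) \<le> p / 4 * 1" using \<eta> p by (intro mult_mono) auto
    moreover have "(1 - \<eta>) * (1 - 3 * p / 4) = 1 - 3 * p / 4 - \<eta> * (1 - 3 * p / 4)"
      by (simp only: left_diff_distrib mult_1)
    ultimately show "1 - p \<le> (1 - \<eta>) * (1 - 3 * p / 4)" using p by linarith
  qed (use nonneg s_rec \<eta>1 in auto)
  also have "(\<Sum>k=0..K. weight \<eta> k * (2 * L * p * G k)) = 2 * L * p * SG"
    unfolding SG_def sum_distrib_left by (intro sum.cong) auto
  finally have SS: "SS \<le> 4 / (3 * p) * u * s 0 + 8 * L / 3 * u * SG"
    using p by (simp add: field_simps)
  have "3 * L * SE = 12 * L / \<delta> * (\<delta> / 4 * SE)" using \<delta> by simp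
  also have "\<dots> \<le> 12 * L / \<delta> * (u * (\<gamma>\<^sup>2 * ((4 * L / \<delta> + 4 * L) * SG + 2 * SS)))"
    using L \<delta> by (intro mult_left_mono SE) auto
  also have "\<dots> \<le> 12 * L / \<delta> * (u * (\<gamma>\<^sup>2 * ((4 * L / \<delta> + 4 * L) * SG
      + 2 * (4 / (3 * p) * u * s 0 + 8 * L / 3 * u * SG))))"
    using L \<delta> u1 SS by (intro mult_left_mono add_left_mono) auto
  also have "\<dots> = 48 * L\<^sup>2 * \<gamma>\<^sup>2 / \<delta>\<^sup>2 * (u * (1 + \<delta> + 4 / 3 * \<delta> * u)) * SG
      + 32 * L * \<gamma>\<^sup>2 / (\<delta> * p) * u\<^sup>2 * s 0"
    using \<delta> p by (simp add: field_simps power2_eq_square)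
  also have "\<dots> \<le> 1 / 4 * SG + 48 * L * \<gamma>\<^sup>2 * (2 + p) / (\<delta> * p) * s 0"
  proof (intro add_mono mult_right_mono SG0 nonneg)
    have "u * (1 + \<delta>) \<le> (1 + \<delta> / 26) * (1 + \<delta>)" using u3 \<delta> by (intro mult_right_mono) auto
    also have "\<dots> \<le> 1 + \<delta> + \<delta> / 13" using \<delta> mult_left_mono[of \<delta> 1 \<delta>] by (simp add: algebra_simps)
    finally have t1: "u * (1 + \<delta>) \<le> 1 + \<delta> + \<delta> / 13" .
    have "u * u \<le> 27 / 26 * (27 / 26)" using u1 u2 by (intro mult_mono) auto
    then have "4 / 3 * \<delta> * (u * u) \<le> 4 / 3 * \<delta> * (27 / 26 * (27 / 26))"
      using \<delta> by (intro mult_left_mono) auto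
    moreover have "u * (1 + \<delta> + 4 / 3 * \<delta> * u) = u * (1 + \<delta>) + 4 / 3 * \<delta> * (u * u)"
      by (simp add: algebra_simps)
    ultimately have "u * (1 + \<delta> + 4 / 3 * \<delta> * u) \<le> 1 + 3 * \<delta>"
      using t1 \<delta> by linarith
    then have "48 * L\<^sup>2 * \<gamma>\<^sup>2 / \<delta>\<^sup>2 * (u * (1 + \<delta> + 4 / 3 * \<delta> * u)) \<le> 48 * L\<^sup>2 * \<gamma>\<^sup>2 / \<delta>\<^sup>2 * (1 + 3 * \<delta>)"
      by (intro mult_left_mono) auto
    also have "\<dots> = 1 / 4 * (192 * L\<^sup>2 * \<gamma>\<^sup>2 * (1 + 3 * \<delta>) / \<delta>\<^sup>2)" by simp
    also have "\<dots> \<le> 1 / 4 * 1"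
      using \<gamma> \<delta> by (intro mult_left_mono) (auto simp: divide_le_eq)
    finally show "48 * L\<^sup>2 * \<gamma>\<^sup>2 / \<delta>\<^sup>2 * (u * (1 + \<delta> + 4 / 3 * \<delta> * u)) \<le> 1 / 4" by simp
    have "u * u \<le> 27 / 26 * (27 / 26)" using u1 u2 by (intro mult_mono) auto
    then have "u\<^sup>2 \<le> 3 + 3 * p / 2" unfolding power2_eq_square using p by linarith
    then have "32 * L * \<gamma>\<^sup>2 / (\<delta> * p) * u\<^sup>2 \<le> 32 * L * \<gamma>\<^sup>2 / (\<delta> * p) * (3 + 3 * p / 2)"
      by (rule mult_left_mono) (use L \<delta> p in simp)
    also have "\<dots> = 32 * L * \<gamma>\<^sup>2 * (3 + 3 * p / 2) / (\<delta> * p)" by simp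
    also have "32 * L * \<gamma>\<^sup>2 * (3 + 3 * p / 2) = 48 * L * \<gamma>\<^sup>2 * (2 + p)"
      by (simp add: algebra_simps)
    finally show "32 * L * \<gamma>\<^sup>2 / (\<delta> * p) * u\<^sup>2 \<le> 48 * L * \<gamma>\<^sup>2 * (2 + p) / (\<delta> * p)" .
  qed
  finally show ?thesis unfolding SE_def SG_def .
qed

text \<open>The weights are chosen so that the contraction factor shifts the index of the weight by one.\<close>

lemma weighted_telescope:
  fixes T b :: "nat \<Rightarrow> real"
  assumes \<eta>: "\<eta> < 1" and rec: "\<And>k. T (Suc k) \<le> (1 - \<eta>) * T k + b k"
  shows "weight \<eta> K * T (Suc K) \<le> T 0 + (\<Sum>k=0..K. weight \<eta> k * b k)"
proof -
  have step: "weight \<eta> k * T (Suc k) \<le> weight \<eta> k * (1 - \<eta>) * T k + weight \<eta> k * b k" for k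
    using mult_left_mono[OF rec[of k], of "weight \<eta> k"] weight_pos[OF \<eta>, of k]
    by (simp add: distrib_left mult.assoc)
  show ?thesis
  proof (induction K)
    case 0
    show ?case using step[of 0] \<eta> by (simp add: weight_def)
  next
    case (Suc K)
    then show ?case using step[of "Suc K"] by (simp add: weight_Suc[OF \<eta>])
  qed
qed

text \<open>Here \<open>D\<close> stands for the expected squared distance of the virtual sequence from the minimizer and \<open>Eb\<close>
  for the expected squared averaged error. In the Lyapunov function, \<open>s\<close> has the factor
  \<open>M = 8 / (3 p)\<close> because it solves \<open>2 + M (1 - p) = M (1 - p / 4)\<close>: the noise \<open>2 \<gamma>\<^sup>2 s\<close> of a step is
  absorbed and the rate \<open>p / 4\<close> remains. The gaps produced by noise and shift together have the
  coefficient \<open>28/3 L \<gamma>\<^sup>2\<close>, which \<open>\<gamma> \<le> 3 / (56 L)\<close> bounds by \<open>\<gamma> / 2\<close>.\<close>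

lemma lyapunov_budget:
  fixes D s G Eb :: "nat \<Rightarrow> real"
  assumes L: "L > 0" and p: "0 < p" and \<gamma>: "0 < \<gamma>" "\<gamma> \<le> 3 / (56 * L)"
    and \<eta>: "\<eta> < 1" "\<eta> \<le> \<gamma> * \<mu> / 2" "\<eta> \<le> p / 4"
    and nonneg: "\<And>k. 0 \<le> D k" "\<And>k. 0 \<le> s k" "\<And>k. 0 \<le> G k"
    and D_rec: "\<And>k. D (Suc k) \<le> (1 - \<gamma> * \<mu> / 2) * D k - \<gamma> * G k + 3 * L * \<gamma> * Eb k
        + \<gamma>\<^sup>2 * (4 * L * G k + 2 * s k)"
    and s_rec: "\<And>k. s (Suc k) \<le> (1 - p) * s k + 2 * L * p * G k"
    and error: "3 * L * (\<Sum>k=0..K. weight \<eta> k * Eb k) \<le> 1 / 4 * (\<Sum>k=0..K. weight \<eta> k * G k) + R"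
  shows "(\<Sum>k=0..K. weight \<eta> k * G k) \<le> 4 * (D 0 + 8 / (3 * p) * \<gamma>\<^sup>2 * s 0 + \<gamma> * R) / \<gamma>"
proof -
  define T where "T k = D k + 8 / (3 * p) * \<gamma>\<^sup>2 * s k" for k
  have T_rec: "T (Suc k) \<le> (1 - \<eta>) * T k + (3 * L * \<gamma> * Eb k - \<gamma> / 2 * G k)" for k
  proof -
    have "8 / (3 * p) * \<gamma>\<^sup>2 * s (Suc k) \<le> 8 / (3 * p) * \<gamma>\<^sup>2 * ((1 - p) * s k + 2 * L * p * G k)"
      using p by (intro mult_left_mono s_rec) auto
    also have "\<dots> = 8 / (3 * p) * \<gamma>\<^sup>2 * s k - 8 / 3 * \<gamma>\<^sup>2 * s k + 16 / 3 * L * \<gamma>\<^sup>2 * G k"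
      using p by (simp add: field_simps)
    finally have s_part: "8 / (3 * p) * \<gamma>\<^sup>2 * s (Suc k)
      \<le> 8 / (3 * p) * \<gamma>\<^sup>2 * s k - 8 / 3 * \<gamma>\<^sup>2 * s k + 16 / 3 * L * \<gamma>\<^sup>2 * G k" .
    have "\<gamma> * L \<le> 3 / 56" using \<gamma> L by (simp add: field_simps)
    then have "\<gamma> * (\<gamma> * L) \<le> \<gamma> * (3 / 56)" using \<gamma> by (intro mult_left_mono) auto
    then have "28 / 3 * (L * \<gamma>\<^sup>2) \<le> \<gamma> / 2" by (simp add: power2_eq_square mult_ac)
    from mult_right_mono[OF this nonneg(3)[of k]]
    have G_part: "28 / 3 * (L * \<gamma>\<^sup>2) * G k \<le> \<gamma> / 2 * G k" .
    have D_part: "\<eta> * D k \<le> \<gamma> * \<mu> / 2 * D k" using \<eta> nonneg by (intro mult_right_mono) auto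
    have "\<eta> * (8 / (3 * p) * \<gamma>\<^sup>2 * s k) \<le> p / 4 * (8 / (3 * p) * \<gamma>\<^sup>2 * s k)"
      using \<eta> nonneg p by (intro mult_right_mono) auto
    also have "\<dots> = 2 / 3 * \<gamma>\<^sup>2 * s k" using p by simp
    finally have "\<eta> * T k \<le> \<gamma> * \<mu> / 2 * D k + 2 / 3 * \<gamma>\<^sup>2 * s k"
      unfolding T_def distrib_left using D_part by linarith
    moreover have "T (Suc k) \<le> (D k - \<gamma> * \<mu> / 2 * D k) - \<gamma> * G k + 3 * L * \<gamma> * Eb k
        + (4 * (L * \<gamma>\<^sup>2) * G k + 2 * (\<gamma>\<^sup>2 * s k))
        + (8 / (3 * p) * \<gamma>\<^sup>2 * s k - 8 / 3 * \<gamma>\<^sup>2 * s k + 16 / 3 * L * \<gamma>\<^sup>2 * G k)"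
      using D_rec[of k] s_part by (simp add: T_def algebra_simps)
    moreover have "(1 - \<eta>) * T k = D k + 8 / (3 * p) * \<gamma>\<^sup>2 * s k - \<eta> * T k"
      by (simp add: T_def left_diff_distrib)
    ultimately show ?thesis using G_part by linarith
  qed
  let ?G = "\<Sum>k=0..K. weight \<eta> k * G k" and ?E = "\<Sum>k=0..K. weight \<eta> k * Eb k"
  have "0 \<le> weight \<eta> K * T (Suc K)"
    using weight_pos[OF \<eta>(1), of K] nonneg p by (simp add: T_def)
  also have "\<dots> \<le> T 0 + (\<Sum>k=0..K. weight \<eta> k * (3 * L * \<gamma> * Eb k - \<gamma> / 2 * G k))"
    by (rule weighted_telescope[where T = T, OF \<eta>(1)]) (rule T_rec)
  also have "(\<Sum>k=0..K. weight \<eta> k * (3 * L * \<gamma> * Eb k - \<gamma> / 2 * G k)) = \<gamma> * (3 * L * ?E) - \<gamma> / 2 * ?G"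
    unfolding sum_distrib_left sum_subtractf[symmetric]
    by (intro sum.cong) (simp_all add: algebra_simps)
  also have "T 0 + (\<gamma> * (3 * L * ?E) - \<gamma> / 2 * ?G) \<le> T 0 + (\<gamma> * (1 / 4 * ?G + R) - \<gamma> / 2 * ?G)"
    using \<gamma> by (intro add_left_mono diff_right_mono mult_left_mono error) auto
  finally have "\<gamma> / 4 * ?G \<le> T 0 + \<gamma> * R" by (simp add: algebra_simps)
  then show ?thesis using \<gamma> by (simp add: T_def field_simps)
qed

lemma weight_sum_0: "weight_sum 0 K = real K + 1"
  by (simp add: weight_sum_def weight_def)

lemma inverse_weight_sum_le:
  assumes "0 \<le> \<eta>" "\<eta> < 1"
  shows "1 / weight_sum \<eta> K \<le> (1 - \<eta>) ^ K"
proof -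
  have "weight \<eta> K \<le> weight_sum \<eta> K"
    unfolding weight_sum_def using weight_pos[OF assms(2)] by (intro member_le_sum) (auto simp: less_imp_le)
  then have "1 / weight_sum \<eta> K \<le> 1 / weight \<eta> K"
    using weight_pos[OF assms(2), of K] by (intro divide_left_mono) auto
  also have "\<dots> = (1 - \<eta>) ^ K * (1 - \<eta>)" by (simp add: weight_def)
  also have "\<dots> \<le> (1 - \<eta>) ^ K" using assms by (intro mult_left_le) auto
  finally show ?thesis .
qed

section \<open>The iterates: measurability and integrability\<close>

locale ec_lsvrg = finite_sum_problem f n m L \<mu> xs + prob_space M
  for f :: "nat \<Rightarrow> nat \<Rightarrow> 'a::euclidean_space \<Rightarrow> real" and n m :: nat and L \<mu> :: real and xs :: 'a
    and M :: "'w measure" +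
  fixes \<gamma> \<delta> p :: real and x0 :: 'a and w0 :: "nat \<Rightarrow> 'a"
    and Q :: "'c measure" and C :: "'c \<Rightarrow> 'a \<Rightarrow> 'a"
    and Z :: "nat \<Rightarrow> nat \<Rightarrow> 'w \<Rightarrow> nat \<times> 'c \<times> bool"
    and x :: "nat \<Rightarrow> 'w \<Rightarrow> 'a" and w e g v :: "nat \<Rightarrow> nat \<Rightarrow> 'w \<Rightarrow> 'a"
  assumes C: "compressor \<delta> Q C" and p: "0 < p" "p < 1" and \<gamma>_pos: "0 < \<gamma>"
    and \<gamma>_le: "\<gamma> \<le> min (3 / (56 * L)) (\<delta> / (8 * L * sqrt (3 * (1 + \<delta> * (1 + 2 / (1 - p))))))"
    and fresh: "fresh_randomness M n (step_law m Q p) Z"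
    and algorithm: "EC_LSVRGstar n m f xs \<gamma> C x0 w0 M Z x w e g v"
begin

abbreviation "N \<equiv> step_law m Q p"
abbreviation "F k \<equiv> past M n N Z k"
abbreviation "gap k \<omega> \<equiv> obj (x k \<omega>) - obj xs"
abbreviation "shift_sq k \<omega> \<equiv> grad_shift_sq n m f xs (\<lambda>i. w k i \<omega>)"
abbreviation "est k i l \<omega> \<equiv> lsvrg i (x k \<omega>) (w k i \<omega>) l"
abbreviation "est_mean k i \<omega> \<equiv> grad (worker i) (x k \<omega>) - grad (worker i) xs"
abbreviation "g_avg k \<omega> \<equiv> (1 / real n) *\<^sub>R (\<Sum>i=1..n. g k i \<omega>)"
abbreviation "e_avg k \<omega> \<equiv> (1 / real n) *\<^sub>R (\<Sum>i=1..n. e k i \<omega>)"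

lemma \<delta>: "0 < \<delta>" "\<delta> \<le> 1" and prob_space_Q: "prob_space Q"
  and C_measurable: "(\<lambda>(s, x). C s x) \<in> borel_measurable (Q \<Otimes>\<^sub>M borel)"
  using C by (auto simp: compressor_def)

lemma x_init: "\<omega> \<in> space M \<Longrightarrow> x 0 \<omega> = x0"
  and w_init: "\<omega> \<in> space M \<Longrightarrow> i \<in> {1..n} \<Longrightarrow> w 0 i \<omega> = w0 i"
  and e_init: "\<omega> \<in> space M \<Longrightarrow> i \<in> {1..n} \<Longrightarrow> e 0 i \<omega> = 0"
  and x_step: "\<omega> \<in> space M \<Longrightarrow> x (Suc k) \<omega> = x k \<omega> - (1 / real n) *\<^sub>R (\<Sum>i=1..n. v k i \<omega>)"
  using algorithm by (simp_all add: EC_LSVRGstar_def)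

lemma worker_step:
  assumes "\<omega> \<in> space M" "i \<in> {1..n}"
  shows "g k i \<omega> = est k i (fst (Z k i \<omega>)) \<omega>"
    and "v k i \<omega> = C (fst (snd (Z k i \<omega>))) (e k i \<omega> + \<gamma> *\<^sub>R g k i \<omega>)"
    and "e (Suc k) i \<omega> = e k i \<omega> + \<gamma> *\<^sub>R g k i \<omega> - v k i \<omega>"
    and "w (Suc k) i \<omega> = (if snd (snd (Z k i \<omega>)) then x k \<omega> else w k i \<omega>)"
proof -
  have "case Z k i \<omega> of (l, s, b) \<Rightarrow>
      g k i \<omega> = grad (f i l) (x k \<omega>) - grad (f i l) (w k i \<omega>) + grad (worker i) (w k i \<omega>) - grad (worker i) xs \<and>
      v k i \<omega> = C s (e k i \<omega> + \<gamma> *\<^sub>R g k i \<omega>) \<and>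
      e (Suc k) i \<omega> = e k i \<omega> + \<gamma> *\<^sub>R g k i \<omega> - v k i \<omega> \<and>
      w (Suc k) i \<omega> = (if b then x k \<omega> else w k i \<omega>)"
    by (rule algorithm[unfolded EC_LSVRGstar_def, THEN bspec, OF assms(1), THEN conjunct2,
          THEN conjunct2, THEN spec, of k, THEN conjunct1, THEN bspec, OF assms(2)])
  then show "g k i \<omega> = est k i (fst (Z k i \<omega>)) \<omega>"
    and "v k i \<omega> = C (fst (snd (Z k i \<omega>))) (e k i \<omega> + \<gamma> *\<^sub>R g k i \<omega>)"
    and "e (Suc k) i \<omega> = e k i \<omega> + \<gamma> *\<^sub>R g k i \<omega> - v k i \<omega>"
    and "w (Suc k) i \<omega> = (if snd (snd (Z k i \<omega>)) then x k \<omega> else w k i \<omega>)"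
    by (simp_all add: case_prod_beta' lsvrg_def)
qed

lemma draw: "i \<in> {1..n} \<Longrightarrow> fresh_step M (F k) m Q p (Z k i)"
  using fresh_randomness_fresh_draw[OF prob_space_axioms fresh, of i k] m prob_space_Q p
  by (simp add: fresh_step_def fresh_step_axioms_def)

lemma past_algebra: "finite_measure_subalgebra M (F k)"
proof -
  interpret fresh_step M "F k" m Q p "Z k 1" by (rule draw) (use n in simp)
  show ?thesis by (rule cond.finite_measure_subalgebra_axioms)
qed

lemma past_measurable_imp: "X \<in> measurable (F k) K \<Longrightarrow> X \<in> measurable M K"
  using finite_measure_subalgebra.subalg[OF past_algebra] by (rule measurable_from_subalg)

lemma draw_measurable_next: "i \<in> {1..n} \<Longrightarrow> Z k i \<in> measurable (F (Suc k)) N"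
  by (rule measurable_draw_past) (use fresh_draw.draw_measurable[OF fresh_step.axioms(1)[OF draw]] in auto)

lemma grad_measurable: "i \<in> {1..n} \<Longrightarrow> l \<in> {1..m} \<Longrightarrow> grad (f i l) \<in> borel_measurable borel"
  by (rule L_smooth_grad_measurable) (rule smooth)

lemma grad_worker_measurable: "i \<in> {1..n} \<Longrightarrow> grad (worker i) \<in> borel_measurable borel"
  by (rule L_smooth_grad_measurable) (rule worker_smooth)

lemma lsvrg_measurable:
  assumes "i \<in> {1..n}" "l \<in> {1..m}" "y \<in> borel_measurable K" "u \<in> borel_measurable K"
  shows "(\<lambda>\<omega>. lsvrg i (y \<omega>) (u \<omega>) l) \<in> borel_measurable K"
  unfolding lsvrg_def
  by (intro borel_measurable_diff borel_measurable_add borel_measurable_const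
      measurable_compose[OF assms(3) grad_measurable[OF assms(1,2)]]
      measurable_compose[OF assms(4) grad_measurable[OF assms(1,2)]]
      measurable_compose[OF assms(4) grad_worker_measurable[OF assms(1)]])

lemma square_integrable_grad:
  assumes "L_smooth L h" "square_integrable M y"
  shows "square_integrable M (\<lambda>\<omega>. grad h (y \<omega>))"
  by (rule square_integrable_lipschitz[OF finite_measure_axioms assms(2)
        L_smooth_grad_measurable[OF assms(1)] L_smooth_lipschitz[OF assms(1)]])

lemma square_integrable_lsvrg:
  assumes "i \<in> {1..n}" "l \<in> {1..m}" "square_integrable M y" "square_integrable M u"
  shows "square_integrable M (\<lambda>\<omega>. lsvrg i (y \<omega>) (u \<omega>) l)"
  unfolding lsvrg_def
  by (intro square_integrable_diff square_integrable_add square_integrable_const finite_measure_axioms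
      square_integrable_grad smooth worker_smooth assms)

text \<open>The invariant of the iteration; the pasts of successive steps form a filtration to which the iterates
  are adapted.\<close>

definition regular :: "nat \<Rightarrow> ('w \<Rightarrow> 'a) \<Rightarrow> bool" where
  "regular k X \<longleftrightarrow> X \<in> borel_measurable (F k) \<and> square_integrable M X"

lemma regularD:
  "regular k X \<Longrightarrow> X \<in> borel_measurable (F k)" "regular k X \<Longrightarrow> square_integrable M X"
  by (auto simp: regular_def)

lemma regular_cong:
  assumes "\<And>\<omega>. \<omega> \<in> space M \<Longrightarrow> X \<omega> = Y \<omega>"
  shows "regular k X \<longleftrightarrow> regular k Y"
proof -
  have "X \<in> borel_measurable (F k) \<longleftrightarrow> Y \<in> borel_measurable (F k)"
    by (rule measurable_cong) (simp add: assms)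
  moreover have "square_integrable M X \<longleftrightarrow> square_integrable M Y"
    by (rule square_integrable_cong) (rule assms)
  ultimately show ?thesis by (simp add: regular_def)
qed

lemma regular_const: "regular k (\<lambda>_. c)"
  by (simp add: regular_def square_integrable_const finite_measure_axioms)

lemma regular_add: "regular k X \<Longrightarrow> regular k Y \<Longrightarrow> regular k (\<lambda>\<omega>. X \<omega> + Y \<omega>)"
  by (auto simp: regular_def intro: square_integrable_add)

lemma regular_diff: "regular k X \<Longrightarrow> regular k Y \<Longrightarrow> regular k (\<lambda>\<omega>. X \<omega> - Y \<omega>)"
  by (auto simp: regular_def intro: square_integrable_diff)

lemma regular_scaleR: "regular k X \<Longrightarrow> regular k (\<lambda>\<omega>. c *\<^sub>R X \<omega>)"
  by (auto simp: regular_def intro: square_integrable_scaleR)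

lemma regular_sum: "(\<And>i. i \<in> I \<Longrightarrow> regular k (X i)) \<Longrightarrow> regular k (\<lambda>\<omega>. \<Sum>i\<in>I. X i \<omega>)"
  by (induction I rule: infinite_finite_induct) (auto intro!: regular_add regular_const)

lemma regular_Suc: "regular k X \<Longrightarrow> regular (Suc k) X"
  by (auto simp: regular_def intro: measurable_past_mono)

lemma regular_lsvrg:
  "i \<in> {1..n} \<Longrightarrow> l \<in> {1..m} \<Longrightarrow> regular k y \<Longrightarrow> regular k u \<Longrightarrow> regular k (\<lambda>\<omega>. lsvrg i (y \<omega>) (u \<omega>) l)"
  by (auto simp: regular_def intro: lsvrg_measurable square_integrable_lsvrg)

text \<open>Quantities that depend on the draw of step \<open>k\<close> belong to the past of step \<open>k + 1\<close>.\<close>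

lemma regular_index_choice:
  assumes i: "i \<in> {1..n}" and \<phi>: "\<And>l. l \<in> {1..m} \<Longrightarrow> regular k (\<phi> l)"
  shows "regular (Suc k) (\<lambda>\<omega>. \<phi> (fst (Z k i \<omega>)) \<omega>)"
proof -
  interpret fresh_step M "F k" m Q p "Z k i" by (rule draw[OF i])
  have "(\<lambda>\<omega>. \<phi> (fst (Z k i \<omega>)) \<omega>) \<in> borel_measurable (F (Suc k))"
  proof (rule measurable_compose_countable'[where I = "{1..m}" and g = "\<lambda>\<omega>. fst (Z k i \<omega>)"])
    show "(\<lambda>\<omega>. fst (Z k i \<omega>)) \<in> measurable (F (Suc k)) (count_space {1..m})"
      by (rule measurable_compose[OF draw_measurable_next[OF i] fst_law_measurable])
  qed (rule regularD(1)[OF regular_Suc[OF \<phi>]], assumption, simp)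
  moreover have "square_integrable M (\<lambda>\<omega>. \<phi> (fst (Z k i \<omega>)) \<omega>)"
    by (rule square_integrable_index_choice) (rule regularD(2)[OF \<phi>])
  ultimately show ?thesis by (simp add: regular_def)
qed

lemma regular_coin_choice:
  assumes i: "i \<in> {1..n}" and a: "regular k a" and b: "regular k b"
  shows "regular (Suc k) (\<lambda>\<omega>. if snd (snd (Z k i \<omega>)) then a \<omega> else b \<omega>)"
proof -
  interpret fresh_step M "F k" m Q p "Z k i" by (rule draw[OF i])
  have "(\<lambda>\<omega>. if snd (snd (Z k i \<omega>)) then a \<omega> else b \<omega>) \<in> borel_measurable (F (Suc k))"
    by (intro measurable_If regularD(1)[OF regular_Suc[OF a]] regularD(1)[OF regular_Suc[OF b]]
        iffD1[OF pred_def] measurable_compose[OF draw_measurable_next[OF i] coin_law_measurable])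
  then show ?thesis
    using square_integrable_coin_choice[OF regularD(2)[OF a] regularD(2)[OF b]] by (simp add: regular_def)
qed

lemma regular_compression_error:
  assumes i: "i \<in> {1..n}" and Y: "\<And>l. l \<in> {1..m} \<Longrightarrow> regular k (Y l)"
  shows "regular (Suc k) (\<lambda>\<omega>. Y (fst (Z k i \<omega>)) \<omega> - C (fst (snd (Z k i \<omega>))) (Y (fst (Z k i \<omega>)) \<omega>))"
    (is "regular _ ?R")
proof -
  interpret fresh_step M "F k" m Q p "Z k i" by (rule draw[OF i])
  let ?Y = "\<lambda>\<omega>. Y (fst (Z k i \<omega>)) \<omega>"
  have Y': "?Y \<in> borel_measurable (F (Suc k))"
    by (rule regularD(1)) (rule regular_index_choice[OF i Y])
  have "(\<lambda>\<omega>. (fst (snd (Z k i \<omega>)), ?Y \<omega>)) \<in> measurable (F (Suc k)) (Q \<Otimes>\<^sub>M borel)"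
    by (intro measurable_Pair Y' measurable_compose[OF draw_measurable_next[OF i] seed_law_measurable])
  from measurable_compose[OF this C_measurable]
  have "?R \<in> borel_measurable (F (Suc k))" using Y' by (intro borel_measurable_diff) simp_all
  moreover have "square_integrable M ?R"
    by (rule compression_error(1)[OF C]) (rule regularD[OF Y], assumption)+
  ultimately show ?thesis by (simp add: regular_def)
qed

text \<open>Every operation of a step preserves regularity. The transmitted vector is handled as the difference
  between the compressor input and the new error memory, since the compressor contract bounds the
  error and not the output.\<close>

lemma state_regular:
  "regular k (x k) \<and> (\<forall>i\<in>{1..n}. regular k (w k i) \<and> regular k (e k i))"
proof (induction k)
  case 0
  have "regular 0 (x 0)" using regular_cong[of "x 0" "\<lambda>_. x0"] by (simp add: x_init regular_const)
  moreover have "regular 0 (w 0 i)" if "i \<in> {1..n}" for i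
    using regular_cong[of "w 0 i" "\<lambda>_. w0 i"] that by (simp add: w_init regular_const)
  moreover have "regular 0 (e 0 i)" if "i \<in> {1..n}" for i
    using regular_cong[of "e 0 i" "\<lambda>_. 0"] that by (simp add: e_init regular_const)
  ultimately show ?case by blast
next
  case (Suc k)
  then have x: "regular k (x k)" and w: "\<And>i. i \<in> {1..n} \<Longrightarrow> regular k (w k i)"
    and e: "\<And>i. i \<in> {1..n} \<Longrightarrow> regular k (e k i)" by auto
  have w': "regular (Suc k) (w (Suc k) i)" if i: "i \<in> {1..n}" for i
    using regular_coin_choice[OF i x w[OF i]]
    by (rule iffD1[OF regular_cong, rotated]) (simp add: worker_step(4)[OF _ i])
  define Y where "Y i l \<omega> = e k i \<omega> + \<gamma> *\<^sub>R est k i l \<omega>" for i l \<omega>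
  have Y: "regular k (Y i l)" if "i \<in> {1..n}" "l \<in> {1..m}" for i l
    unfolding Y_def using that by (intro regular_add regular_scaleR regular_lsvrg x w e)
  have e': "regular (Suc k) (e (Suc k) i)" if i: "i \<in> {1..n}" for i
  proof -
    have "regular (Suc k) (\<lambda>\<omega>. Y i (fst (Z k i \<omega>)) \<omega> - C (fst (snd (Z k i \<omega>))) (Y i (fst (Z k i \<omega>)) \<omega>))"
      by (rule regular_compression_error[OF i Y[OF i]])
    then show ?thesis
      by (rule iffD1[OF regular_cong, rotated]) (simp add: worker_step[OF _ i] Y_def)
  qed
  have v: "regular (Suc k) (v k i)" if i: "i \<in> {1..n}" for i
  proof -
    have "regular (Suc k) (\<lambda>\<omega>. Y i (fst (Z k i \<omega>)) \<omega> - e (Suc k) i \<omega>)"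
      by (intro regular_diff regular_index_choice[OF i Y[OF i]] e' i)
    then show ?thesis
      by (rule iffD1[OF regular_cong, rotated]) (simp add: worker_step(1,3)[OF _ i] Y_def)
  qed
  have "regular (Suc k) (\<lambda>\<omega>. x k \<omega> - (1 / real n) *\<^sub>R (\<Sum>i=1..n. v k i \<omega>))"
    by (intro regular_diff regular_Suc[OF x] regular_scaleR regular_sum v)
  then have "regular (Suc k) (x (Suc k))"
    by (rule iffD1[OF regular_cong, rotated]) (simp add: x_step)
  with w' e' show ?case by blast
qed

lemma x_regular: "regular k (x k)"
  and w_regular: "i \<in> {1..n} \<Longrightarrow> regular k (w k i)"
  and e_regular: "i \<in> {1..n} \<Longrightarrow> regular k (e k i)"
  using state_regular[of k] by auto

lemma est_regular: "i \<in> {1..n} \<Longrightarrow> l \<in> {1..m} \<Longrightarrow> regular k (est k i l)"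
  by (intro regular_lsvrg x_regular w_regular)

lemma regular_grad: "L_smooth L h \<Longrightarrow> regular k y \<Longrightarrow> regular k (\<lambda>\<omega>. grad h (y \<omega>))"
  by (auto simp: regular_def intro: square_integrable_grad measurable_compose[OF _ L_smooth_grad_measurable])

lemma est_mean_regular: "i \<in> {1..n} \<Longrightarrow> regular k (est_mean k i)"
  by (intro regular_diff regular_const regular_grad worker_smooth x_regular)

lemma g_regular: "i \<in> {1..n} \<Longrightarrow> regular (Suc k) (g k i)"
proof -
  assume i: "i \<in> {1..n}"
  have "regular (Suc k) (\<lambda>\<omega>. est k i (fst (Z k i \<omega>)) \<omega>)"
    by (rule regular_index_choice[OF i]) (rule est_regular[OF i])
  then show ?thesis
    by (rule iffD1[OF regular_cong, rotated]) (simp add: worker_step(1)[OF _ i])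
qed

lemma g_avg_regular: "regular (Suc k) (g_avg k)"
  by (intro regular_scaleR regular_sum g_regular)

lemma e_avg_regular: "regular k (e_avg k)"
  by (intro regular_scaleR regular_sum e_regular)

lemma regular_norm_sq:
  assumes "regular k X"
  shows "(\<lambda>\<omega>. (norm (X \<omega>))\<^sup>2) \<in> borel_measurable (F k)" "integrable M (\<lambda>\<omega>. (norm (X \<omega>))\<^sup>2)"
  using regularD[OF assms] by (auto simp: square_integrable_def)

lemma regular_inner:
  assumes "regular k X" "regular k Y"
  shows "(\<lambda>\<omega>. X \<omega> \<bullet> Y \<omega>) \<in> borel_measurable (F k)" "integrable M (\<lambda>\<omega>. X \<omega> \<bullet> Y \<omega>)"
  using regularD(1)[OF assms(1)] regularD(1)[OF assms(2)]
    square_integrable_inner[OF regularD(2)[OF assms(1)] regularD(2)[OF assms(2)]] by auto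

text \<open>The gap lies between zero and a multiple of the squared distance from the minimizer.\<close>

lemma gap_regular: "(\<lambda>\<omega>. obj (y \<omega>) - obj xs) \<in> borel_measurable M"
    "integrable M (\<lambda>\<omega>. obj (y \<omega>) - obj xs)" if y: "square_integrable M y"
proof -
  show meas: "(\<lambda>\<omega>. obj (y \<omega>) - obj xs) \<in> borel_measurable M"
    using measurable_compose[OF square_integrableD(1)[OF y] L_smooth_measurable[OF obj_smooth]] by simp
  show "integrable M (\<lambda>\<omega>. obj (y \<omega>) - obj xs)"
  proof (rule Bochner_Integration.integrable_bound[OF _ meas])
    show "integrable M (\<lambda>\<omega>. L / 2 * (norm (y \<omega> - xs))\<^sup>2)"
      using square_integrableD(2)[OF square_integrable_diff[OF y square_integrable_const[OF finite_measure_axioms]]]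
      by simp
    show "AE \<omega> in M. norm (obj (y \<omega>) - obj xs) \<le> norm (L / 2 * (norm (y \<omega> - xs))\<^sup>2)"
      using gap_quadratic obj_minimal L by (intro AE_I2) simp
  qed
qed

lemma gap_integrable: "integrable M (gap k)"
  by (rule gap_regular(2)) (rule regularD(2)[OF x_regular])

lemma shift_integrable: "integrable M (shift_sq k)"
  unfolding grad_shift_sq_def
  by (intro Bochner_Integration.integrable_mult_right Bochner_Integration.integrable_sum
      square_integrableD(2) square_integrable_diff square_integrable_grad square_integrable_const
      finite_measure_axioms smooth regularD(2)[OF w_regular])

section \<open>Conditional moments of the gradient estimators\<close>

text \<open>Bridge between the process, which is specified on the sample space only, and the index average.
  It is applied with the coordinates of the estimator, with its squared norm, with its squared
  deviation and with its inner product with a regular vector.\<close>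

lemma cond_exp_of_draw:
  assumes i: "i \<in> {1..n}" and meas: "\<And>l. l \<in> {1..m} \<Longrightarrow> \<phi> l \<in> borel_measurable (F k)"
    and int: "\<And>l. l \<in> {1..m} \<Longrightarrow> integrable M (\<phi> l)"
    and X: "\<And>\<omega>. \<omega> \<in> space M \<Longrightarrow> X \<omega> = \<phi> (fst (Z k i \<omega>)) \<omega>"
  shows "integrable M X"
    and "AE \<omega> in M. real_cond_exp M (F k) X \<omega> = 1 / real m * (\<Sum>l=1..m. \<phi> l \<omega>)"
    and "(\<integral>\<omega>. X \<omega> \<partial>M) = (\<integral>\<omega>. 1 / real m * (\<Sum>l=1..m. \<phi> l \<omega>) \<partial>M)"
proof -
  interpret fresh_step M "F k" m Q p "Z k i" by (rule draw[OF i])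
  let ?X = "\<lambda>\<omega>. \<phi> (fst (Z k i \<omega>)) \<omega>"
  have X_int: "integrable M ?X" by (rule integrable_index_choice) (rule int)
  have "integrable M X \<longleftrightarrow> integrable M ?X"
    by (rule Bochner_Integration.integrable_cong) (simp_all add: X)
  with X_int show int_X: "integrable M X" by simp
  have "AE \<omega> in M. real_cond_exp M (F k) X \<omega> = real_cond_exp M (F k) ?X \<omega>"
    by (rule cond.real_cond_exp_cong) (use X int_X X_int in auto)
  moreover have "AE \<omega> in M. real_cond_exp M (F k) ?X \<omega> = 1 / real m * (\<Sum>l=1..m. \<phi> l \<omega>)"
    by (rule cond_exp_index) (rule meas int, assumption)+
  ultimately show "AE \<omega> in M. real_cond_exp M (F k) X \<omega> = 1 / real m * (\<Sum>l=1..m. \<phi> l \<omega>)"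
    by eventually_elim simp
  have "(\<integral>\<omega>. X \<omega> \<partial>M) = (\<integral>\<omega>. ?X \<omega> \<partial>M)"
    by (rule Bochner_Integration.integral_cong) (simp_all add: X)
  also have "\<dots> = (\<integral>\<omega>. 1 / real m * (\<Sum>l=1..m. \<phi> l \<omega>) \<partial>M)"
    by (rule integral_index_choice) (rule meas int, assumption)+
  finally show "(\<integral>\<omega>. X \<omega> \<partial>M) = (\<integral>\<omega>. 1 / real m * (\<Sum>l=1..m. \<phi> l \<omega>) \<partial>M)" .
qed

lemma est_inner_mean:
  "i \<in> {1..n} \<Longrightarrow> 1 / real m * (\<Sum>l=1..m. b \<bullet> est k i l \<omega>) = b \<bullet> est_mean k i \<omega>"
  using arg_cong[OF lsvrg_mean[of i "x k \<omega>" "w k i \<omega>"], of "\<lambda>t. b \<bullet> t"] by (simp add: inner_sum_right)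

lemma cond_exp_coordinate:
  assumes i: "i \<in> {1..n}"
  shows "integrable M (\<lambda>\<omega>. g k i \<omega> \<bullet> b)"
    and "AE \<omega> in M. real_cond_exp M (F k) (\<lambda>\<omega>. g k i \<omega> \<bullet> b) \<omega> = est_mean k i \<omega> \<bullet> b"
proof -
  note reg = regular_inner[OF regular_const est_regular[OF i], of _ b k]
  have X: "g k i \<omega> \<bullet> b = b \<bullet> est k i (fst (Z k i \<omega>)) \<omega>" if "\<omega> \<in> space M" for \<omega>
    by (simp only: worker_step(1)[OF that i] inner_commute)
  show "integrable M (\<lambda>\<omega>. g k i \<omega> \<bullet> b)"
    by (rule cond_exp_of_draw(1)[OF i, of "\<lambda>l \<omega>. b \<bullet> est k i l \<omega>"]) (rule reg X, assumption)+
  have "AE \<omega> in M. real_cond_exp M (F k) (\<lambda>\<omega>. g k i \<omega> \<bullet> b) \<omega> = 1 / real m * (\<Sum>l=1..m. b \<bullet> est k i l \<omega>)"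
    by (rule cond_exp_of_draw(2)[OF i, of "\<lambda>l \<omega>. b \<bullet> est k i l \<omega>"]) (rule reg X, assumption)+
  then show "AE \<omega> in M. real_cond_exp M (F k) (\<lambda>\<omega>. g k i \<omega> \<bullet> b) \<omega> = est_mean k i \<omega> \<bullet> b"
    by (simp only: est_inner_mean[OF i] inner_commute)
qed

lemma cond_exp_g:
  assumes i: "i \<in> {1..n}"
  shows "AE \<omega> in M. vec_cond_exp M (F k) (g k i) \<omega> = est_mean k i \<omega>"
proof -
  interpret cond: finite_measure_subalgebra M "F k" by (rule past_algebra)
  show ?thesis by (rule cond.vec_cond_expI) (rule cond_exp_coordinate[OF i])
qed

text \<open>Unbiasedness of the averaged estimator: the shifts by the worker gradients at the minimizer cancel.\<close>

lemma average_est_mean: "(1 / real n) *\<^sub>R (\<Sum>i=1..n. est_mean k i \<omega>) = grad obj (x k \<omega>)"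
  using grad_obj[of "x k \<omega>"] grad_obj[of xs]
  by (simp add: sum_subtractf scaleR_diff_right grad_obj_minimizer)

lemma cond_exp_g_avg: "AE \<omega> in M. vec_cond_exp M (F k) (g_avg k) \<omega> = grad obj (x k \<omega>)"
proof -
  interpret cond: finite_measure_subalgebra M "F k" by (rule past_algebra)
  show ?thesis
  proof (rule cond.vec_cond_expI)
    fix b :: 'a
    have "AE \<omega> in M. real_cond_exp M (F k) (\<lambda>\<omega>. 1 / real n * (\<Sum>i=1..n. g k i \<omega> \<bullet> b)) \<omega>
        = 1 / real n * (\<Sum>i=1..n. est_mean k i \<omega> \<bullet> b)"
      by (rule cond.cond_exp_average) (rule cond_exp_coordinate, assumption)+
    moreover have "1 / real n * (\<Sum>i=1..n. est_mean k i \<omega> \<bullet> b) = grad obj (x k \<omega>) \<bullet> b" for \<omega>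
      unfolding average_est_mean[symmetric] by (simp add: inner_sum_left)
    moreover have "(\<lambda>\<omega>. g_avg k \<omega> \<bullet> b) = (\<lambda>\<omega>. 1 / real n * (\<Sum>i=1..n. g k i \<omega> \<bullet> b))"
      by (simp add: inner_sum_left)
    ultimately show "AE \<omega> in M. real_cond_exp M (F k) (\<lambda>\<omega>. g_avg k \<omega> \<bullet> b) \<omega> = grad obj (x k \<omega>) \<bullet> b"
      by (simp only:)
  qed
qed

lemma mean_bound:
  "AE \<omega> in M. 1 / real n * (\<Sum>i=1..n. (norm (vec_cond_exp M (F k) (g k i) \<omega>))\<^sup>2) \<le> 2 * L * gap k \<omega>"
proof -
  have "AE \<omega> in M. \<forall>i\<in>{1..n}. vec_cond_exp M (F k) (g k i) \<omega> = est_mean k i \<omega>"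
    by (intro AE_finite_allI cond_exp_g) auto
  then show ?thesis
    by eventually_elim (use worker_grad_bound in simp)
qed

text \<open>The conditional mean is replaced by its explicit version, from which it differs on a null set, before
  the past is frozen.\<close>

lemma cond_exp_deviation:
  assumes i: "i \<in> {1..n}"
  shows "integrable M (\<lambda>\<omega>. (norm (g k i \<omega> - vec_cond_exp M (F k) (g k i) \<omega>))\<^sup>2)"
    and "AE \<omega> in M. real_cond_exp M (F k) (\<lambda>\<omega>. (norm (g k i \<omega> - vec_cond_exp M (F k) (g k i) \<omega>))\<^sup>2) \<omega>
      = 1 / real m * (\<Sum>l=1..m. (norm (est k i l \<omega> - est_mean k i \<omega>))\<^sup>2)"
proof -
  interpret cond: finite_measure_subalgebra M "F k" by (rule past_algebra)
  let ?D = "\<lambda>\<omega>. (norm (g k i \<omega> - vec_cond_exp M (F k) (g k i) \<omega>))\<^sup>2"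
  let ?D' = "\<lambda>\<omega>. (norm (g k i \<omega> - est_mean k i \<omega>))\<^sup>2"
  note [measurable] = past_measurable_imp[OF regularD(1)[OF g_regular[OF i]]] vec_cond_exp_measurable
  have D_meas: "?D \<in> borel_measurable M" by measurable
  have eq: "AE \<omega> in M. ?D' \<omega> = ?D \<omega>"
    using cond_exp_g[OF i, of k] by eventually_elim simp
  note reg = regular_norm_sq[OF regular_diff[OF est_regular[OF i] est_mean_regular[OF i]]]
  have X: "?D' \<omega> = (norm (est k i (fst (Z k i \<omega>)) \<omega> - est_mean k i \<omega>))\<^sup>2" if "\<omega> \<in> space M" for \<omega>
    by (simp only: worker_step(1)[OF that i])
  have D'_int: "integrable M ?D'"
    by (rule cond_exp_of_draw(1)[OF i, of "\<lambda>l \<omega>. (norm (est k i l \<omega> - est_mean k i \<omega>))\<^sup>2"])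
       (rule reg X, assumption)+
  have D'_cond: "AE \<omega> in M. real_cond_exp M (F k) ?D' \<omega>
      = 1 / real m * (\<Sum>l=1..m. (norm (est k i l \<omega> - est_mean k i \<omega>))\<^sup>2)"
    by (rule cond_exp_of_draw(2)[OF i, of "\<lambda>l \<omega>. (norm (est k i l \<omega> - est_mean k i \<omega>))\<^sup>2"])
       (rule reg X, assumption)+
  show "integrable M ?D" by (rule Bochner_Integration.integrable_cong_AE_imp[OF D'_int D_meas]) (use eq in eventually_elim, simp)
  have "AE \<omega> in M. real_cond_exp M (F k) ?D' \<omega> = real_cond_exp M (F k) ?D \<omega>"
    by (rule cond.real_cond_exp_cong[OF eq borel_measurable_integrable[OF D'_int] D_meas])
  with D'_cond show "AE \<omega> in M. real_cond_exp M (F k) ?D \<omega>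
      = 1 / real m * (\<Sum>l=1..m. (norm (est k i l \<omega> - est_mean k i \<omega>))\<^sup>2)"
    by eventually_elim simp
qed

text \<open>The pointwise form of the variance bound; the recursion of the error memory uses it as well.\<close>

lemma deviation_bound:
  "1 / real n * (\<Sum>i=1..n. 1 / real m * (\<Sum>l=1..m. (norm (est k i l \<omega> - est_mean k i \<omega>))\<^sup>2))
    \<le> 4 * L * gap k \<omega> + 2 * shift_sq k \<omega>"
  by (rule average_moment_bound[of _ _ "\<lambda>i. w k i \<omega>"]) (rule lsvrg_deviation)

lemma variance_bound:
  "AE \<omega> in M. 1 / real n * (\<Sum>i=1..n. real_cond_exp M (F k)
      (\<lambda>\<omega>. (norm (g k i \<omega> - vec_cond_exp M (F k) (g k i) \<omega>))\<^sup>2) \<omega>) \<le> 4 * L * gap k \<omega> + 2 * shift_sq k \<omega>"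
proof -
  have "AE \<omega> in M. \<forall>i\<in>{1..n}. real_cond_exp M (F k)
      (\<lambda>\<omega>. (norm (g k i \<omega> - vec_cond_exp M (F k) (g k i) \<omega>))\<^sup>2) \<omega>
      = 1 / real m * (\<Sum>l=1..m. (norm (est k i l \<omega> - est_mean k i \<omega>))\<^sup>2)"
    by (intro AE_finite_allI cond_exp_deviation) auto
  then show ?thesis
  proof eventually_elim
    case (elim \<omega>)
    then have "(\<Sum>i=1..n. real_cond_exp M (F k)
      (\<lambda>\<omega>. (norm (g k i \<omega> - vec_cond_exp M (F k) (g k i) \<omega>))\<^sup>2) \<omega>)
      = (\<Sum>i=1..n. 1 / real m * (\<Sum>l=1..m. (norm (est k i l \<omega> - est_mean k i \<omega>))\<^sup>2))"
      by (intro sum.cong refl) blast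
    then show ?case using deviation_bound[of k \<omega>] by (simp only:)
  qed
qed

lemma second_moment_bound:
  "integrable M (\<lambda>\<omega>. (norm (g_avg k \<omega>))\<^sup>2)"
  "AE \<omega> in M. real_cond_exp M (F k) (\<lambda>\<omega>. (norm (g_avg k \<omega>))\<^sup>2) \<omega> \<le> 4 * L * gap k \<omega> + 2 * shift_sq k \<omega>"
proof -
  interpret cond: finite_measure_subalgebra M "F k" by (rule past_algebra)
  show int: "integrable M (\<lambda>\<omega>. (norm (g_avg k \<omega>))\<^sup>2)" by (rule regular_norm_sq(2)[OF g_avg_regular])
  let ?S = "\<lambda>\<omega>. 1 / real n * (\<Sum>i=1..n. (norm (g k i \<omega>))\<^sup>2)"
  have gi: "integrable M (\<lambda>\<omega>. (norm (g k i \<omega>))\<^sup>2)" if "i \<in> {1..n}" for i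
    by (rule regular_norm_sq(2)[OF g_regular[OF that]])
  have S_int: "integrable M ?S"
    by (intro Bochner_Integration.integrable_mult_right Bochner_Integration.integrable_sum gi)
  have mono: "AE \<omega> in M. real_cond_exp M (F k) (\<lambda>\<omega>. (norm (g_avg k \<omega>))\<^sup>2) \<omega> \<le> real_cond_exp M (F k) ?S \<omega>"
    by (rule cond.real_cond_exp_mono[OF _ int S_int]) (intro AE_I2 norm_average_sq_le n)
  have exact: "AE \<omega> in M. real_cond_exp M (F k) ?S \<omega>
      = 1 / real n * (\<Sum>i=1..n. 1 / real m * (\<Sum>l=1..m. (norm (est k i l \<omega>))\<^sup>2))"
  proof (rule cond.cond_exp_average[OF gi], assumption)
    fix i assume i: "i \<in> {1..n}"
    note reg = regular_norm_sq[OF est_regular[OF i]]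
    have X: "(norm (g k i \<omega>))\<^sup>2 = (norm (est k i (fst (Z k i \<omega>)) \<omega>))\<^sup>2" if "\<omega> \<in> space M" for \<omega>
      by (simp only: worker_step(1)[OF that i])
    show "AE \<omega> in M. real_cond_exp M (F k) (\<lambda>\<omega>. (norm (g k i \<omega>))\<^sup>2) \<omega>
        = 1 / real m * (\<Sum>l=1..m. (norm (est k i l \<omega>))\<^sup>2)"
      by (rule cond_exp_of_draw(2)[OF i, of "\<lambda>l \<omega>. (norm (est k i l \<omega>))\<^sup>2"]) (rule reg X, assumption)+
  qed
  have bound: "1 / real n * (\<Sum>i=1..n. 1 / real m * (\<Sum>l=1..m. (norm (est k i l \<omega>))\<^sup>2))
      \<le> 4 * L * gap k \<omega> + 2 * shift_sq k \<omega>" for \<omega>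
    by (rule average_moment_bound[of _ _ "\<lambda>i. w k i \<omega>"]) (rule lsvrg_second_moment)
  from mono exact
  show "AE \<omega> in M. real_cond_exp M (F k) (\<lambda>\<omega>. (norm (g_avg k \<omega>))\<^sup>2) \<omega> \<le> 4 * L * gap k \<omega> + 2 * shift_sq k \<omega>"
  proof eventually_elim
    case (elim \<omega>)
    then show ?case using bound[of \<omega>] by linarith
  qed
qed

text \<open>Given the past, the reference point is the current iterate with probability \<open>p\<close> and the old
  reference point otherwise.\<close>

lemma shift_recursion:
  "AE \<omega> in M. real_cond_exp M (F k) (shift_sq (Suc k)) \<omega> \<le> (1 - p) * shift_sq k \<omega> + 2 * (L * p) * gap k \<omega>"
proof -
  interpret cond: finite_measure_subalgebra M "F k" by (rule past_algebra)
  define \<phi> where "\<phi> i y = 1 / real m * (\<Sum>j=1..m. (norm (grad (f i j) y - grad (f i j) xs))\<^sup>2)" for i y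
  have diff_reg: "regular k (\<lambda>\<omega>. grad (f i j) (y \<omega>) - grad (f i j) xs)"
    if "i \<in> {1..n}" "j \<in> {1..m}" "regular k y" for i j y
    by (intro regular_diff regular_grad smooth regular_const that)
  have \<phi>_meas: "(\<lambda>\<omega>. \<phi> i (y \<omega>)) \<in> borel_measurable (F k)" if "i \<in> {1..n}" "regular k y" for i y
    unfolding \<phi>_def
    by (intro borel_measurable_times borel_measurable_sum borel_measurable_const
        regular_norm_sq(1)[OF diff_reg] that)
  have \<phi>_int: "integrable M (\<lambda>\<omega>. \<phi> i (y \<omega>))" if "i \<in> {1..n}" "regular k y" for i y
    unfolding \<phi>_def
    by (intro Bochner_Integration.integrable_mult_right Bochner_Integration.integrable_sum
        regular_norm_sq(2)[OF diff_reg] that)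
  let ?X = "\<lambda>i \<omega>. if snd (snd (Z k i \<omega>)) then \<phi> i (x k \<omega>) else \<phi> i (w k i \<omega>)"
  have X_int: "integrable M (?X i)" if i: "i \<in> {1..n}" for i
  proof -
    interpret fresh_step M "F k" m Q p "Z k i" by (rule draw[OF i])
    show ?thesis by (intro integrable_coin_choice \<phi>_int i x_regular w_regular)
  qed
  have X_cond: "AE \<omega> in M. real_cond_exp M (F k) (?X i) \<omega> = p * \<phi> i (x k \<omega>) + (1 - p) * \<phi> i (w k i \<omega>)"
    if i: "i \<in> {1..n}" for i
  proof -
    interpret fresh_step M "F k" m Q p "Z k i" by (rule draw[OF i])
    show ?thesis by (intro cond_exp_coin \<phi>_int \<phi>_meas i x_regular w_regular)
  qed
  have shift_eq: "shift_sq (Suc k) \<omega> = 1 / real n * (\<Sum>i=1..n. ?X i \<omega>)" if "\<omega> \<in> space M" for \<omega>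
    unfolding grad_shift_sq_average \<phi>_def[symmetric]
    by (intro arg_cong[of _ _ "\<lambda>t. 1 / real n * t"] sum.cong) (simp_all add: worker_step(4)[OF that])
  have S_int: "integrable M (\<lambda>\<omega>. 1 / real n * (\<Sum>i=1..n. ?X i \<omega>))"
    by (intro Bochner_Integration.integrable_mult_right Bochner_Integration.integrable_sum X_int)
  have rewrite: "AE \<omega> in M. real_cond_exp M (F k) (shift_sq (Suc k)) \<omega>
      = real_cond_exp M (F k) (\<lambda>\<omega>. 1 / real n * (\<Sum>i=1..n. ?X i \<omega>)) \<omega>"
    by (rule cond.real_cond_exp_cong[OF AE_I2[OF shift_eq] borel_measurable_integrable[OF shift_integrable]
          borel_measurable_integrable[OF S_int]])
  have exact: "AE \<omega> in M. real_cond_exp M (F k) (\<lambda>\<omega>. 1 / real n * (\<Sum>i=1..n. ?X i \<omega>)) \<omega>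
      = 1 / real n * (\<Sum>i=1..n. p * \<phi> i (x k \<omega>) + (1 - p) * \<phi> i (w k i \<omega>))"
    by (rule cond.cond_exp_average) (rule X_int X_cond, assumption)+
  have bound: "1 / real n * (\<Sum>i=1..n. p * \<phi> i (x k \<omega>) + (1 - p) * \<phi> i (w k i \<omega>))
      \<le> (1 - p) * shift_sq k \<omega> + 2 * (L * p) * gap k \<omega>" for \<omega>
  proof -
    have "1 / real n * (\<Sum>i=1..n. p * \<phi> i (x k \<omega>) + (1 - p) * \<phi> i (w k i \<omega>))
        = p * grad_shift_sq n m f xs (\<lambda>_. x k \<omega>) + (1 - p) * shift_sq k \<omega>"
      unfolding grad_shift_sq_average \<phi>_def[symmetric] sum.distrib sum_distrib_left[symmetric]
      by (simp only: distrib_left mult.left_commute)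
    also have "p * grad_shift_sq n m f xs (\<lambda>_. x k \<omega>) \<le> p * (2 * L * gap k \<omega>)"
      using p by (intro mult_left_mono component_grad_bound) auto
    finally show ?thesis by (simp add: mult_ac)
  qed
  from rewrite exact show ?thesis
  proof eventually_elim
    case (elim \<omega>)
    then show ?case using bound[of \<omega>] by linarith
  qed
qed

text \<open>The average of the squared errors, unlike the square of the averaged error, satisfies
  a recursion of its own: the compressors act on the workers separately.\<close>

definition "err_sq k \<omega> = 1 / real n * (\<Sum>i=1..n. (norm (e k i \<omega>))\<^sup>2)"

lemma err_sq_integrable: "integrable M (err_sq k)"
  unfolding err_sq_def
  by (intro Bochner_Integration.integrable_mult_right Bochner_Integration.integrable_sum
      regular_norm_sq(2)[OF e_regular])

lemma expected_shift_recursion: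
  "(\<integral>\<omega>. shift_sq (Suc k) \<omega> \<partial>M) \<le> (1 - p) * (\<integral>\<omega>. shift_sq k \<omega> \<partial>M) + 2 * L * p * (\<integral>\<omega>. gap k \<omega> \<partial>M)"
proof -
  interpret cond: finite_measure_subalgebra M "F k" by (rule past_algebra)
  have "(\<integral>\<omega>. shift_sq (Suc k) \<omega> \<partial>M) = (\<integral>\<omega>. real_cond_exp M (F k) (shift_sq (Suc k)) \<omega> \<partial>M)"
    by (rule cond.real_cond_exp_int(2)[symmetric, OF shift_integrable])
  also have "\<dots> \<le> (\<integral>\<omega>. (1 - p) * shift_sq k \<omega> + 2 * (L * p) * gap k \<omega> \<partial>M)"
    by (intro integral_mono_AE cond.real_cond_exp_int(1) shift_integrable shift_recursion
        Bochner_Integration.integrable_add Bochner_Integration.integrable_mult_right gap_integrable)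
  also have "\<dots> = (1 - p) * (\<integral>\<omega>. shift_sq k \<omega> \<partial>M) + 2 * L * p * (\<integral>\<omega>. gap k \<omega> \<partial>M)"
    using shift_integrable gap_integrable
    by (subst Bochner_Integration.integral_add) (auto simp: mult.assoc intro!: Bochner_Integration.integrable_mult_right)
  finally show ?thesis .
qed

lemma expected_second_moment:
  "(\<integral>\<omega>. (norm (g_avg k \<omega>))\<^sup>2 \<partial>M) \<le> 4 * L * (\<integral>\<omega>. gap k \<omega> \<partial>M) + 2 * (\<integral>\<omega>. shift_sq k \<omega> \<partial>M)"
proof -
  interpret cond: finite_measure_subalgebra M "F k" by (rule past_algebra)
  have "(\<integral>\<omega>. (norm (g_avg k \<omega>))\<^sup>2 \<partial>M) = (\<integral>\<omega>. real_cond_exp M (F k) (\<lambda>\<omega>. (norm (g_avg k \<omega>))\<^sup>2) \<omega> \<partial>M)"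
    by (rule cond.real_cond_exp_int(2)[symmetric, OF second_moment_bound(1)])
  also have "\<dots> \<le> (\<integral>\<omega>. 4 * L * gap k \<omega> + 2 * shift_sq k \<omega> \<partial>M)"
    by (intro integral_mono_AE cond.real_cond_exp_int(1) second_moment_bound shift_integrable
        Bochner_Integration.integrable_add Bochner_Integration.integrable_mult_right gap_integrable)
  also have "\<dots> = 4 * L * (\<integral>\<omega>. gap k \<omega> \<partial>M) + 2 * (\<integral>\<omega>. shift_sq k \<omega> \<partial>M)"
    using shift_integrable gap_integrable
    by (subst Bochner_Integration.integral_add) (auto simp: mult.assoc intro!: Bochner_Integration.integrable_mult_right)
  finally show ?thesis .
qed

text \<open>For one worker, the compressor contracts the second moment of its input \<open>e + \<gamma> g\<close>. This moment
  splits into the squared mean and the variance of \<open>\<gamma> g\<close>, and Young's inequality with parameter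
  \<open>\<delta> / 2\<close> separates the memory from the mean. The split matters: only the squared mean, not the
  variance, gets the large factor \<open>2 / \<delta>\<close>.\<close>

lemma expected_error_recursion:
  "(\<integral>\<omega>. err_sq (Suc k) \<omega> \<partial>M) \<le> (1 - \<delta> / 2) * (\<integral>\<omega>. err_sq k \<omega> \<partial>M)
    + \<gamma>\<^sup>2 * ((4 * L / \<delta> + 4 * L) * (\<integral>\<omega>. gap k \<omega> \<partial>M) + 2 * (\<integral>\<omega>. shift_sq k \<omega> \<partial>M))"
proof -
  define Y where "Y i l \<omega> = e k i \<omega> + \<gamma> *\<^sub>R est k i l \<omega>" for i l \<omega>
  define q where "q i \<omega> = 1 / real m * (\<Sum>l=1..m. (norm (Y i l \<omega>))\<^sup>2)" for i \<omega>
  define dev where "dev i \<omega> = 1 / real m * (\<Sum>l=1..m. (norm (est k i l \<omega> - est_mean k i \<omega>))\<^sup>2)" for i \<omega>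
  have Y: "regular k (Y i l)" if "i \<in> {1..n}" "l \<in> {1..m}" for i l
    unfolding Y_def using that by (intro regular_add regular_scaleR est_regular e_regular)
  have q_int: "integrable M (q i)" if "i \<in> {1..n}" for i
    unfolding q_def using that
    by (intro Bochner_Integration.integrable_mult_right Bochner_Integration.integrable_sum
        regular_norm_sq(2)[OF Y])
  have one_worker: "(\<integral>\<omega>. (norm (e (Suc k) i \<omega>))\<^sup>2 \<partial>M) \<le> (1 - \<delta>) * (\<integral>\<omega>. q i \<omega> \<partial>M)" if i: "i \<in> {1..n}" for i
  proof -
    interpret fresh_step M "F k" m Q p "Z k i" by (rule draw[OF i])
    have "(\<integral>\<omega>. (norm (e (Suc k) i \<omega>))\<^sup>2 \<partial>M) = (\<integral>\<omega>. (norm (Y i (fst (Z k i \<omega>)) \<omega>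
        - C (fst (snd (Z k i \<omega>))) (Y i (fst (Z k i \<omega>)) \<omega>)))\<^sup>2 \<partial>M)"
      by (rule Bochner_Integration.integral_cong) (simp_all add: worker_step[OF _ i] Y_def)
    also have "\<dots> \<le> (1 - \<delta>) * (\<integral>\<omega>. q i \<omega> \<partial>M)"
      unfolding q_def by (rule compression_error(2)[OF C]) (rule regularD[OF Y[OF i]], assumption)+
    finally show ?thesis .
  qed
  have q_le: "(1 - \<delta>) * q i \<omega> \<le> (1 - \<delta> / 2) * (norm (e k i \<omega>))\<^sup>2
      + \<gamma>\<^sup>2 * (2 / \<delta> * (norm (est_mean k i \<omega>))\<^sup>2 + dev i \<omega>)" if i: "i \<in> {1..n}" for i \<omega>
  proof -
    let ?b = "e k i \<omega> + \<gamma> *\<^sub>R est_mean k i \<omega>"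
    have "(\<Sum>l=1..m. Y i l \<omega>) = real m *\<^sub>R e k i \<omega> + \<gamma> *\<^sub>R (\<Sum>l=1..m. est k i l \<omega>)"
      by (simp add: Y_def sum.distrib scaleR_sum_right sum_constant_scaleR)
    then have "(1 / real m) *\<^sub>R (\<Sum>l=1..m. Y i l \<omega>)
        = e k i \<omega> + \<gamma> *\<^sub>R ((1 / real m) *\<^sub>R (\<Sum>l=1..m. est k i l \<omega>))"
      using m by (simp add: scaleR_add_right)
    then have "(1 / real m) *\<^sub>R (\<Sum>l=1..m. Y i l \<omega>) = ?b"
      unfolding lsvrg_mean[OF i] .
    from sum_norm_sq_deviation[OF m this[symmetric]]
    have "(\<Sum>l=1..m. (norm (Y i l \<omega>))\<^sup>2) = real m * (norm ?b)\<^sup>2 + (\<Sum>l=1..m. (norm (Y i l \<omega> - ?b))\<^sup>2)"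
      by simp
    also have "(\<Sum>l=1..m. (norm (Y i l \<omega> - ?b))\<^sup>2) = \<gamma>\<^sup>2 * (\<Sum>l=1..m. (norm (est k i l \<omega> - est_mean k i \<omega>))\<^sup>2)"
      unfolding sum_distrib_left
      by (intro sum.cong) (simp_all add: Y_def scaleR_diff_right[symmetric] power_mult_distrib del: scaleR_diff_right)
    finally have q_eq: "q i \<omega> = (norm ?b)\<^sup>2 + \<gamma>\<^sup>2 * dev i \<omega>"
      using m by (simp add: q_def dev_def field_simps)
    have dev0: "0 \<le> dev i \<omega>" unfolding dev_def by (intro mult_nonneg_nonneg sum_nonneg) auto
    have "(norm ?b)\<^sup>2 \<le> (1 + \<delta> / 2) * (norm (e k i \<omega>))\<^sup>2 + (1 + 2 / \<delta>) * (\<gamma>\<^sup>2 * (norm (est_mean k i \<omega>))\<^sup>2)"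
      using norm_add_sq_le[of "\<delta> / 2" "e k i \<omega>" "\<gamma> *\<^sub>R est_mean k i \<omega>"] \<delta> by (simp add: power_mult_distrib)
    then have "(1 - \<delta>) * (norm ?b)\<^sup>2 \<le> (1 - \<delta>) * ((1 + \<delta> / 2) * (norm (e k i \<omega>))\<^sup>2
        + (1 + 2 / \<delta>) * (\<gamma>\<^sup>2 * (norm (est_mean k i \<omega>))\<^sup>2))"
      using \<delta> by (intro mult_left_mono) auto
    also have "\<dots> = (1 - \<delta>) * (1 + \<delta> / 2) * (norm (e k i \<omega>))\<^sup>2
        + (1 - \<delta>) * (1 + 2 / \<delta>) * (\<gamma>\<^sup>2 * (norm (est_mean k i \<omega>))\<^sup>2)"
      by (rule trans[OF distrib_left]) (simp only: mult.assoc)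
    also have "\<dots> \<le> (1 - \<delta> / 2) * (norm (e k i \<omega>))\<^sup>2 + 2 / \<delta> * (\<gamma>\<^sup>2 * (norm (est_mean k i \<omega>))\<^sup>2)"
    proof (intro add_mono mult_right_mono)
      show "(1 - \<delta>) * (1 + \<delta> / 2) \<le> 1 - \<delta> / 2"
        using \<delta> by (simp add: algebra_simps)
      \<comment> \<open>The contraction factor also tames the large Young constant of the mean.\<close>
      have "(1 - \<delta>) * (1 + 2 / \<delta>) = 2 / \<delta> - 1 - \<delta>" using \<delta> by (simp add: field_simps)
      then show "(1 - \<delta>) * (1 + 2 / \<delta>) \<le> 2 / \<delta>" using \<delta> by simp
    qed auto
    finally have "(1 - \<delta>) * (norm ?b)\<^sup>2 \<le> (1 - \<delta> / 2) * (norm (e k i \<omega>))\<^sup>2 + 2 / \<delta> * (\<gamma>\<^sup>2 * (norm (est_mean k i \<omega>))\<^sup>2)" .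
    moreover have "(1 - \<delta>) * (\<gamma>\<^sup>2 * dev i \<omega>) \<le> 1 * (\<gamma>\<^sup>2 * dev i \<omega>)"
      using \<delta> dev0 by (intro mult_right_mono) auto
    ultimately show ?thesis unfolding q_eq by (simp add: distrib_left mult.left_commute)
  qed
  have "(\<integral>\<omega>. err_sq (Suc k) \<omega> \<partial>M) = 1 / real n * (\<Sum>i=1..n. \<integral>\<omega>. (norm (e (Suc k) i \<omega>))\<^sup>2 \<partial>M)"
    unfolding err_sq_def using regular_norm_sq(2)[OF e_regular, of _ "Suc k"]
    by (subst integral_mult_right_zero) (simp add: Bochner_Integration.integral_sum)
  also have "\<dots> \<le> 1 / real n * (\<Sum>i=1..n. (1 - \<delta>) * (\<integral>\<omega>. q i \<omega> \<partial>M))"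
    by (intro mult_left_mono sum_mono one_worker) auto
  also have "\<dots> = (\<integral>\<omega>. 1 / real n * (\<Sum>i=1..n. (1 - \<delta>) * q i \<omega>) \<partial>M)"
    using q_int by (subst integral_mult_right_zero) (simp add: Bochner_Integration.integral_sum)
  also have "\<dots> \<le> (\<integral>\<omega>. (1 - \<delta> / 2) * err_sq k \<omega> + \<gamma>\<^sup>2 * ((4 * L / \<delta> + 4 * L) * gap k \<omega> + 2 * shift_sq k \<omega>) \<partial>M)"
  proof (intro integral_mono)
    show "integrable M (\<lambda>\<omega>. 1 / real n * (\<Sum>i=1..n. (1 - \<delta>) * q i \<omega>))"
      by (intro Bochner_Integration.integrable_mult_right Bochner_Integration.integrable_sum q_int)
    show "integrable M (\<lambda>\<omega>. (1 - \<delta> / 2) * err_sq k \<omega> + \<gamma>\<^sup>2 * ((4 * L / \<delta> + 4 * L) * gap k \<omega> + 2 * shift_sq k \<omega>))"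
      by (intro Bochner_Integration.integrable_add Bochner_Integration.integrable_mult_right
          err_sq_integrable gap_integrable shift_integrable)
    fix \<omega>
    have "1 / real n * (\<Sum>i=1..n. (1 - \<delta>) * q i \<omega>) \<le> 1 / real n * (\<Sum>i=1..n. (1 - \<delta> / 2) * (norm (e k i \<omega>))\<^sup>2
        + \<gamma>\<^sup>2 * (2 / \<delta> * (norm (est_mean k i \<omega>))\<^sup>2 + dev i \<omega>))"
      by (intro mult_left_mono sum_mono q_le) auto
    also have "\<dots> = (1 - \<delta> / 2) * err_sq k \<omega> + \<gamma>\<^sup>2 * (2 / \<delta> * (1 / real n * (\<Sum>i=1..n. (norm (est_mean k i \<omega>))\<^sup>2))
        + 1 / real n * (\<Sum>i=1..n. dev i \<omega>))"
      unfolding err_sq_def sum.distrib sum_distrib_left[symmetric]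
      by (simp only: distrib_left mult.left_commute)
    also have "\<dots> \<le> (1 - \<delta> / 2) * err_sq k \<omega> + \<gamma>\<^sup>2 * (2 / \<delta> * (2 * L * gap k \<omega>) + (4 * L * gap k \<omega> + 2 * shift_sq k \<omega>))"
      using \<delta> deviation_bound[of k \<omega>]
      by (intro add_left_mono mult_left_mono add_mono worker_grad_bound) (auto simp: dev_def)
    also have "\<dots> = (1 - \<delta> / 2) * err_sq k \<omega> + \<gamma>\<^sup>2 * ((4 * L / \<delta> + 4 * L) * gap k \<omega> + 2 * shift_sq k \<omega>)"
      by (simp add: algebra_simps)
    finally show "1 / real n * (\<Sum>i=1..n. (1 - \<delta>) * q i \<omega>)
        \<le> (1 - \<delta> / 2) * err_sq k \<omega> + \<gamma>\<^sup>2 * ((4 * L / \<delta> + 4 * L) * gap k \<omega> + 2 * shift_sq k \<omega>)" .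
  qed
  also have "\<dots> = (1 - \<delta> / 2) * (\<integral>\<omega>. err_sq k \<omega> \<partial>M)
      + \<gamma>\<^sup>2 * ((4 * L / \<delta> + 4 * L) * (\<integral>\<omega>. gap k \<omega> \<partial>M) + 2 * (\<integral>\<omega>. shift_sq k \<omega> \<partial>M))"
  proof -
    note ints = err_sq_integrable[of k] gap_integrable[of k] shift_integrable[of k]
      Bochner_Integration.integrable_mult_right Bochner_Integration.integrable_add
    show ?thesis
      by (subst Bochner_Integration.integral_add, (intro ints)+, subst (2) integral_mult_right_zero,
          subst Bochner_Integration.integral_add, (intro ints)+, simp)
  qed
  finally show ?thesis .
qed

section \<open>Expected recursions and convergence\<close>

definition "\<eta> = min (\<gamma> * \<mu> / 2) (p / 4)"

lemma step_size: "\<gamma> \<le> 3 / (56 * L)" "\<gamma> \<le> \<delta> / (8 * L * sqrt (3 * (1 + \<delta> * (1 + 2 / (1 - p)))))"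
  using \<gamma>_le by auto

lemma \<eta>_bounds: "0 \<le> \<eta>" "\<eta> < 1" "\<eta> \<le> \<gamma> * \<mu> / 2" "\<eta> \<le> p / 4" "\<eta> \<le> \<delta> / 27"
  using step_size_consequences(2)[OF L mu mu_le_L \<delta> p \<gamma>_pos step_size(2)] p \<gamma>_pos mu
  by (auto simp: \<eta>_def min_def)

lemma expected_gap_nonneg: "0 \<le> (\<integral>\<omega>. gap k \<omega> \<partial>M)"
  using obj_minimal by (intro integral_nonneg_AE) auto

lemma expected_shift_nonneg: "0 \<le> (\<integral>\<omega>. shift_sq k \<omega> \<partial>M)"
  by (intro integral_nonneg_AE AE_I2 grad_shift_sq_nonneg)

lemma integral_on_space_const:
  "(\<And>\<omega>. \<omega> \<in> space M \<Longrightarrow> X \<omega> = c) \<Longrightarrow> (\<integral>\<omega>. (X \<omega> :: real) \<partial>M) = c"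
  using Bochner_Integration.integral_cong[of M M X "\<lambda>_. c"] by (simp add: prob_space)

lemma shift_sq_init: "\<omega> \<in> space M \<Longrightarrow> shift_sq 0 \<omega> = grad_shift_sq n m f xs w0"
  by (simp add: grad_shift_sq_def w_init)

lemma e_avg_le: "(\<integral>\<omega>. (norm (e_avg k \<omega>))\<^sup>2 \<partial>M) \<le> (\<integral>\<omega>. err_sq k \<omega> \<partial>M)"
  by (intro integral_mono regular_norm_sq(2)[OF e_avg_regular] err_sq_integrable)
     (unfold err_sq_def, rule norm_average_sq_le[OF n])

lemma error_accumulation:
  "3 * L * (\<Sum>k=0..K. weight \<eta> k * (\<integral>\<omega>. (norm (e_avg k \<omega>))\<^sup>2 \<partial>M))
    \<le> 1 / 4 * (\<Sum>k=0..K. weight \<eta> k * (\<integral>\<omega>. gap k \<omega> \<partial>M))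
      + 48 * L * \<gamma>\<^sup>2 * (2 + p) / (\<delta> * p) * grad_shift_sq n m f xs w0"
proof -
  have "3 * L * (\<Sum>k=0..K. weight \<eta> k * (\<integral>\<omega>. (norm (e_avg k \<omega>))\<^sup>2 \<partial>M))
      \<le> 3 * L * (\<Sum>k=0..K. weight \<eta> k * (\<integral>\<omega>. err_sq k \<omega> \<partial>M))"
    using L weight_pos[OF \<eta>_bounds(2)]
    by (intro mult_left_mono sum_mono e_avg_le) (auto simp: less_imp_le)
  also have "\<dots> \<le> 1 / 4 * (\<Sum>k=0..K. weight \<eta> k * (\<integral>\<omega>. gap k \<omega> \<partial>M))
      + 48 * L * \<gamma>\<^sup>2 * (2 + p) / (\<delta> * p) * (\<integral>\<omega>. shift_sq 0 \<omega> \<partial>M)"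
  proof (rule error_budget[OF L \<delta> p step_size_consequences(1)[OF L mu mu_le_L \<delta> p \<gamma>_pos step_size(2)]
        \<eta>_bounds(1,5,4)])
    show "0 \<le> (\<integral>\<omega>. err_sq k \<omega> \<partial>M)" for k
      unfolding err_sq_def by (intro integral_nonneg_AE AE_I2 mult_nonneg_nonneg sum_nonneg) auto
    show "(\<integral>\<omega>. err_sq 0 \<omega> \<partial>M) = 0"
      by (rule integral_on_space_const) (simp add: err_sq_def e_init)
  qed (rule expected_gap_nonneg expected_shift_nonneg expected_error_recursion expected_shift_recursion)+
  also have "(\<integral>\<omega>. shift_sq 0 \<omega> \<partial>M) = grad_shift_sq n m f xs w0"
    by (rule integral_on_space_const) (rule shift_sq_init)
  finally show ?thesis .
qed

text \<open>The untransmitted part of \<open>\<gamma> g\<close> leaves \<open>x\<close> behind but enters the memory, so that the difference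
  moves by exactly \<open>- \<gamma> g\<close>, whatever the compressor does.\<close>

lemma virtual_step:
  assumes "\<omega> \<in> space M"
  shows "x (Suc k) \<omega> - e_avg (Suc k) \<omega> = x k \<omega> - e_avg k \<omega> - \<gamma> *\<^sub>R g_avg k \<omega>"
proof -
  have "(\<Sum>i=1..n. e (Suc k) i \<omega>) = (\<Sum>i=1..n. e k i \<omega> + \<gamma> *\<^sub>R g k i \<omega> - v k i \<omega>)"
    by (intro sum.cong refl worker_step(3) assms)
  then show ?thesis
    by (simp add: x_step[OF assms] sum.distrib sum_subtractf scaleR_add_right scaleR_diff_right
        scaleR_sum_right[symmetric] scaleR_left_commute)
qed

text \<open>A vector that is known before the step sees only the conditional mean of the estimator.\<close>

lemma expected_inner_g_avg:
  assumes y: "regular k y"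
  shows "(\<integral>\<omega>. y \<omega> \<bullet> g_avg k \<omega> \<partial>M) = (\<integral>\<omega>. y \<omega> \<bullet> grad obj (x k \<omega>) \<partial>M)"
proof -
  have int: "integrable M (\<lambda>\<omega>. y \<omega> \<bullet> g k i \<omega>)" and eq: "(\<integral>\<omega>. y \<omega> \<bullet> g k i \<omega> \<partial>M) = (\<integral>\<omega>. y \<omega> \<bullet> est_mean k i \<omega> \<partial>M)"
    if i: "i \<in> {1..n}" for i
  proof -
    note reg = regular_inner[OF y est_regular[OF i]]
    have X: "y \<omega> \<bullet> g k i \<omega> = y \<omega> \<bullet> est k i (fst (Z k i \<omega>)) \<omega>" if "\<omega> \<in> space M" for \<omega>
      by (simp only: worker_step(1)[OF that i])
    show "integrable M (\<lambda>\<omega>. y \<omega> \<bullet> g k i \<omega>)"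
      by (rule cond_exp_of_draw(1)[OF i, of "\<lambda>l \<omega>. y \<omega> \<bullet> est k i l \<omega>"]) (rule reg X, assumption)+
    have "(\<integral>\<omega>. y \<omega> \<bullet> g k i \<omega> \<partial>M) = (\<integral>\<omega>. 1 / real m * (\<Sum>l=1..m. y \<omega> \<bullet> est k i l \<omega>) \<partial>M)"
      by (rule cond_exp_of_draw(3)[OF i, of "\<lambda>l \<omega>. y \<omega> \<bullet> est k i l \<omega>"]) (rule reg X, assumption)+
    then show "(\<integral>\<omega>. y \<omega> \<bullet> g k i \<omega> \<partial>M) = (\<integral>\<omega>. y \<omega> \<bullet> est_mean k i \<omega> \<partial>M)"
      by (simp only: est_inner_mean[OF i])
  qed
  have int': "integrable M (\<lambda>\<omega>. y \<omega> \<bullet> est_mean k i \<omega>)" if "i \<in> {1..n}" for i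
    by (rule regular_inner(2)[OF y est_mean_regular[OF that]])
  have "(\<integral>\<omega>. y \<omega> \<bullet> g_avg k \<omega> \<partial>M) = (\<integral>\<omega>. 1 / real n * (\<Sum>i=1..n. y \<omega> \<bullet> g k i \<omega>) \<partial>M)"
    by (simp only: inner_scaleR_right inner_sum_right)
  also have "\<dots> = 1 / real n * (\<Sum>i=1..n. \<integral>\<omega>. y \<omega> \<bullet> g k i \<omega> \<partial>M)"
    by (simp only: integral_mult_right_zero Bochner_Integration.integral_sum[OF int])
  also have "\<dots> = 1 / real n * (\<Sum>i=1..n. \<integral>\<omega>. y \<omega> \<bullet> est_mean k i \<omega> \<partial>M)"
    by (intro arg_cong[of _ _ "\<lambda>t. 1 / real n * t"] sum.cong refl eq)
  also have "\<dots> = (\<integral>\<omega>. 1 / real n * (\<Sum>i=1..n. y \<omega> \<bullet> est_mean k i \<omega>) \<partial>M)"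
    by (simp only: integral_mult_right_zero Bochner_Integration.integral_sum[OF int'])
  also have "\<dots> = (\<integral>\<omega>. y \<omega> \<bullet> grad obj (x k \<omega>) \<partial>M)"
    by (simp only: average_est_mean[symmetric] inner_scaleR_right inner_sum_right)
  finally show ?thesis .
qed

lemma virtual_regular: "regular k (\<lambda>\<omega>. x k \<omega> - e_avg k \<omega> - xs)"
  by (intro regular_diff x_regular e_avg_regular regular_const)

text \<open>Expansion of the square in the virtual step: the cross term is estimated by the perturbed descent
  inequality, the squared estimator by its second moment.\<close>

lemma expected_distance_recursion:
  fixes k
  defines "D \<equiv> \<lambda>k. \<integral>\<omega>. (norm (x k \<omega> - e_avg k \<omega> - xs))\<^sup>2 \<partial>M"
  shows "D (Suc k) \<le> (1 - \<gamma> * \<mu> / 2) * D k - \<gamma> * (\<integral>\<omega>. gap k \<omega> \<partial>M)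
    + 3 * L * \<gamma> * (\<integral>\<omega>. (norm (e_avg k \<omega>))\<^sup>2 \<partial>M)
    + \<gamma>\<^sup>2 * (4 * L * (\<integral>\<omega>. gap k \<omega> \<partial>M) + 2 * (\<integral>\<omega>. shift_sq k \<omega> \<partial>M))"
proof -
  let ?y = "\<lambda>\<omega>. x k \<omega> - e_avg k \<omega> - xs"
  have y_sq: "integrable M (\<lambda>\<omega>. (norm (?y \<omega>))\<^sup>2)" by (rule regular_norm_sq(2)[OF virtual_regular])
  have yg: "integrable M (\<lambda>\<omega>. ?y \<omega> \<bullet> g_avg k \<omega>)"
    by (rule regular_inner(2)[OF regular_Suc[OF virtual_regular] g_avg_regular])
  have grad_reg: "regular k (\<lambda>\<omega>. grad obj (x k \<omega>))" by (rule regular_grad[OF obj_smooth x_regular])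
  have y_grad: "integrable M (\<lambda>\<omega>. ?y \<omega> \<bullet> grad obj (x k \<omega>))"
    by (rule regular_inner(2)[OF virtual_regular grad_reg])
  have e_sq: "integrable M (\<lambda>\<omega>. (norm (e_avg k \<omega>))\<^sup>2)" by (rule regular_norm_sq(2)[OF e_avg_regular])
  have "D (Suc k) = (\<integral>\<omega>. ((norm (?y \<omega>))\<^sup>2 - 2 * \<gamma> * (?y \<omega> \<bullet> g_avg k \<omega>)) + \<gamma>\<^sup>2 * (norm (g_avg k \<omega>))\<^sup>2 \<partial>M)"
    unfolding D_def
  proof (rule Bochner_Integration.integral_cong)
    fix \<omega> assume \<omega>: "\<omega> \<in> space M"
    have "x (Suc k) \<omega> - e_avg (Suc k) \<omega> - xs = ?y \<omega> - \<gamma> *\<^sub>R g_avg k \<omega>"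
      unfolding virtual_step[OF \<omega>] by (rule cancel_ab_semigroup_add_class.diff_right_commute)
    moreover have "(norm (a - \<gamma> *\<^sub>R b))\<^sup>2 = ((norm a)\<^sup>2 - 2 * \<gamma> * (a \<bullet> b)) + \<gamma>\<^sup>2 * (norm b)\<^sup>2" for a b :: 'a
      unfolding power2_norm_eq_inner
      by (simp add: inner_diff_left inner_diff_right inner_commute power2_eq_square algebra_simps)
    ultimately show "(norm (x (Suc k) \<omega> - e_avg (Suc k) \<omega> - xs))\<^sup>2
        = ((norm (?y \<omega>))\<^sup>2 - 2 * \<gamma> * (?y \<omega> \<bullet> g_avg k \<omega>)) + \<gamma>\<^sup>2 * (norm (g_avg k \<omega>))\<^sup>2"
      by (simp only:)
  qed simp
  also have "\<dots> = D k - 2 * \<gamma> * (\<integral>\<omega>. ?y \<omega> \<bullet> g_avg k \<omega> \<partial>M) + \<gamma>\<^sup>2 * (\<integral>\<omega>. (norm (g_avg k \<omega>))\<^sup>2 \<partial>M)"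
    unfolding D_def
    by (simp only: Bochner_Integration.integral_add[OF Bochner_Integration.integrable_diff[OF y_sq
            Bochner_Integration.integrable_mult_right[OF yg]]
          Bochner_Integration.integrable_mult_right[OF second_moment_bound(1)]]
        Bochner_Integration.integral_diff[OF y_sq Bochner_Integration.integrable_mult_right[OF yg]]
        integral_mult_right_zero)
  also have "(\<integral>\<omega>. ?y \<omega> \<bullet> g_avg k \<omega> \<partial>M) = (\<integral>\<omega>. ?y \<omega> \<bullet> grad obj (x k \<omega>) \<partial>M)"
    by (rule expected_inner_g_avg[OF virtual_regular])
  finally have step: "D (Suc k) = D k - 2 * \<gamma> * (\<integral>\<omega>. ?y \<omega> \<bullet> grad obj (x k \<omega>) \<partial>M)
      + \<gamma>\<^sup>2 * (\<integral>\<omega>. (norm (g_avg k \<omega>))\<^sup>2 \<partial>M)" .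
  have "- 2 * (\<integral>\<omega>. ?y \<omega> \<bullet> grad obj (x k \<omega>) \<partial>M) = (\<integral>\<omega>. - 2 * (?y \<omega> \<bullet> grad obj (x k \<omega>)) \<partial>M)"
    by (simp only: integral_mult_right_zero)
  also have "\<dots> \<le> (\<integral>\<omega>. - \<mu> / 2 * (norm (?y \<omega>))\<^sup>2 - gap k \<omega> + 3 * L * (norm (e_avg k \<omega>))\<^sup>2 \<partial>M)"
    by (intro integral_mono perturbed_descent Bochner_Integration.integrable_add
        Bochner_Integration.integrable_diff Bochner_Integration.integrable_mult_right
        y_sq y_grad gap_integrable e_sq)
  also have "\<dots> = - \<mu> / 2 * D k - (\<integral>\<omega>. gap k \<omega> \<partial>M) + 3 * L * (\<integral>\<omega>. (norm (e_avg k \<omega>))\<^sup>2 \<partial>M)"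
    unfolding D_def
    by (simp only: Bochner_Integration.integral_add[OF Bochner_Integration.integrable_diff[OF
            Bochner_Integration.integrable_mult_right[OF y_sq] gap_integrable]
          Bochner_Integration.integrable_mult_right[OF e_sq]]
        Bochner_Integration.integral_diff[OF Bochner_Integration.integrable_mult_right[OF y_sq] gap_integrable]
        integral_mult_right_zero)
  finally have descent: "- 2 * (\<integral>\<omega>. ?y \<omega> \<bullet> grad obj (x k \<omega>) \<partial>M)
      \<le> - \<mu> / 2 * D k - (\<integral>\<omega>. gap k \<omega> \<partial>M) + 3 * L * (\<integral>\<omega>. (norm (e_avg k \<omega>))\<^sup>2 \<partial>M)" .
  have a: "\<gamma> * (- 2 * (\<integral>\<omega>. ?y \<omega> \<bullet> grad obj (x k \<omega>) \<partial>M))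
      \<le> \<gamma> * (- \<mu> / 2 * D k - (\<integral>\<omega>. gap k \<omega> \<partial>M) + 3 * L * (\<integral>\<omega>. (norm (e_avg k \<omega>))\<^sup>2 \<partial>M))"
    using \<gamma>_pos by (intro mult_left_mono descent) auto
  have b: "\<gamma>\<^sup>2 * (\<integral>\<omega>. (norm (g_avg k \<omega>))\<^sup>2 \<partial>M)
      \<le> \<gamma>\<^sup>2 * (4 * L * (\<integral>\<omega>. gap k \<omega> \<partial>M) + 2 * (\<integral>\<omega>. shift_sq k \<omega> \<partial>M))"
    by (intro mult_left_mono expected_second_moment) auto
  have c: "\<gamma> * (- \<mu> / 2 * D k - G + 3 * L * E) = - (\<gamma> * \<mu> / 2) * D k - \<gamma> * G + 3 * L * \<gamma> * E" for G E
    by (simp add: algebra_simps)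
  show ?thesis using a b unfolding step c left_diff_distrib by linarith
qed

lemma weighted_gap_bound:
  "(\<Sum>k=0..K. weight \<eta> k * (\<integral>\<omega>. gap k \<omega> \<partial>M))
    \<le> 4 * ((norm (x0 - xs))\<^sup>2 + 8 / (3 * p) * \<gamma>\<^sup>2 * grad_shift_sq n m f xs w0
        + \<gamma> * (48 * L * \<gamma>\<^sup>2 * (2 + p) / (\<delta> * p) * grad_shift_sq n m f xs w0)) / \<gamma>"
proof -
  have D0: "(\<integral>\<omega>. (norm (x 0 \<omega> - e_avg 0 \<omega> - xs))\<^sup>2 \<partial>M) = (norm (x0 - xs))\<^sup>2"
    by (rule integral_on_space_const) (simp add: x_init e_init)
  have s0: "(\<integral>\<omega>. shift_sq 0 \<omega> \<partial>M) = grad_shift_sq n m f xs w0"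
    by (rule integral_on_space_const) (rule shift_sq_init)
  show ?thesis
    unfolding D0[symmetric] s0[symmetric]
  proof (rule lyapunov_budget[where D = "\<lambda>k. \<integral>\<omega>. (norm (x k \<omega> - e_avg k \<omega> - xs))\<^sup>2 \<partial>M"
        and s = "\<lambda>k. \<integral>\<omega>. shift_sq k \<omega> \<partial>M" and G = "\<lambda>k. \<integral>\<omega>. gap k \<omega> \<partial>M"
        and Eb = "\<lambda>k. \<integral>\<omega>. (norm (e_avg k \<omega>))\<^sup>2 \<partial>M",
        OF L p(1) \<gamma>_pos step_size(1) \<eta>_bounds(2,3,4)])
    show "0 \<le> (\<integral>\<omega>. (norm (x k \<omega> - e_avg k \<omega> - xs))\<^sup>2 \<partial>M)" for k
      by (intro integral_nonneg_AE AE_I2 zero_le_power2)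
    show "3 * L * (\<Sum>k=0..K. weight \<eta> k * (\<integral>\<omega>. (norm (e_avg k \<omega>))\<^sup>2 \<partial>M))
      \<le> 1 / 4 * (\<Sum>k=0..K. weight \<eta> k * (\<integral>\<omega>. gap k \<omega> \<partial>M))
        + 48 * L * \<gamma>\<^sup>2 * (2 + p) / (\<delta> * p) * (\<integral>\<omega>. shift_sq 0 \<omega> \<partial>M)"
      unfolding s0 by (rule error_accumulation)
  qed (rule expected_shift_nonneg expected_gap_nonneg expected_distance_recursion expected_shift_recursion)+
qed

lemma weighted_avg_square_integrable: "square_integrable M (weighted_avg \<eta> x K)"
  unfolding weighted_avg_def
  by (intro square_integrable_scaleR square_integrable_sum finite_measure_axioms regularD(2)[OF x_regular])

lemma avg_gap_integrable: "integrable M (\<lambda>\<omega>. obj (weighted_avg \<eta> x K \<omega>) - obj xs)"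
  by (rule gap_regular(2)[OF weighted_avg_square_integrable])

lemma avg_gap_le: "obj (weighted_avg \<eta> x K \<omega>) - obj xs \<le> 1 / weight_sum \<eta> K * (\<Sum>k=0..K. weight \<eta> k * gap k \<omega>)"
proof -
  let ?W = "weight_sum \<eta> K"
  have W: "0 < ?W" by (rule weight_sum_pos[OF \<eta>_bounds(2)])
  have one: "(\<Sum>k=0..K. weight \<eta> k / ?W) = 1"
    using W by (simp add: sum_divide_distrib[symmetric] weight_sum_def)
  have "obj (\<Sum>k=0..K. (weight \<eta> k / ?W) *\<^sub>R x k \<omega>) \<le> (\<Sum>k=0..K. weight \<eta> k / ?W * obj (x k \<omega>))"
    using weight_pos[OF \<eta>_bounds(2)] W
    by (intro convex_on_sum[OF _ _ obj_convex one]) (auto simp: less_imp_le)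
  moreover have "weighted_avg \<eta> x K \<omega> = (\<Sum>k=0..K. (weight \<eta> k / ?W) *\<^sub>R x k \<omega>)"
    by (simp add: weighted_avg_def scaleR_sum_right)
  moreover have "(\<Sum>k=0..K. weight \<eta> k / ?W * obj (x k \<omega>)) - obj xs = (\<Sum>k=0..K. weight \<eta> k / ?W * gap k \<omega>)"
  proof -
    have "(\<Sum>k=0..K. weight \<eta> k / ?W * obj xs) = obj xs"
      unfolding sum_distrib_right[symmetric] one by simp
    then show ?thesis by (simp only: right_diff_distrib sum_subtractf)
  qed
  moreover have "(\<Sum>k=0..K. weight \<eta> k / ?W * gap k \<omega>) = 1 / ?W * (\<Sum>k=0..K. weight \<eta> k * gap k \<omega>)"
    by (simp add: sum_distrib_left)
  ultimately show ?thesis by simp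
qed

lemma expected_avg_gap:
  "(\<integral>\<omega>. obj (weighted_avg \<eta> x K \<omega>) - obj xs \<partial>M)
    \<le> 1 / weight_sum \<eta> K * (4 * ((norm (x0 - xs))\<^sup>2 + 8 / (3 * p) * \<gamma>\<^sup>2 * grad_shift_sq n m f xs w0
        + \<gamma> * (48 * L * \<gamma>\<^sup>2 * (2 + p) / (\<delta> * p) * grad_shift_sq n m f xs w0)) / \<gamma>)"
proof -
  have int: "integrable M (\<lambda>\<omega>. weight \<eta> k * gap k \<omega>)" for k
    by (intro Bochner_Integration.integrable_mult_right gap_integrable)
  have "(\<integral>\<omega>. obj (weighted_avg \<eta> x K \<omega>) - obj xs \<partial>M)
      \<le> (\<integral>\<omega>. 1 / weight_sum \<eta> K * (\<Sum>k=0..K. weight \<eta> k * gap k \<omega>) \<partial>M)"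
    by (intro integral_mono avg_gap_integrable avg_gap_le
        Bochner_Integration.integrable_mult_right Bochner_Integration.integrable_sum gap_integrable)
  also have "\<dots> = 1 / weight_sum \<eta> K * (\<Sum>k=0..K. weight \<eta> k * (\<integral>\<omega>. gap k \<omega> \<partial>M))"
    by (simp only: integral_mult_right_zero Bochner_Integration.integral_sum[OF int])
  also have "\<dots> \<le> 1 / weight_sum \<eta> K * (4 * ((norm (x0 - xs))\<^sup>2 + 8 / (3 * p) * \<gamma>\<^sup>2 * grad_shift_sq n m f xs w0
        + \<gamma> * (48 * L * \<gamma>\<^sup>2 * (2 + p) / (\<delta> * p) * grad_shift_sq n m f xs w0)) / \<gamma>)"
    using weight_sum_pos[OF \<eta>_bounds(2), of K] by (intro mult_left_mono weighted_gap_bound) auto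
  finally show ?thesis .
qed

text \<open>The candidate \<open>1 / 4\<close> that comes from \<open>\<rho>\<^sub>1 = 1\<close> never attains the minimum, since \<open>p < 1\<close>.\<close>

lemma rate_eq: "crho1 c = 1 \<Longrightarrow> crho2 c = p \<Longrightarrow> rate \<gamma> \<mu> c = \<eta>"
  using p by (simp add: rate_def \<eta>_def min_def)

lemma parametric_assumption_holds:
  "parametric_assumption M F n obj xs L \<mu> \<gamma> x e g (\<lambda>k \<omega>. 0) shift_sq
     \<lparr> cA = L, cB1 = 0, cB2 = 0, cD1 = 0,
       cAt = 2 * L, cB1t = 0, cB2t = 2, cD1t = 0,
       cAp = 2 * L, cB1p = 0, cB2p = 2, cD1p = 0,
       crho1 = 1, cC1 = 0, cG = 0, cD2 = 0,
       crho2 = p, cC2 = L * p,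
       cF1 = 0, cF2 = 48 * L * \<gamma>\<^sup>2 * (2 + p) / (\<delta> * p), cD3 = 0 \<rparr>"
  (is "parametric_assumption _ _ _ _ _ _ _ _ _ _ _ _ _ ?c")
proof -
  have rate: "rate \<gamma> \<mu> ?c = \<eta>" by (rule rate_eq) simp_all
  have g_int: "integrable M (g k i)" if "i \<in> {1..n}" for k i
    by (rule square_integrable_integrable[OF finite_measure_axioms regularD(2)[OF g_regular[OF that]]])
  have zero: "cond_exp_le M (F k) (\<lambda>\<omega>. 0) (\<lambda>\<omega>. 0)" for k
  proof -
    interpret cond: finite_measure_subalgebra M "F k" by (rule past_algebra)
    have "AE \<omega> in M. real_cond_exp M (F k) (\<lambda>\<omega>. 0) \<omega> = 0"
      by (rule cond.real_cond_exp_F_meas) auto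
    then have "AE \<omega> in M. real_cond_exp M (F k) (\<lambda>\<omega>. 0) \<omega> \<le> 0" by eventually_elim simp
    then show ?thesis by (simp add: cond_exp_le_def)
  qed
  have accum: "AE \<omega> in M. 3 * L * (\<Sum>k=0..K. weight \<eta> k * (\<integral>\<omega>'. (norm (e_avg k \<omega>'))\<^sup>2 \<partial>M))
      \<le> 1 / 4 * (\<Sum>k=0..K. weight \<eta> k * (\<integral>\<omega>'. gap k \<omega>' \<partial>M))
        + 48 * L * \<gamma>\<^sup>2 * (2 + p) / (\<delta> * p) * shift_sq 0 \<omega>" for K
    using error_accumulation[of K] by (intro AE_I2) (simp only: shift_sq_init)
  have variance_form: "2 * (2 * L) * a + 0 * 0 + 2 * b + 0 = 4 * L * a + 2 * b" for a b :: real by simp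
  have mean_form: "2 * L * a + 0 * 0 + 0 * b + 0 = 2 * L * a" for a b :: real by simp
  have zero_form: "(1 - 1) * 0 + 2 * 0 * a + 0 * 1 * b + 0 = 0" for a b :: real by simp
  have accum_form: "a + 0 * 0 + b + \<gamma> * 0 * d = a + b" for a b d :: real by simp
  show ?thesis
    unfolding parametric_assumption_def Let_def rate param_consts.simps
      variance_form mean_form zero_form accum_form
  proof (intro conjI allI ballI)
    show "integrable M (g k i)" if "i \<in> {1..n}" for k i
      by (rule g_int[OF that])
    show "cond_exp_le M (F k) (\<lambda>\<omega>. (norm (g_avg k \<omega>))\<^sup>2) (\<lambda>\<omega>. 4 * L * gap k \<omega> + 2 * shift_sq k \<omega>)" for k
      unfolding cond_exp_le_def by (intro conjI second_moment_bound)
    show "cond_exp_le M (F k) (shift_sq (k + 1)) (\<lambda>\<omega>. (1 - p) * shift_sq k \<omega> + 2 * (L * p) * gap k \<omega>)" for k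
      unfolding cond_exp_le_def Suc_eq_plus1[symmetric] by (intro conjI shift_integrable shift_recursion)
  qed (rule gap_integrable regular_norm_sq(2)[OF e_avg_regular] cond_exp_g_avg mean_bound
      cond_exp_deviation(1) variance_bound zero accum, assumption?)+
qed

end

theorem theoremJ7:
  fixes f :: "nat \<Rightarrow> nat \<Rightarrow> 'a::euclidean_space \<Rightarrow> real"
    and n m :: nat and L \<mu> \<gamma> \<delta> p :: real
    and xs x0 :: 'a and w0 :: "nat \<Rightarrow> 'a"
    and Q :: "'c measure" and C :: "'c \<Rightarrow> 'a \<Rightarrow> 'a"
    and M :: "'w measure" and Z :: "nat \<Rightarrow> nat \<Rightarrow> 'w \<Rightarrow> nat \<times> 'c \<times> bool"
    and x :: "nat \<Rightarrow> 'w \<Rightarrow> 'a" and w e g v :: "nat \<Rightarrow> nat \<Rightarrow> 'w \<Rightarrow> 'a"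
  assumes "n \<ge> 1" and "m \<ge> 1" and "L > 0" and "\<mu> \<ge> 0"
    and "quasi_strongly_convex \<mu> (total_avg n m f) xs"
    and "\<And>i j. i \<in> {1..n} \<Longrightarrow> j \<in> {1..m} \<Longrightarrow> convex_on UNIV (f i j) \<and> L_smooth L (f i j)"
    and "compressor \<delta> Q C"
    and "0 < p" and "p < 1"
    and "0 < \<gamma>"
    and "\<gamma> \<le> min (3 / (56 * L)) (\<delta> / (8 * L * sqrt (3 * (1 + \<delta> * (1 + 2 / (1 - p))))))"
    and "prob_space M"
    and "fresh_randomness M n (step_law m Q p) Z"
    and "EC_LSVRGstar n m f xs \<gamma> C x0 w0 M Z x w e g v"
  shows
    "let F = total_avg n m f;
         \<sigma>0_sq = grad_shift_sq n m f xs w0;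
         F2 = 48 * L * \<gamma>\<^sup>2 * (2 + p) / (\<delta> * p);
         M2 = 8 / (3 * p);
         T0 = (norm (x0 - xs))\<^sup>2 + M2 * \<gamma>\<^sup>2 * \<sigma>0_sq;
         c = \<lparr> cA = L,       cB1 = 0,  cB2 = 0,  cD1 = 0,
               cAt = 2 * L,  cB1t = 0, cB2t = 2, cD1t = 0,
               cAp = 2 * L,  cB1p = 0, cB2p = 2, cD1p = 0,
               crho1 = 1, cC1 = 0, cG = 0, cD2 = 0,
               crho2 = p, cC2 = L * p,
               cF1 = 0, cF2 = F2, cD3 = 0 \<rparr>;
         xbar = weighted_avg (rate \<gamma> \<mu> c) x
     in
       parametric_assumption M (past M n (step_law m Q p) Z) n F xs L \<mu> \<gamma> x e g
         (\<lambda>k \<omega>. 0) (\<lambda>k \<omega>. grad_shift_sq n m f xs (\<lambda>i. w k i \<omega>)) c \<and>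
       (\<forall>K. integrable M (\<lambda>\<omega>. F (xbar K \<omega>) - F xs)) \<and>
       (\<mu> > 0 \<longrightarrow> (\<forall>K.
          (\<integral>\<omega>. F (xbar K \<omega>) - F xs \<partial>M)
            \<le> (1 - min (\<gamma> * \<mu> / 2) (p / 4)) ^ K * (4 * (T0 + \<gamma> * F2 * \<sigma>0_sq) / \<gamma>))) \<and>
       (\<mu> = 0 \<longrightarrow> (\<forall>K>0.
          (\<integral>\<omega>. F (xbar K \<omega>) - F xs \<partial>M)
            \<le> 4 * (T0 + \<gamma> * F2 * \<sigma>0_sq) / (\<gamma> * real K)))"
proof -
  interpret prob_space M by fact
  interpret ec_lsvrg f n m L \<mu> xs M \<gamma> \<delta> p x0 w0 Q C Z x w e g v
    by unfold_locales (use assms in auto)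
  let ?\<sigma> = "grad_shift_sq n m f xs w0"
  define R where "R = 4 * ((norm (x0 - xs))\<^sup>2 + 8 / (3 * p) * \<gamma>\<^sup>2 * ?\<sigma>
      + \<gamma> * (48 * L * \<gamma>\<^sup>2 * (2 + p) / (\<delta> * p)) * ?\<sigma>) / \<gamma>"
  have R_nonneg: "0 \<le> R"
    unfolding R_def using L \<gamma>_pos \<delta> p grad_shift_sq_nonneg[of w0] by (intro divide_nonneg_nonneg mult_nonneg_nonneg add_nonneg_nonneg) auto
  have bound: "(\<integral>\<omega>. obj (weighted_avg \<eta> x K \<omega>) - obj xs \<partial>M) \<le> 1 / weight_sum \<eta> K * R" for K
    unfolding R_def mult.assoc[of \<gamma>] by (rule expected_avg_gap)
  have linear: "(\<integral>\<omega>. obj (weighted_avg \<eta> x K \<omega>) - obj xs \<partial>M) \<le> (1 - \<eta>) ^ K * R" for K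
    by (rule order_trans[OF bound mult_right_mono[OF inverse_weight_sum_le[OF \<eta>_bounds(1,2)] R_nonneg]])
  have sublinear: "(\<integral>\<omega>. obj (weighted_avg \<eta> x K \<omega>) - obj xs \<partial>M) \<le> R / real K" if "\<mu> = 0" "K > 0" for K
  proof -
    have "\<eta> = 0" unfolding \<eta>_def using that p by simp
    then have "1 / weight_sum \<eta> K \<le> 1 / real K"
      using that by (simp add: weight_sum_0 frac_le)
    from order_trans[OF bound mult_right_mono[OF this R_nonneg]] show ?thesis by simp
  qed
  have rate: "rate \<gamma> \<mu> \<lparr> cA = L, cB1 = 0, cB2 = 0, cD1 = 0,
       cAt = 2 * L, cB1t = 0, cB2t = 2, cD1t = 0,
       cAp = 2 * L, cB1p = 0, cB2p = 2, cD1p = 0,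
       crho1 = 1, cC1 = 0, cG = 0, cD2 = 0,
       crho2 = p, cC2 = L * p,
       cF1 = 0, cF2 = 48 * L * \<gamma>\<^sup>2 * (2 + p) / (\<delta> * p), cD3 = 0 \<rparr> = \<eta>"
    by (rule rate_eq) simp_all
  show ?thesis
    unfolding Let_def rate
    using parametric_assumption_holds avg_gap_integrable linear sublinear
    unfolding R_def \<eta>_def[symmetric] by (simp add: divide_divide_eq_left)
qed

end
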